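(* Consider a splitting method $$\psi_\tau=\varphi^{[a]}_{a_{s+1}\tau}\circ\varphi^{[b]}_{b_s\tau}\circ\varphi^{[a]}_{a_s\tau}\circ\cdots\circ\varphi^{[b]}_{b_1\tau}\circ\varphi^{[a]}_{a_1\tau}$$ with coefficients $a_1,\ldots,a_{s+1},b_1,\ldots,b_s$, applied to systems $x'=f^{[a]}(x)+\varepsilon f^{[b]}(x)$, and put $c_i=\sum_{j=1}^{i}a_j$ for $i=1,\ldots,s+1$. Let $r_1\ge r_2\ge\cdots\ge r_m$. Then the splitting method is of generalized order $(r_1,\ldots,r_m)$ if and only if $c_{s+1}=1$ and $$\sum_{1\le i_1\le\cdots\le i_k\le s}\frac{b_{i_1}\cdots b_{i_k}}{\sigma_{i_1\cdots i_k}}\,c_{i_1}^{j_1-1}\cdots c_{i_k}^{j_k-1}=\frac{1}{(j_1+\cdots+j_k)\cdots(j_1+j_2)\,j_1}$$ holds for $k=1,\ldots,m$ and each Lyndon multi-index $(j_1,\ldots,j_k)$ such that $j_1+\cdots+j_k\le r_k$. For symmetric methods, only Lyndon multi-indices $(j_1,\ldots,j_k)$ with odd $j_1+\cdots+j_k$ need to be considered.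
   Context: Setting: one considers a generic differential equation $x'=f^{[a]}(x)+\varepsilon f^{[b]}(x)$, $x(0)=x_0\in\mathbb{R}^D$, with $|\varepsilon|\ll 1$, where each of the parts $x'=f^{[a]}(x)$ and $x'=\varepsilon f^{[b]}(x)$ is exactly solvable. Here $\varphi_\tau$, $\varphi^{[a]}_\tau$ and $\varphi^{[b]}_\tau$ denote the exact $\tau$-flows of $x'=f^{[a]}(x)+\varepsilon f^{[b]}(x)$, of $x'=f^{[a]}(x)$, and of $x'=\varepsilon f^{[b]}(x)$, respectively (so $\varepsilon$ is included in $\varphi^{[b]}_\tau$). Generalized order: an integration method $\psi_\tau$ for this system is of generalized order $(r_1,r_2,\ldots,r_m)$ (where $r_1\ge r_2\ge\cdots\ge r_m$) if the local error satisfies $$\psi_\tau(x)-\varphi_\tau(x)=\mathcal{O}(\varepsilon\tau^{r_1+1}+\varepsilon^2\tau^{r_2+1}+\cdots+\varepsilon^m\tau^{r_m+1})\quad\text{as }(\tau,\varepsilon)\to(0,0).$$ The method is symmetric if $\psi_{-\tau}=\psi_\tau^{-1}$, or equivalently $a_{s+2-i}=a_i$ and $b_{s+1-i}=b_i$ for all $i$ (the composition is left-right palindromic). The numbers $\sigma_{i_1\cdots i_k}$ (for $i_1\le\cdots\le i_k$) are defined by: $\sigma_{i_1\cdots i_k}=1$ if $i_1<\cdots<i_k$; and $\sigma_{i_1\cdots i_k}=\ell!\,\sigma_{i_{\ell+1}\cdots i_k}$ if $i_1=\cdots=i_\ell<i_{\ell+1}\le\cdots\le i_k$ (with $\sigma=1$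 for the empty sequence). Powers with exponent $0$ equal $1$. A multi-index is a $k$-tuple of positive integers, $k\ge1$. Multi-indices are ordered by the lexicographical order $<$ (the order used when ordering words in the dictionary). A multi-index $(i_1,\ldots,i_n)$ is a Lyndon multi-index if $(i_1,\ldots,i_k)<(i_{k+1},\ldots,i_n)$ for each $1\le k<n$; in particular every multi-index of length one is Lyndon.
   Formalization: Generalized order is read as an expansion in powers of ε: for k=1..m the coefficient of ε^k in the local error is O(τ^{r_k+1}), with remainder O(ε^{m+1}); under the plain bound O(ετ^{r_1+1}+…+ε^mτ^{r_m+1}) the "if" part is false, e.g. for m=1, r_1=3. *)

theory Defs
  imports "HOL-Analysis.Analysis" "HOL-Library.Landau_Symbols"
begin

section \<open>Euclidean space of variable dimension\<close>

text \<open>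
  The order of a method concerns systems in all dimensions \<open>D\<close>, so \<open>D\<close> has to be quantified
  inside a formula and cannot be a type. \<open>\<real>\<^sup>D\<close> is the set of real sequences supported on
  \<open>{..<D}\<close>; on it the product topology of \<^typ>\<open>nat \<Rightarrow> real\<close> is the Euclidean one.
\<close>

definition space_R :: "nat \<Rightarrow> (nat \<Rightarrow> real) set" where
  "space_R D = {x. \<forall>i\<ge>D. x i = 0}"

definition norm_R :: "nat \<Rightarrow> (nat \<Rightarrow> real) \<Rightarrow> real" where
  "norm_R D x = L2_set x {..<D}"

definition partial_deriv :: "nat \<Rightarrow> ((nat \<Rightarrow> real) \<Rightarrow> real) \<Rightarrow> (nat \<Rightarrow> real) \<Rightarrow> real" where
  "partial_deriv j g x = deriv (\<lambda>t. g (x(j := t))) (x j)"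

text \<open>\<open>C_k D n g\<close>: all partial derivatives of \<open>g\<close> on \<open>\<real>\<^sup>D\<close> up to order \<open>n\<close> exist, and those of
  order \<open>n\<close> are continuous.\<close>

primrec C_k :: "nat \<Rightarrow> nat \<Rightarrow> ((nat \<Rightarrow> real) \<Rightarrow> real) \<Rightarrow> bool" where
  "C_k D 0 g \<longleftrightarrow> continuous_on (space_R D) g"
| "C_k D (Suc n) g \<longleftrightarrow>
     (\<forall>j<D. (\<forall>x\<in>space_R D. (\<lambda>t. g (x(j := t))) differentiable (at (x j))) \<and>
            C_k D n (partial_deriv j g))"

definition smooth_field :: "nat \<Rightarrow> ((nat \<Rightarrow> real) \<Rightarrow> nat \<Rightarrow> real) \<Rightarrow> bool" where
  "smooth_field D f \<longleftrightarrow>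
     f \<in> space_R D \<rightarrow> space_R D \<and> (\<forall>i<D. \<forall>n. C_k D n (\<lambda>x. f x i))"


section \<open>Flows and splitting methods\<close>

definition solves_ode ::
  "nat \<Rightarrow> ((nat \<Rightarrow> real) \<Rightarrow> nat \<Rightarrow> real) \<Rightarrow> real set \<Rightarrow> (real \<Rightarrow> nat \<Rightarrow> real) \<Rightarrow> bool" where
  "solves_ode D f T u \<longleftrightarrow>
     (\<forall>t\<in>T. u t \<in> space_R D \<and>
        (\<forall>i<D. ((\<lambda>t. u t i) has_real_derivative f (u t) i) (at t within T)))"

text \<open>
  Solutions of \<open>x' = f(x)\<close> with smooth \<open>f\<close> are unique, so the description below is proper
  whenever a solution starting at \<open>x\<close> exists up to time \<open>\<tau>\<close> (of either sign), which is the case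
  for small \<open>\<tau>\<close>. Otherwise the value is unspecified; this is irrelevant for limits \<open>\<tau> \<rightarrow> 0\<close>.
\<close>

definition flow ::
  "nat \<Rightarrow> ((nat \<Rightarrow> real) \<Rightarrow> nat \<Rightarrow> real) \<Rightarrow> real \<Rightarrow> (nat \<Rightarrow> real) \<Rightarrow> nat \<Rightarrow> real" where
  "flow D f \<tau> x =
     (THE y. \<exists>u. solves_ode D f (closed_segment 0 \<tau>) u \<and> u 0 = x \<and> u \<tau> = y)"

text \<open>\<open>\<phi>\<^sub>A\<close> and \<open>\<phi>\<^sub>B\<close> are the flows of the two parts, with the time as first argument;
  the coefficients are \<open>a 1, \<dots>, a (s + 1)\<close> and \<open>b 1, \<dots>, b s\<close>.\<close>

primrec splitting ::
  "(real \<Rightarrow> 'x \<Rightarrow> 'x) \<Rightarrow> (real \<Rightarrow> 'x \<Rightarrow> 'x) \<Rightarrow> (nat \<Rightarrow> real) \<Rightarrow> (nat \<Rightarrow> real) \<Rightarrow> nat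
    \<Rightarrow> real \<Rightarrow> 'x \<Rightarrow> 'x" where
  "splitting \<phi>\<^sub>A \<phi>\<^sub>B a b 0 \<tau> = \<phi>\<^sub>A (a 1 * \<tau>)"
| "splitting \<phi>\<^sub>A \<phi>\<^sub>B a b (Suc s) \<tau> =
     \<phi>\<^sub>A (a (s + 2) * \<tau>) \<circ> \<phi>\<^sub>B (b (s + 1) * \<tau>) \<circ> splitting \<phi>\<^sub>A \<phi>\<^sub>B a b s \<tau>"


section \<open>Generalized order\<close>

text \<open>
  \<open>err \<epsilon> \<tau>\<close> is \<open>O(\<epsilon> \<tau>^(r 1 + 1) + \<dots> + \<epsilon>^m \<tau>^(r m + 1))\<close> as an expansion in powers of \<open>\<epsilon>\<close>:
  for \<open>1 \<le> k \<le> m\<close> the coefficient of \<open>\<epsilon>^k\<close> is \<open>O(\<tau>^(r k + 1))\<close>, there is no term free of \<open>\<epsilon>\<close>, and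
  what is left is of order \<open>\<epsilon>^(m + 1)\<close>. A mere bound by \<open>\<Sum>k=1..m. \<bar>\<epsilon>\<bar>^k \<bar>\<tau>\<bar>^(r k + 1)\<close> is a different
  condition: it constrains the powers of \<open>\<epsilon>\<close> beyond the \<open>m\<close>-th (if \<open>m = 1\<close> and \<open>r 1 = 3\<close>, it
  excludes an error term \<open>\<epsilon>^2 \<tau>^3\<close>), and if \<open>r\<close> is not convex it does not bound each coefficient
  (if \<open>r = (8, 8, 4)\<close>, it admits \<open>\<epsilon>^2 \<tau>^7\<close>, the geometric mean of \<open>\<epsilon> \<tau>^9\<close> and \<open>\<epsilon>^3 \<tau>^5\<close>).
\<close>

definition error_expansion ::
  "nat \<Rightarrow> nat \<Rightarrow> (nat \<Rightarrow> nat) \<Rightarrow> (real \<Rightarrow> real \<Rightarrow> nat \<Rightarrow> real) \<Rightarrow> bool" where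
  "error_expansion D m r err \<longleftrightarrow>
     (\<exists>R :: nat \<Rightarrow> real \<Rightarrow> nat \<Rightarrow> real.
        (\<forall>k\<in>{1..m}. (\<lambda>\<tau>. norm_R D (R k \<tau>)) \<in> O[at 0](\<lambda>\<tau>. \<tau> ^ (r k + 1))) \<and>
        (\<lambda>(\<tau>, \<epsilon>). norm_R D (\<lambda>i. err \<epsilon> \<tau> i - (\<Sum>k=1..m. \<epsilon> ^ k * R k \<tau> i)))
          \<in> O[at (0, 0)](\<lambda>(\<tau>, \<epsilon>). \<epsilon> ^ (m + 1)))"

text \<open>A method for the systems \<open>x' = f\<^sub>A(x) + \<epsilon> f\<^sub>B(x)\<close>, given as \<open>\<psi> \<epsilon> \<tau> x\<close>.\<close>

definition has_generalized_order ::
  "nat \<Rightarrow> ((nat \<Rightarrow> real) \<Rightarrow> nat \<Rightarrow> real) \<Rightarrow> ((nat \<Rightarrow> real) \<Rightarrow> nat \<Rightarrow> real)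
    \<Rightarrow> (real \<Rightarrow> real \<Rightarrow> (nat \<Rightarrow> real) \<Rightarrow> nat \<Rightarrow> real) \<Rightarrow> nat \<Rightarrow> (nat \<Rightarrow> nat) \<Rightarrow> bool" where
  "has_generalized_order D f\<^sub>A f\<^sub>B \<psi> m r \<longleftrightarrow>
     (\<forall>x\<in>space_R D. error_expansion D m r
        (\<lambda>\<epsilon> \<tau> i. \<psi> \<epsilon> \<tau> x i - flow D (\<lambda>y i. f\<^sub>A y i + \<epsilon> * f\<^sub>B y i) \<tau> x i))"

definition splitting_generalized_order ::
  "(nat \<Rightarrow> real) \<Rightarrow> (nat \<Rightarrow> real) \<Rightarrow> nat \<Rightarrow> nat \<Rightarrow> (nat \<Rightarrow> nat) \<Rightarrow> bool" where
  "splitting_generalized_order a b s m r \<longleftrightarrow>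
     (\<forall>D f\<^sub>A f\<^sub>B. smooth_field D f\<^sub>A \<and> smooth_field D f\<^sub>B \<longrightarrow>
        has_generalized_order D f\<^sub>A f\<^sub>B
          (\<lambda>\<epsilon>. splitting (flow D f\<^sub>A) (flow D (\<lambda>y i. \<epsilon> * f\<^sub>B y i)) a b s) m r)"

definition symmetric_coeffs :: "(nat \<Rightarrow> real) \<Rightarrow> (nat \<Rightarrow> real) \<Rightarrow> nat \<Rightarrow> bool" where
  "symmetric_coeffs a b s \<longleftrightarrow>
     (\<forall>i\<in>{1..s + 1}. a (s + 2 - i) = a i) \<and> (\<forall>i\<in>{1..s}. b (s + 1 - i) = b i)"


section \<open>Order conditions\<close>

text \<open>Multi-indices are nonempty lists of positive integers; \<^const>\<open>lexord\<close> is the strict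
  dictionary order.\<close>

definition lyndon :: "nat list \<Rightarrow> bool" where
  "lyndon js \<longleftrightarrow> js \<noteq> [] \<and> (\<forall>j\<in>set js. 1 \<le> j) \<and>
     (\<forall>k. 1 \<le> k \<and> k < length js \<longrightarrow> (take k js, drop k js) \<in> lexord less_than)"

text \<open>A leading block of \<open>l\<close> equal indices contributes the factor \<open>l!\<close>; for a strictly increasing
  list all blocks have length 1 and the result is 1.\<close>

function sigma :: "nat list \<Rightarrow> real" where
  "sigma [] = 1"
| "sigma (i # is) =
     fact (length (takeWhile (\<lambda>j. j = i) (i # is))) * sigma (dropWhile (\<lambda>j. j = i) (i # is))"
  by pat_completeness auto
termination
  by (relation "Wellfounded.measure length") (auto simp: le_imp_less_Suc length_dropWhile_le)

definition c_coeff :: "(nat \<Rightarrow> real) \<Rightarrow> nat \<Rightarrow> real" where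
  "c_coeff a i = (\<Sum>j=1..i. a j)"

text \<open>The sum runs over all \<open>1 \<le> i\<^sub>1 \<le> \<dots> \<le> i\<^sub>k \<le> s\<close>; list positions start at 0.\<close>

definition order_condition ::
  "(nat \<Rightarrow> real) \<Rightarrow> (nat \<Rightarrow> real) \<Rightarrow> nat \<Rightarrow> nat list \<Rightarrow> bool" where
  "order_condition a b s js \<longleftrightarrow>
     (\<Sum>is | length is = length js \<and> sorted is \<and> set is \<subseteq> {1..s}.
        (\<Prod>l<length js. b (is ! l)) / sigma is *
        (\<Prod>l<length js. c_coeff a (is ! l) ^ (js ! l - 1)))
     = 1 / (\<Prod>l=1..length js. real (sum_list (take l js)))"

end

theory Submission
  imports Defs
begin

text \<open>
  Write the flows as Lie series in words over the two parts of the field, with \<open>\<epsilon>\<close> as an additional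
  coordinate. The local error is then the sum of
  \<open>(\<gamma>(w) - 1/|w|!) \<tau>^|w| \<epsilon>^k L\<^sub>w\<close>, where \<open>k\<close> is the number of letters of the second kind in \<open>w\<close> and
  \<open>\<gamma>(w)\<close> is a coefficient of a product of exponentials. An independent expansion in powers of \<open>\<epsilon>\<close>, uniform
  in \<open>\<tau>\<close>, shows that the coefficient of \<open>\<epsilon>^k\<close> in the error has the Taylor coefficients which the Lie series
  predicts. Expanding the powers of \<open>c\<^sub>l\<^sub>+\<^sub>1 - c\<^sub>l\<close> in \<open>\<gamma>(w)\<close> gives a linear combination of left-hand sides
  \<open>\<alpha>(j\<^sub>1, \<dots>, j\<^sub>k)\<close> of order conditions, and the same combination of the right-hand sides \<open>\<beta>\<close>
  is \<open>1/|w|!\<close>; so the conditions for all multi-indices suffice. They are necessary because polynomial test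
  systems have \<open>\<epsilon>^k \<tau>^(j\<^sub>1 + \<dots> + j\<^sub>k) (\<alpha> - \<beta>)\<close> as a component of the error. Finally, \<open>\<alpha>\<close> and \<open>\<beta>\<close> are
  characters of the shuffle algebra, which are determined by their values at Lyndon multi-indices, and
  for palindromic products the identity \<open>\<psi>\<^sub>-\<^sub>\<tau> \<psi>\<^sub>\<tau> = id\<close> yields the conditions of even weight from
  those of smaller weight.
\<close>

section \<open>Shuffles of multi-indices\<close>

text \<open>The order demands a remainder of size \<epsilon>^(m+1), uniformly in \<tau>. A truncated
  Lie series has a remainder O(\<tau>^N) that carries no power of \<epsilon>, so it cannot supply
  this alone; the expansion in \<epsilon>, in turn, says nothing about how its coefficients behave
  as \<tau> tends to 0. Both are therefore built and then matched on the scale where \<epsilon> is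
  comparable to |\<tau>|^q, on which the two remainders have equal size. Making \<epsilon> a
  coordinate turns a family of systems into one pair of fields, and estimates on a compact cube
  become uniform over all |\<epsilon>| \<le> 1. The term free of \<epsilon> is governed by no
  multi-index; it vanishes because c_(s+1) = 1 makes the unperturbed method exact. That r is
  nonincreasing enters whenever a word or a multi-index is cut: the pieces are shorter, so the bound
  for the whole is also a bound for them.\<close>

fun lex_le :: "nat list \<Rightarrow> nat list \<Rightarrow> bool" where
  "lex_le [] v \<longleftrightarrow> True"
| "lex_le (a # u) [] \<longleftrightarrow> False"
| "lex_le (a # u) (b # v) \<longleftrightarrow> a < b \<or> a = b \<and> lex_le u v"

lemma lex_le_Nil_right [simp]: "lex_le u [] \<longleftrightarrow> u = []"
  by (cases u) auto

lemma lex_le_refl [simp]: "lex_le u u"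
  by (induction u) auto

lemma lex_le_trans: "lex_le u v \<Longrightarrow> lex_le v w \<Longrightarrow> lex_le u w"
proof (induction u v arbitrary: w rule: lex_le.induct)
  case (3 a u b v)
  then show ?case by (cases w) auto
qed auto

lemma lex_le_antisym: "lex_le u v \<Longrightarrow> lex_le v u \<Longrightarrow> u = v"
  by (induction u v rule: lex_le.induct) auto

lemma lex_le_linear: "lex_le u v \<or> lex_le v u"
  by (induction u v rule: lex_le.induct) auto

lemma lex_le_append_self [simp]: "lex_le u (u @ v)"
  by (induction u) auto

lemma lex_le_append_cancel [simp]: "lex_le (p @ u) (p @ v) \<longleftrightarrow> lex_le u v"
  by (induction p) auto

lemma lexord_iff_lex_le: "(u, v) \<in> lexord less_than \<longleftrightarrow> lex_le u v \<and> u \<noteq> v"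
  by (induction u v rule: lex_le.induct) (auto simp: neq_Nil_conv eq_commute[of "[]"])

text \<open>If \<open>u\<close> is no prefix of \<open>v\<close>, the comparison is decided at a
  first differing letter, and it then survives arbitrary continuations of both words.\<close>

lemma lex_le_cases:
  assumes "lex_le u v"
  obtains y where "v = u @ y" | "\<And>y z. \<not> lex_le (v @ z) (u @ y)"
proof -
  have "(\<exists>y. v = u @ y) \<or> (\<forall>y z. \<not> lex_le (v @ z) (u @ y))"
    using assms by (induction u v rule: lex_le.induct) auto
  then show ?thesis using that by blast
qed

lemma finite_lex_le_min:
  "finite S \<Longrightarrow> S \<noteq> {} \<Longrightarrow> \<exists>v\<in>S. \<forall>x\<in>S. lex_le v x"
proof (induction S rule: finite_ne_induct)
  case (insert x F)
  then obtain v where v: "v \<in> F" "\<And>y. y \<in> F \<Longrightarrow> lex_le v y" by blast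
  show ?case
  proof (cases "lex_le x v")
    case True
    then have "lex_le x y" if "y \<in> insert x F" for y
      using that v(2)[of y] lex_le_trans[of x v y] by auto
    then show ?thesis by blast
  next
    case False
    then have "lex_le v x" using lex_le_linear[of x v] by simp
    then have "lex_le v y" if "y \<in> insert x F" for y
      using that v(2)[of y] by auto
    then show ?thesis using v(1) by blast
  qed
qed auto

lemma append_in_shuffles [simp]: "u @ v \<in> shuffles u v"
  by (induction u) (auto simp: Cons_in_shuffles_leftI)

text \<open>Moving the prefix \<open>p\<close> from the larger word \<open>x\<close> to the smaller
  word \<open>y\<close> can only raise the greatest shuffle. A leading letter of \<open>p\<close>
  can be taken from its new place. When \<open>y\<close> supplies the letter, the first letter of
  \<open>x\<close> replaces it: an equal letter joins \<open>p\<close> and the induction goes on, a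
  larger one decides the comparison at once.\<close>

lemma shuffles_exchange:
  "lex_le y x \<Longrightarrow> w \<in> shuffles (p @ x) y \<Longrightarrow> \<exists>w'\<in>shuffles x (p @ y). lex_le w w'"
proof (induction "length p + length x + length y" arbitrary: p x y w rule: less_induct)
  case less
  show ?case
  proof (cases p)
    case Nil
    then show ?thesis using less.prems by (intro bexI[of _ w]) auto
  next
    case (Cons c p')
    have "length w = length (p @ x) + length y"
      using less.prems(2) by (rule length_shuffles)
    then obtain z w0 where w: "w = z # w0" using Cons by (cases w) auto
    consider "c = z" "w0 \<in> shuffles (p' @ x) y"
      | "y \<noteq> []" "hd y = z" "w0 \<in> shuffles (p @ x) (tl y)"
      using less.prems(2) Cons unfolding w by (auto simp: Cons_in_shuffles_iff)
    then show ?thesis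
    proof cases
      case 1
      obtain w' where w': "w' \<in> shuffles x (p' @ y)" "lex_le w0 w'"
        using less.hyps[of p' x y w0] less.prems(1) 1(2) Cons by auto
      then have "c # w' \<in> shuffles x (p @ y)"
        by (auto simp: Cons Cons_in_shuffles_iff)
      then show ?thesis using w'(2) w 1(1) by force
    next
      case 2
      then obtain y' where y: "y = z # y'" by (cases y) auto
      with less.prems(1) obtain b x' where x: "x = b # x'" by (cases x) auto
      show ?thesis
      proof (cases "z = b")
        case True
        then have "lex_le y' x'" using less.prems(1) x y by auto
        moreover have "w0 \<in> shuffles ((p @ [b]) @ x') y'"
          using 2(3) x y by simp
        ultimately obtain w' where w': "w' \<in> shuffles x' ((p @ [b]) @ y')" "lex_le w0 w'"
          using less.hyps[of "p @ [b]" x' y' w0] x y by auto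
        then have "b # w' \<in> shuffles x (p @ y)"
          by (auto simp: x y True Cons_in_shuffles_iff)
        then show ?thesis using w'(2) w True by force
      next
        case False
        then have "z < b" using less.prems(1) x y by auto
        moreover have "b # (x' @ p @ y) \<in> shuffles x (p @ y)"
          using append_in_shuffles[of x "p @ y"] by (simp add: x)
        ultimately show ?thesis unfolding w by (meson lex_le.simps(3))
      qed
    qed
  qed
qed

text \<open>A shuffle that begins with a letter of \<open>u\<close> is covered by induction, since
  the hypothesis passes to suffixes. If it begins with the first letter of \<open>v\<close>, this
  letter is at most the first one of \<open>u\<close>. A smaller letter settles the comparison; for
  an equal one \<open>shuffles_exchange\<close> trades the rest for a larger shuffle of the tail of
  \<open>u\<close> with all of \<open>v\<close>.\<close>

lemma shuffles_le_append:
  assumes "\<And>x y. u = y @ x \<Longrightarrow> x \<noteq> [] \<Longrightarrow> lex_le v x" "w \<in> shuffles u v"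
  shows "lex_le w (u @ v)"
  using assms
proof (induction u arbitrary: w)
  case Nil
  then show ?case by simp
next
  case (Cons a u)
  have IH: "lex_le w' (u @ v)" if "w' \<in> shuffles u v" for w'
    using Cons.IH[OF _ that] Cons.prems(1) by (metis append_Cons)
  have vle: "lex_le v (a # u)" using Cons.prems(1)[of "[]" "a # u"] by simp
  have "length w = length (a # u) + length v"
    using Cons.prems(2) by (rule length_shuffles)
  then obtain z w0 where w: "w = z # w0" by (cases w) auto
  consider "z = a" "w0 \<in> shuffles u v"
    | "v \<noteq> []" "hd v = z" "w0 \<in> shuffles (a # u) (tl v)"
    using Cons.prems(2) unfolding w by (auto simp: Cons_in_shuffles_iff)
  then show ?case
  proof cases
    case 1
    then show ?thesis using IH w by auto
  next
    case 2
    then obtain v' where v: "v = z # v'" by (cases v) auto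
    show ?thesis
    proof (cases "z = a")
      case True
      then have "lex_le v' u" using vle v by auto
      moreover have "w0 \<in> shuffles ([a] @ u) v'" using 2 v by simp
      ultimately obtain w' where "w' \<in> shuffles u ([a] @ v')" "lex_le w0 w'"
        using shuffles_exchange by blast
      then have "lex_le w0 (u @ v)" using IH v True lex_le_trans by auto
      then show ?thesis using w True by simp
    next
      case False
      then show ?thesis using vle v w by auto
    qed
  qed
qed

text \<open>The word \<open>v\<close> is the least proper suffix. Suppose that \<open>x\<close> is
  smaller than \<open>v\<close>. A shorter suffix \<open>x\<close> of \<open>u\<close> gives the
  proper suffix \<open>x @ v\<close>, so \<open>v\<close> is at most \<open>x @ v\<close>. This
  excludes a first differing letter, and if \<open>v = x @ z\<close> it cancels to \<open>z\<close>
  being at most \<open>v\<close>; as \<open>z\<close> is itself a proper suffix,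
  \<open>z = v\<close>, which is absurd for nonempty \<open>x\<close>.\<close>

lemma nonlyndon_split:
  assumes "js \<noteq> []" "\<forall>j\<in>set js. 1 \<le> j" "\<not> lyndon js"
  obtains u v where "js = u @ v" "u \<noteq> []" "v \<noteq> []"
    "\<And>x y. u = y @ x \<Longrightarrow> x \<noteq> [] \<Longrightarrow> lex_le v x"
proof -
  define S where "S = {q. \<exists>p. js = p @ q \<and> p \<noteq> [] \<and> q \<noteq> []}"
  obtain k where k: "1 \<le> k" "k < length js" "\<not> (lex_le (take k js) (drop k js) \<and> take k js \<noteq> drop k js)"
    using assms unfolding lyndon_def lexord_iff_lex_le by blast
  define p q where "p = take k js" and "q = drop k js"
  have pq: "js = p @ q" "p \<noteq> []" "q \<noteq> []" using k by (auto simp: p_def q_def)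
  have qp: "lex_le q p" using k(3) lex_le_linear lex_le_refl unfolding p_def q_def by metis
  have "S \<subseteq> (\<lambda>n. drop n js) ` {..length js}"
  proof
    fix x assume "x \<in> S"
    then obtain y where "js = y @ x" unfolding S_def by blast
    then have "x = drop (length y) js" "length y \<le> length js" by auto
    then show "x \<in> (\<lambda>n. drop n js) ` {..length js}" by blast
  qed
  then have "finite S" by (rule finite_subset) simp
  moreover have "q \<in> S" using pq unfolding S_def by blast
  ultimately obtain v where v: "v \<in> S" "\<And>x. x \<in> S \<Longrightarrow> lex_le v x"
    using finite_lex_le_min[of S] by blast
  then obtain u where u: "js = u @ v" "u \<noteq> []" "v \<noteq> []" unfolding S_def by blast
  have vq: "lex_le v q" using v(2) \<open>q \<in> S\<close> .
  have vp: "lex_le v p" using vq qp lex_le_trans by blast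
  have tails: "lex_le v z" if "v = x @ z" "z \<noteq> []" for x z
    using that u v(2) unfolding S_def by auto
  have "lex_le v x" if x: "u = y @ x" "x \<noteq> []" for x y
  proof (rule ccontr)
    assume n: "\<not> lex_le v x"
    then have xv: "lex_le x v" "x \<noteq> v" using lex_le_linear lex_le_refl by blast+
    \<comment> \<open>For \<open>x = u\<close> the word \<open>x @ v\<close> is all of
      \<open>js\<close>, on which minimality is silent. The cut \<open>p\<close>, \<open>q\<close>
      that violates the Lyndon property helps instead: \<open>v\<close> is at most \<open>q\<close>,
      hence at most \<open>p\<close>, so \<open>p\<close> cannot be a prefix of
      \<open>u\<close>.\<close>
    have whole: "\<exists>t. t \<noteq> [] \<and> p = u @ t \<and> v = t @ q" if "y = []"
    proof -
      have "u @ v = p @ q" using u pq by simp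
      then consider t where "u = p @ t" | t where "t \<noteq> []" "p = u @ t" "v = t @ q"
        unfolding append_eq_append_conv2 using append_Nil2[of u] by metis
      then show ?thesis
      proof cases
        case 1
        then have "lex_le v u" using vp lex_le_trans lex_le_append_self by blast
        then show ?thesis using n x that by simp
      qed blast
    qed
    from xv(1) show False
    proof (cases rule: lex_le_cases)
      case (1 z)
      have z: "z \<noteq> []" using 1 xv by auto
      then have vz: "lex_le v z" using tails 1 by blast
      have "lex_le z v"
      proof (cases "y = []")
        case False
        have "js = y @ (x @ v)" "x @ v \<noteq> []" using u x by auto
        then have "x @ v \<in> S" using False unfolding S_def by blast
        then have "lex_le v (x @ v)" by (rule v(2))
        then show ?thesis using 1 by simp
      next
        case True
        then obtain t where t: "t \<noteq> []" "p = u @ t" "v = t @ q" using whole by blast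
        have "lex_le (u @ z) (u @ t)" using vp 1 t x True by simp
        then have "lex_le z t" by simp
        then show ?thesis using t lex_le_trans lex_le_append_self by blast
      qed
      then have "z = v" using vz lex_le_antisym by blast
      then show False using 1 x by simp
    next
      case 2
      show False
      proof (cases "y = []")
        case False
        have "js = y @ (x @ v)" "x @ v \<noteq> []" using u x by auto
        then have "x @ v \<in> S" using False unfolding S_def by blast
        then have "lex_le v (x @ v)" by (rule v(2))
        then show ?thesis using 2[of "[]" v] by simp
      next
        case True
        then obtain t where "p = x @ t" using whole x by auto
        then show ?thesis using vp 2[of "[]" t] by simp
      qed
    qed
  qed
  then show thesis using that u by blast
qed

text \<open>The linear extension of \<open>f\<close> evaluated at the shuffle product. Unlike the
  set \<open>shuffles u v\<close>, it counts each word with its multiplicity, as the character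
  identity requires.\<close>

fun shuffle_sum :: "(nat list \<Rightarrow> real) \<Rightarrow> nat list \<Rightarrow> nat list \<Rightarrow> real" where
  "shuffle_sum f [] v = f v"
| "shuffle_sum f (a # u) [] = f (a # u)"
| "shuffle_sum f (a # u) (b # v) =
     shuffle_sum (\<lambda>w. f (a # w)) u (b # v) + shuffle_sum (\<lambda>w. f (b # w)) (a # u) v"

lemma shuffle_sum_Nil [simp]: "shuffle_sum f u [] = f u"
  by (cases u) auto

text \<open>The recursion at the other end. It is the useful one here, because both sides of the
  order conditions are recursive in the last index.\<close>

lemma shuffle_sum_snoc:
  "shuffle_sum f (u @ [a]) (v @ [b]) =
     shuffle_sum (\<lambda>w. f (w @ [a])) u (v @ [b]) + shuffle_sum (\<lambda>w. f (w @ [b])) (u @ [a]) v"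
proof (induction "length u + length v" arbitrary: u v f rule: less_induct)
  case less
  show ?case
  proof (cases u; cases v)
    fix x u' y v' assume uv: "u = x # u'" "v = y # v'"
    show ?thesis
      using less[of u' v "\<lambda>w. f (x # w)"] less[of u v' "\<lambda>w. f (y # w)"] by (simp add: uv)
  next
    fix y v' assume uv: "u = []" "v = y # v'"
    show ?thesis using less[of u v' "\<lambda>w. f (y # w)"] by (simp add: uv)
  next
    fix x u' assume uv: "u = x # u'" "v = []"
    show ?thesis using less[of u' v "\<lambda>w. f (x # w)"] by (simp add: uv)
  qed simp
qed

lemma shuffle_sum_diff:
  "shuffle_sum (\<lambda>w. f w - g w) u v = shuffle_sum f u v - shuffle_sum g u v"
  by (induction "\<lambda>w. f w - g w" u v arbitrary: f g rule: shuffle_sum.induct) simp_all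

lemma shuffle_sum_cmult: "shuffle_sum (\<lambda>w. c * f w) u v = c * shuffle_sum f u v"
  by (induction "\<lambda>w. c * f w" u v arbitrary: f rule: shuffle_sum.induct)
    (simp_all add: algebra_simps)

lemma shuffle_sum_cong:
  "(\<And>w. w \<in> shuffles u v \<Longrightarrow> f w = g w) \<Longrightarrow> shuffle_sum f u v = shuffle_sum g u v"
proof (induction f u v arbitrary: g rule: shuffle_sum.induct)
  case (3 f a u b v)
  have "shuffle_sum (\<lambda>w. f (a # w)) u (b # v) = shuffle_sum (\<lambda>w. g (a # w)) u (b # v)"
    by (rule 3(1)) (use 3(3) in \<open>auto simp: Cons_in_shuffles_iff\<close>)
  moreover have "shuffle_sum (\<lambda>w. f (b # w)) (a # u) v = shuffle_sum (\<lambda>w. g (b # w)) (a # u) v"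
    by (rule 3(2)) (use 3(3) in \<open>auto simp: Cons_in_shuffles_iff\<close>)
  ultimately show ?case by simp
qed auto

lemma shuffle_sum_single:
  assumes "\<And>w. w \<in> shuffles u v \<Longrightarrow> w \<noteq> z \<Longrightarrow> f w = 0"
  shows "\<exists>n::nat. (z \<in> shuffles u v \<longrightarrow> n > 0) \<and> shuffle_sum f u v = of_nat n * f z"
proof -
  \<comment> \<open>The multiplicity is chosen before \<open>f\<close>: the recursion changes
    \<open>f\<close>, and the two branches have to be added with fixed numbers.\<close>
  have "\<exists>n::nat. (z \<in> shuffles u v \<longrightarrow> n > 0) \<and>
      (\<forall>f. (\<forall>w\<in>shuffles u v. w \<noteq> z \<longrightarrow> f w = 0) \<longrightarrow> shuffle_sum f u v = of_nat n * f z)"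
  proof (induction u v arbitrary: z rule: shuffles.induct)
    case (1 v)
    show ?case by (rule exI[of _ "if z = v then 1 else 0"]) auto
  next
    case (2 u)
    show ?case by (rule exI[of _ "if z = u then 1 else 0"]) auto
  next
    case (3 a u b v)
    show ?case
    proof (cases z)
      case Nil
      have *: "shuffle_sum f (a # u) (b # v) = 0" if f: "\<forall>w\<in>shuffles (a # u) (b # v). w \<noteq> z \<longrightarrow> f w = 0" for f
      proof -
        have "shuffle_sum f (a # u) (b # v) = shuffle_sum (\<lambda>w. 0 * f w) (a # u) (b # v)"
          by (rule shuffle_sum_cong) (use f Nil in \<open>auto simp: Cons_in_shuffles_iff\<close>)
        then show ?thesis unfolding shuffle_sum_cmult by simp
      qed
      show ?thesis by (rule exI[of _ 0]) (use * Nil in auto)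
    next
      case (Cons c z')
      obtain n1 where n1: "z' \<in> shuffles u (b # v) \<longrightarrow> n1 > (0::nat)"
        "\<And>f. (\<forall>w\<in>shuffles u (b # v). w \<noteq> z' \<longrightarrow> f w = 0) \<Longrightarrow> shuffle_sum f u (b # v) = of_nat n1 * f z'"
        using 3(1)[of z'] by blast
      obtain n2 where n2: "z' \<in> shuffles (a # u) v \<longrightarrow> n2 > (0::nat)"
        "\<And>f. (\<forall>w\<in>shuffles (a # u) v. w \<noteq> z' \<longrightarrow> f w = 0) \<Longrightarrow> shuffle_sum f (a # u) v = of_nat n2 * f z'"
        using 3(2)[of z'] by blast
      have zero: "shuffle_sum f u v = 0" if "\<forall>w\<in>shuffles u v. f w = 0" for f u v
        using shuffle_sum_cong[of u v f "\<lambda>w. 0 * f w"] that unfolding shuffle_sum_cmult by simp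
      let ?n = "(if c = a then n1 else 0) + (if c = b then n2 else 0)"
      have "shuffle_sum f (a # u) (b # v) = of_nat ?n * f z"
        if f: "\<forall>w\<in>shuffles (a # u) (b # v). w \<noteq> z \<longrightarrow> f w = 0" for f
      proof -
        have "shuffle_sum (\<lambda>w. f (a # w)) u (b # v) = of_nat (if c = a then n1 else 0) * f z"
        proof (cases "c = a")
          case True
          then show ?thesis using n1(2)[of "\<lambda>w. f (a # w)"] f Cons
            by (auto simp: Cons_in_shuffles_iff)
        next
          case False
          then show ?thesis using zero[of u "b # v" "\<lambda>w. f (a # w)"] f Cons
            by (auto simp: Cons_in_shuffles_iff)
        qed
        moreover have "shuffle_sum (\<lambda>w. f (b # w)) (a # u) v = of_nat (if c = b then n2 else 0) * f z"
        proof (cases "c = b")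
          case True
          then show ?thesis using n2(2)[of "\<lambda>w. f (b # w)"] f Cons
            by (auto simp: Cons_in_shuffles_iff)
        next
          case False
          then show ?thesis using zero[of "a # u" v "\<lambda>w. f (b # w)"] f Cons
            by (auto simp: Cons_in_shuffles_iff)
        qed
        ultimately show ?thesis by (simp add: algebra_simps)
      qed
      moreover have "z \<in> shuffles (a # u) (b # v) \<longrightarrow> ?n > 0"
        using n1(1) n2(1) by (auto simp: Cons Cons_in_shuffles_iff)
      ultimately show ?thesis by blast
    qed
  qed
  then show ?thesis using assms by blast
qed

text \<open>If \<open>u @ v\<close> is not Lyndon and \<open>v\<close> is its least suffix, then \<open>u @ v\<close> is the greatest
  of the shuffles of \<open>u\<close> and \<open>v\<close>. So the value of a character at \<open>u @ v\<close> is determined by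
  its values at shorter words and at lexicographically smaller rearrangements.\<close>

lemma shuffle_characters_eqI:
  assumes f: "\<And>u v. \<forall>j\<in>set (u @ v). 1 \<le> j \<Longrightarrow> shuffle_sum f u v = f u * f v"
    and g: "\<And>u v. \<forall>j\<in>set (u @ v). 1 \<le> j \<Longrightarrow> shuffle_sum g u v = g u * g v"
    and P: "\<And>u v. P (u @ v) \<Longrightarrow> u \<noteq> [] \<Longrightarrow> v \<noteq> [] \<Longrightarrow> P u \<and> P v"
      "\<And>w w'. mset w = mset w' \<Longrightarrow> P w \<Longrightarrow> P w'"
    and eq: "\<And>js. lyndon js \<Longrightarrow> P js \<Longrightarrow> f js = g js"
    and js: "js \<noteq> []" "\<forall>j\<in>set js. 1 \<le> j" "P js"
  shows "f js = g js"
proof -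
  \<comment> \<open>The dictionary order is not well-founded on words of unbounded length. Comparing
    lengths first repairs this and also admits the factors \<open>u\<close> and
    \<open>v\<close>.\<close>
  have "wf (lenlex less_than)" by blast
  then show ?thesis using js
  proof (induction js rule: wf_induct_rule)
    case (less js)
    show ?case
    proof (cases "lyndon js")
      case True
      then show ?thesis using eq less.prems by blast
    next
      case False
      obtain u v where uv: "js = u @ v" "u \<noteq> []" "v \<noteq> []"
        "\<And>x y. u = y @ x \<Longrightarrow> x \<noteq> [] \<Longrightarrow> lex_le v x"
        using nonlyndon_split[OF less.prems(1,2) False] by blast
      have pos: "\<forall>j\<in>set (u @ v). 1 \<le> j" using less.prems uv by simp
      have Puv: "P u" "P v" using P(1)[of u v] less.prems uv by auto
      have "f u = g u"
        by (rule less.IH) (use uv less.prems Puv in \<open>auto simp: lenlex_conv\<close>)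
      moreover have "f v = g v"
        by (rule less.IH) (use uv less.prems Puv in \<open>auto simp: lenlex_conv\<close>)
      ultimately have "shuffle_sum (\<lambda>w. f w - g w) u v = 0"
        unfolding shuffle_sum_diff f[OF pos] g[OF pos] by simp
      moreover have "f w - g w = 0" if w: "w \<in> shuffles u v" "w \<noteq> js" for w
      proof -
        have len: "length w = length js" using w(1) length_shuffles uv by fastforce
        have ms: "mset w = mset js" using mset_shuffles[OF w(1)] uv by simp
        have "lex_le w js" using shuffles_le_append[OF uv(4) w(1)] uv(1) by simp
        then have "(w, js) \<in> lenlex less_than"
          using w(2) len by (auto simp: lenlex_conv lexord_lex lexord_iff_lex_le)
        moreover have "w \<noteq> []" using len less.prems(1) by auto
        moreover have "\<forall>j\<in>set w. 1 \<le> j" using ms less.prems(2) by (metis mset_eq_setD)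
        moreover have "P w" using P(2) ms less.prems(3) by metis
        ultimately show ?thesis using less.IH by simp
      qed
      then obtain n :: nat where n: "js \<in> shuffles u v \<longrightarrow> n > 0"
        "shuffle_sum (\<lambda>w. f w - g w) u v = of_nat n * (f js - g js)"
        using shuffle_sum_single[of u v js "\<lambda>w. f w - g w"] by blast
      moreover have "js \<in> shuffles u v" using append_in_shuffles uv(1) by simp
      ultimately show ?thesis by auto
    qed
  qed
qed

section \<open>Both sides of the order conditions as shuffle characters\<close>

text \<open>Effect on the index sums of one further node \<open>c\<close> with weight
  \<open>t\<close>: the last \<open>n\<close> indices are placed at the new node, with the divided
  power t^n / n!, and the others are left to \<open>f\<close>. It is the convolution of
  \<open>f\<close> with an exponential.\<close>

definition pulse :: "(nat list \<Rightarrow> real) \<Rightarrow> real \<Rightarrow> real \<Rightarrow> nat list \<Rightarrow> real" where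
  "pulse f c t js = (\<Sum>n\<le>length js. f (take (length js - n) js) * (t ^ n / fact n) *
     prod_list (map (\<lambda>j. c ^ (j - 1)) (drop (length js - n) js)))"

primrec alpha :: "(nat \<Rightarrow> real) \<Rightarrow> (nat \<Rightarrow> real) \<Rightarrow> nat \<Rightarrow> nat list \<Rightarrow> real" where
  "alpha b c 0 js = (if js = [] then 1 else 0)"
| "alpha b c (Suc s) js = pulse (alpha b c s) (c (Suc s)) (b (Suc s)) js"

text \<open>This is the integral of x_1^(j_1 - 1) ... x_k^(j_k - 1) over the simplex 0 \<le> x_1
  \<le> ... \<le> x_k \<le> 1, the continuous counterpart of the sum over nodes.\<close>

definition beta :: "nat list \<Rightarrow> real" where
  "beta js = 1 / (\<Prod>l=1..length js. real (sum_list (take l js)))"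

lemma pulse_Nil [simp]: "pulse f c t [] = f []"
  by (simp add: pulse_def)

lemma pulse_0 [simp]: "pulse f c 0 js = f js"
proof -
  have "pulse f c 0 js = (\<Sum>n\<le>length js. if n = 0 then f js else 0)"
    unfolding pulse_def by (rule sum.cong) auto
  then show ?thesis by simp
qed

lemma pulse_snoc:
  "pulse f c t (js @ [a]) = f (js @ [a]) + (\<Sum>n\<le>length js. f (take (length js - n) js) *
     (t ^ Suc n / fact (Suc n)) * prod_list (map (\<lambda>j. c ^ (j - 1)) (drop (length js - n) js)) * c ^ (a - 1))"
proof -
  have "pulse f c t (js @ [a]) = (\<Sum>n\<le>Suc (length js). f (take (Suc (length js) - n) (js @ [a])) * (t ^ n / fact n) *
     prod_list (map (\<lambda>j. c ^ (j - 1)) (drop (Suc (length js) - n) (js @ [a]))))"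
    unfolding pulse_def by simp
  also have "\<dots> = f (js @ [a]) + (\<Sum>n\<le>length js. f (take (length js - n) (js @ [a])) * (t ^ Suc n / fact (Suc n)) *
     prod_list (map (\<lambda>j. c ^ (j - 1)) (drop (length js - n) (js @ [a]))))"
    by (subst sum.atMost_Suc_shift) (simp del: fact_Suc power_Suc)
  also have "(\<Sum>n\<le>length js. f (take (length js - n) (js @ [a])) * (t ^ Suc n / fact (Suc n)) *
     prod_list (map (\<lambda>j. c ^ (j - 1)) (drop (length js - n) (js @ [a])))) =
     (\<Sum>n\<le>length js. f (take (length js - n) js) *
     (t ^ Suc n / fact (Suc n)) * prod_list (map (\<lambda>j. c ^ (j - 1)) (drop (length js - n) js)) * c ^ (a - 1))"
    by (rule sum.cong) (simp_all del: fact_Suc power_Suc)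
  finally show ?thesis .
qed

text \<open>Differentiation lowers the divided powers by one. This equation serves twice: for the
  shuffle identity, and to recognize \<open>pulse\<close> as the flow of the second part of the test
  systems.\<close>

lemma pulse_deriv_snoc:
  "((\<lambda>t. pulse f c t (js @ [a])) has_real_derivative c ^ (a - 1) * pulse f c t js) (at t)"
proof -
  have *: "((\<lambda>t. t ^ Suc n / fact (Suc n)) has_real_derivative t ^ n / fact n) (at t)" for n
  proof -
    have "((\<lambda>t::real. t ^ Suc n) has_real_derivative real (Suc n) * t ^ n) (at t)"
      using DERIV_pow[of "Suc n" t] by simp
    then have "((\<lambda>t. t ^ Suc n / fact (Suc n)) has_real_derivative real (Suc n) * t ^ n / fact (Suc n)) (at t)"
      by (rule DERIV_cdivide)
    then show ?thesis by (simp add: fact_Suc del: power_Suc)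
  qed
  have "((\<lambda>t. f (js @ [a]) + (\<Sum>n\<le>length js. f (take (length js - n) js) *
     (t ^ Suc n / fact (Suc n)) * prod_list (map (\<lambda>j. c ^ (j - 1)) (drop (length js - n) js)) * c ^ (a - 1)))
     has_real_derivative 0 + (\<Sum>n\<le>length js. f (take (length js - n) js) *
     (t ^ n / fact n) * prod_list (map (\<lambda>j. c ^ (j - 1)) (drop (length js - n) js)) * c ^ (a - 1))) (at t)"
    by (intro DERIV_add DERIV_const DERIV_sum DERIV_cmult_right DERIV_cmult *)
  then show ?thesis unfolding pulse_snoc
    by (simp add: pulse_def sum_distrib_left mult_ac del: power_Suc fact_Suc)
qed

lemma pulse_shuffle_sum_deriv:
  assumes "\<And>w. ((\<lambda>t. f t w) has_real_derivative f' t w) (at t)"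
  shows "((\<lambda>t. shuffle_sum (f t) u v) has_real_derivative shuffle_sum (f' t) u v) (at t)"
  using assms
proof (induction "length u + length v" arbitrary: u v f f' rule: less_induct)
  case less
  show ?case
  proof (cases u; cases v)
    fix x u' y v' assume uv: "u = x # u'" "v = y # v'"
    show ?thesis unfolding uv shuffle_sum.simps
      by (intro DERIV_add less.hyps) (use uv less.prems in auto)
  qed (use less.prems in auto)
qed

text \<open>Both sides of the shuffle identity have the same derivative with respect to the weight
  of the pulse, since the last letter of a shuffle is the last letter of one of the factors.\<close>

lemma pulse_character:
  assumes f: "\<And>u v. shuffle_sum f u v = f u * f v" "f [] = 1"
  shows "shuffle_sum (pulse f c t) u v = pulse f c t u * pulse f c t v"
proof (induction "length u + length v" arbitrary: u v t rule: less_induct)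
  case less
  show ?case
  proof (cases u rule: rev_cases; cases v rule: rev_cases)
    fix u' a v' b assume uv: "u = u' @ [a]" "v = v' @ [b]"
    have IH1: "shuffle_sum (pulse f c t) u' v = pulse f c t u' * pulse f c t v" for t
      by (rule less) (simp add: uv)
    have IH2: "shuffle_sum (pulse f c t) u v' = pulse f c t u * pulse f c t v'" for t
      by (rule less) (simp add: uv)
    define h where "h = (\<lambda>t. shuffle_sum (pulse f c t) u v - pulse f c t u * pulse f c t v)"
    have "(h has_real_derivative 0) (at t)" for t
    proof -
      have "((\<lambda>t. shuffle_sum (\<lambda>w. pulse f c t (w @ [a])) u' v) has_real_derivative
          shuffle_sum (\<lambda>w. c ^ (a - 1) * pulse f c t w) u' v) (at t)"
        by (rule pulse_shuffle_sum_deriv) (rule pulse_deriv_snoc)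
      moreover have "((\<lambda>t. shuffle_sum (\<lambda>w. pulse f c t (w @ [b])) u v') has_real_derivative
          shuffle_sum (\<lambda>w. c ^ (b - 1) * pulse f c t w) u v') (at t)"
        by (rule pulse_shuffle_sum_deriv) (rule pulse_deriv_snoc)
      moreover have "((\<lambda>t. pulse f c t u * pulse f c t v) has_real_derivative
          c ^ (a - 1) * pulse f c t u' * pulse f c t v + c ^ (b - 1) * pulse f c t v' * pulse f c t u) (at t)"
        unfolding uv by (rule DERIV_mult[OF pulse_deriv_snoc pulse_deriv_snoc])
      ultimately have "((\<lambda>t. shuffle_sum (\<lambda>w. pulse f c t (w @ [a])) u' v +
            shuffle_sum (\<lambda>w. pulse f c t (w @ [b])) u v' - pulse f c t u * pulse f c t v) has_real_derivative
          shuffle_sum (\<lambda>w. c ^ (a - 1) * pulse f c t w) u' v +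
          shuffle_sum (\<lambda>w. c ^ (b - 1) * pulse f c t w) u v' -
          (c ^ (a - 1) * pulse f c t u' * pulse f c t v + c ^ (b - 1) * pulse f c t v' * pulse f c t u)) (at t)"
        by (intro DERIV_add DERIV_diff)
      moreover have "shuffle_sum (\<lambda>w. c ^ (a - 1) * pulse f c t w) u' v +
          shuffle_sum (\<lambda>w. c ^ (b - 1) * pulse f c t w) u v' -
          (c ^ (a - 1) * pulse f c t u' * pulse f c t v + c ^ (b - 1) * pulse f c t v' * pulse f c t u) = 0"
        unfolding shuffle_sum_cmult IH1 IH2 by simp
      ultimately show ?thesis unfolding h_def uv shuffle_sum_snoc by simp
    qed
    then have "h t = h 0" by (rule DERIV_isconst_all[rule_format])
    moreover have "pulse f c 0 = f" by (rule ext) simp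
    ultimately show ?thesis by (simp add: h_def f(1))
  qed (use f(2) in auto)
qed

lemma alpha_Nil [simp]: "alpha b c s [] = 1"
  by (induction s) auto

lemma alpha_character: "shuffle_sum (alpha b c s) u v = alpha b c s u * alpha b c s v"
proof (induction s arbitrary: u v)
  case 0
  have "shuffle_sum (\<lambda>w. 0 * (1::real)) u v = 0" for u v
    using shuffle_sum_cmult[of 0 "\<lambda>_. 1"] by simp
  then show ?case by (cases u; cases v) auto
next
  case (Suc s)
  have "alpha b c (Suc s) = pulse (alpha b c s) (c (Suc s)) (b (Suc s))"
    by (rule ext) simp
  then show ?case using pulse_character[OF Suc.IH] by simp
qed

lemma beta_Nil [simp]: "beta [] = 1"
  by (simp add: beta_def)

lemma beta_snoc: "beta (js @ [a]) = beta js / real (sum_list (js @ [a]))"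
proof -
  have "(\<Prod>l=1..length js. real (sum_list (take l (js @ [a])))) =
      (\<Prod>l=1..length js. real (sum_list (take l js)))"
    by (rule prod.cong) auto
  moreover have "(\<Prod>l=1..length (js @ [a]). real (sum_list (take l (js @ [a])))) =
      (\<Prod>l=1..length js. real (sum_list (take l (js @ [a])))) * real (sum_list (js @ [a]))"
    by simp
  ultimately show ?thesis unfolding beta_def by simp
qed

lemma sum_list_shuffles: "w \<in> shuffles u v \<Longrightarrow> sum_list w = sum_list u + sum_list (v :: nat list)"
  using mset_shuffles[of w u v] by (metis mset_append sum_list_append sum_mset_sum_list)

text \<open>Every shuffle has weight U + V, so both branches of the last-letter recursion have this
  common denominator, and 1/U + 1/V = (U + V)/(U V) combines them. Positive indices make U and V
  nonzero.\<close>

lemma beta_character: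
  "\<forall>j\<in>set (u @ v). 1 \<le> j \<Longrightarrow> shuffle_sum beta u v = beta u * beta v"
proof (induction "length u + length v" arbitrary: u v rule: less_induct)
  case less
  show ?case
  proof (cases u rule: rev_cases; cases v rule: rev_cases)
    fix u' a v' b assume uv: "u = u' @ [a]" "v = v' @ [b]"
    define U where "U = real (sum_list u)"
    define V where "V = real (sum_list v)"
    have pos: "U > 0" "V > 0" using less.prems unfolding U_def V_def uv by auto
    have IH1: "shuffle_sum beta u' v = beta u' * beta v"
      by (rule less) (use uv less.prems in auto)
    have IH2: "shuffle_sum beta u v' = beta u * beta v'"
      by (rule less) (use uv less.prems in auto)
    have "shuffle_sum (\<lambda>w. beta (w @ [a])) u' v = 1 / (U + V) * shuffle_sum beta u' v"
      unfolding shuffle_sum_cmult[symmetric] by (rule shuffle_sum_cong) (simp add: beta_snoc sum_list_shuffles U_def V_def uv add_ac)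
    moreover have "shuffle_sum (\<lambda>w. beta (w @ [b])) u v' = 1 / (U + V) * shuffle_sum beta u v'"
      unfolding shuffle_sum_cmult[symmetric] by (rule shuffle_sum_cong) (simp add: beta_snoc sum_list_shuffles U_def V_def uv add_ac)
    ultimately have "shuffle_sum beta u v = 1 / (U + V) * (beta u' * beta v) + 1 / (U + V) * (beta u * beta v')"
      unfolding uv shuffle_sum_snoc using IH1 IH2 unfolding uv by simp
    moreover have "beta u = beta u' / U" "beta v = beta v' / V"
      unfolding uv beta_snoc U_def V_def by auto
    moreover have "1 / (U + V) * (x * (y / V)) + 1 / (U + V) * (x / U * y) = x / U * (y / V)" for x y
    proof -
      have "1 / (U + V) * (x * (y / V)) + 1 / (U + V) * (x / U * y) = x * y / (U + V) * (1 / V + 1 / U)"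
        using pos by (simp add: divide_simps) (simp add: algebra_simps)
      also have "1 / V + 1 / U = (U + V) / (U * V)"
        using pos by (simp add: field_simps)
      finally show ?thesis using pos by simp
    qed
    ultimately show ?thesis by simp
  qed auto
qed

text \<open>The conditions with weight bounded by \<open>r\<close> form an admissible class for the
  induction: rearranging preserves length and weight, and a factor is shorter, so the bound for the
  whole multi-index is at most the bound for the factor.\<close>

lemma alpha_eq_beta_of_lyndon:
  assumes "\<And>k l. 1 \<le> k \<Longrightarrow> k \<le> l \<Longrightarrow> l \<le> m \<Longrightarrow> r l \<le> (r k :: nat)"
    and "\<And>js. lyndon js \<Longrightarrow> length js \<le> m \<Longrightarrow> sum_list js \<le> r (length js) \<Longrightarrow> alpha b c s js = beta js"
    and "js \<noteq> []" "\<forall>j\<in>set js. 1 \<le> j" "length js \<le> m" "sum_list js \<le> r (length js)"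
  shows "alpha b c s js = beta js"
proof (rule shuffle_characters_eqI[where P = "\<lambda>w. length w \<le> m \<and> sum_list w \<le> r (length w)"])
  fix u v :: "nat list" assume *: "length (u @ v) \<le> m \<and> sum_list (u @ v) \<le> r (length (u @ v))"
    "u \<noteq> []" "v \<noteq> []"
  have "r (length (u @ v)) \<le> r (length u)" "r (length (u @ v)) \<le> r (length v)"
    by (rule assms(1); use * in \<open>simp add: Suc_le_eq\<close>)+
  then show "(length u \<le> m \<and> sum_list u \<le> r (length u)) \<and> (length v \<le> m \<and> sum_list v \<le> r (length v))"
    using * by auto
next
  fix w w' :: "nat list" assume *: "mset w = mset w'" "length w \<le> m \<and> sum_list w \<le> r (length w)"
  have "length w = length w'" using *(1) mset_eq_length by blast
  moreover have "sum_list w = sum_list w'" using *(1) by (metis sum_mset_sum_list)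
  ultimately show "length w' \<le> m \<and> sum_list w' \<le> r (length w')" using *(2) by simp
qed (use assms alpha_character beta_character in auto)

section \<open>The left-hand sides as sums over nondecreasing lists of nodes\<close>

fun monomial :: "real list \<Rightarrow> nat list \<Rightarrow> real" where
  "monomial (x # xs) (j # js) = x ^ (j - 1) * monomial xs js"
| "monomial _ _ = 1"

definition sorted_indices :: "nat \<Rightarrow> nat \<Rightarrow> nat list set" where
  "sorted_indices s k = {is. length is = k \<and> sorted is \<and> set is \<subseteq> {1..s}}"

definition weight :: "(nat \<Rightarrow> real) \<Rightarrow> nat list \<Rightarrow> real" where
  "weight b is = prod_list (map b is) / sigma is"

lemma finite_sorted_indices [simp]: "finite (sorted_indices s k)"
  by (rule finite_subset[OF _ finite_lists_length_eq[of "{1..s}" k]]) (auto simp: sorted_indices_def)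

text \<open>The recursion of \<open>sigma\<close> strips blocks on the left, whereas nodes are added
  on the right. A new index that exceeds all others forms a block of its own and contributes its
  factorial.\<close>

lemma sigma_append_replicate:
  "\<forall>i\<in>set is. i < m \<Longrightarrow> sigma (is @ replicate n m) = sigma is * fact n"
proof (induction "is" rule: sigma.induct)
  case 1
  show ?case by (cases n) (simp_all add: takeWhile_replicate dropWhile_replicate)
next
  case (2 i "is")
  have ne: "i < m" using 2(2) by simp
  have tr: "takeWhile (\<lambda>j. j = i) (replicate n m) = []" "dropWhile (\<lambda>j. j = i) (replicate n m) = replicate n m"
    using ne by (simp_all add: takeWhile_replicate dropWhile_replicate)
  have takeWhile_app: "takeWhile P (xs @ ys) = takeWhile P xs" if "takeWhile P ys = []"
    for P :: "nat \<Rightarrow> bool" and xs ys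
    using that by (induction xs) auto
  have dropWhile_app: "dropWhile P (xs @ ys) = dropWhile P xs @ ys" if "dropWhile P ys = ys"
    for P :: "nat \<Rightarrow> bool" and xs ys
    using that by (induction xs) auto
  have t: "takeWhile (\<lambda>j. j = i) ((i # is) @ replicate n m) = takeWhile (\<lambda>j. j = i) (i # is)"
    by (rule takeWhile_app) (rule tr(1))
  have d: "dropWhile (\<lambda>j. j = i) ((i # is) @ replicate n m) = dropWhile (\<lambda>j. j = i) (i # is) @ replicate n m"
    by (rule dropWhile_app) (rule tr(2))
  have "\<forall>j\<in>set (dropWhile (\<lambda>j. j = i) (i # is)). j < m"
    using 2(2) by (meson set_dropWhileD)
  then have IH: "sigma (dropWhile (\<lambda>j. j = i) (i # is) @ replicate n m) =
      sigma (dropWhile (\<lambda>j. j = i) (i # is)) * fact n"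
    by (rule 2(1))
  have "sigma ((i # is) @ replicate n m) =
      fact (length (takeWhile (\<lambda>j. j = i) ((i # is) @ replicate n m))) *
      sigma (dropWhile (\<lambda>j. j = i) ((i # is) @ replicate n m))"
    by (simp only: append_Cons sigma.simps)
  also have "\<dots> = sigma (i # is) * fact n"
    unfolding t d IH sigma.simps(2) by (simp only: mult.assoc)
  finally show ?case .
qed

lemma sum_sorted_indices_0: "sum F (sorted_indices 0 k) = (if k = 0 then F [] else 0)"
proof -
  have "sorted_indices 0 k = (if k = 0 then {[]} else {})"
    by (auto simp: sorted_indices_def)
  then show ?thesis by simp
qed

text \<open>In a sorted list the copies of the largest admissible index form the final block, so the
  lists are classified by the length of this block, which may be 0.\<close>

lemma sum_sorted_indices_Suc:
  fixes F :: "nat list \<Rightarrow> real"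
  shows "sum F (sorted_indices (Suc s) k) =
    (\<Sum>n\<le>k. \<Sum>is\<in>sorted_indices s (k - n). F (is @ replicate n (Suc s)))"
proof -
  define A where "A n = (\<lambda>is. is @ replicate n (Suc s)) ` sorted_indices s (k - n)" for n
  have "sorted_indices (Suc s) k = (\<Union>n\<le>k. A n)"
  proof (intro set_eqI iffI)
    fix xs assume "xs \<in> sorted_indices (Suc s) k"
    then have xs: "length xs = k" "sorted xs" "set xs \<subseteq> {1..Suc s}" by (auto simp: sorted_indices_def)
    define ys where "ys = filter (\<lambda>i. i \<le> s) xs"
    define zs where "zs = filter (\<lambda>i. \<not> i \<le> s) xs"
    have "xs = ys @ zs" unfolding ys_def zs_def using xs(2)
    proof (induction xs)
      case (Cons x xs)
      show ?case
      proof (cases "x \<le> s")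
        case False
        then have "filter (\<lambda>i. i \<le> s) xs = []" using Cons.prems by (auto simp: filter_empty_conv)
        then show ?thesis using Cons False by auto
      qed (use Cons in auto)
    qed simp
    moreover have "zs = replicate (length zs) (Suc s)"
    proof (rule replicate_length_same[symmetric], rule ballI)
      fix x assume "x \<in> set zs"
      then show "x = Suc s" using xs(3) unfolding zs_def by force
    qed
    moreover have "ys \<in> sorted_indices s (k - length zs)"
    proof -
      have "length ys = k - length zs" using xs(1) \<open>xs = ys @ zs\<close> by auto
      moreover have "sorted ys" unfolding ys_def using xs(2) by (rule sorted_wrt_filter)
      moreover have "set ys \<subseteq> {1..s}" unfolding ys_def using xs(3) by force
      ultimately show ?thesis by (simp add: sorted_indices_def)
    qed
    ultimately have "xs \<in> A (length zs)" unfolding A_def by (metis image_eqI)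
    moreover have "length zs \<le> k" using xs(1) \<open>xs = ys @ zs\<close> by auto
    ultimately show "xs \<in> (\<Union>n\<le>k. A n)" by blast
  next
    fix xs assume "xs \<in> (\<Union>n\<le>k. A n)"
    then show "xs \<in> sorted_indices (Suc s) k"
      unfolding A_def sorted_indices_def by (fastforce simp: sorted_append)
  qed
  moreover have "A n \<inter> A n' = {}" if "n \<noteq> n'" for n n'
  proof -
    have "length (filter (\<lambda>i. i = Suc s) xs) = n" if mem: "xs \<in> A n" for xs n
    proof -
      obtain ys where ys: "xs = ys @ replicate n (Suc s)" "ys \<in> sorted_indices s (k - n)"
        using mem unfolding A_def by blast
      then have "set ys \<subseteq> {1..s}" by (simp add: sorted_indices_def)
      then have "filter (\<lambda>i. i = Suc s) ys = []" by (force simp: filter_empty_conv)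
      then show ?thesis using ys by simp
    qed
    then show ?thesis using that by blast
  qed
  ultimately have "sum F (sorted_indices (Suc s) k) = (\<Sum>n\<le>k. sum F (A n))"
    by (simp add: sum.UNION_disjoint A_def)
  also have "\<dots> = (\<Sum>n\<le>k. \<Sum>is\<in>sorted_indices s (k - n). F (is @ replicate n (Suc s)))"
    unfolding A_def by (rule sum.cong[OF refl], subst sum.reindex) (auto simp: inj_on_def)
  finally show ?thesis .
qed

lemma monomial_append_replicate:
  "length xs + n = length js \<Longrightarrow> monomial (xs @ replicate n x) js =
     monomial xs (take (length xs) js) * prod_list (map (\<lambda>j. x ^ (j - 1)) (drop (length xs) js))"
proof (induction xs arbitrary: js)
  case Nil
  then show ?case
  proof (induction n arbitrary: js)
    case (Suc n)
    then show ?case by (cases js) auto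
  qed auto
next
  case (Cons y xs)
  then show ?case by (cases js) auto
qed

lemma weight_append_replicate:
  "\<forall>i\<in>set is. i < m \<Longrightarrow> weight b (is @ replicate n m) = weight b is * (b m ^ n / fact n)"
  by (simp add: weight_def sigma_append_replicate)

text \<open>The final block of a sorted list matches the last indices that \<open>pulse\<close>
  places at the newest node, and its share b^n / n! of the weight is the divided power.\<close>

lemma alpha_sum:
  "alpha b c s js = (\<Sum>is\<in>sorted_indices s (length js). weight b is * monomial (map c is) js)"
proof (induction s arbitrary: js)
  case 0
  show ?case by (cases js) (simp_all add: sum_sorted_indices_0 weight_def)
next
  case (Suc s)
  have "alpha b c (Suc s) js = (\<Sum>n\<le>length js. \<Sum>is\<in>sorted_indices s (length js - n).
      weight b (is @ replicate n (Suc s)) * monomial (map c (is @ replicate n (Suc s))) js)"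
    unfolding alpha.simps pulse_def
  proof (rule sum.cong[OF refl], goal_cases)
    case (1 n)
    then have n: "n \<le> length js" by simp
    have "alpha b c s (take (length js - n) js) * (b (Suc s) ^ n / fact n) *
        prod_list (map (\<lambda>j. c (Suc s) ^ (j - 1)) (drop (length js - n) js)) =
      (\<Sum>is\<in>sorted_indices s (length js - n). weight b is * monomial (map c is) (take (length js - n) js) *
         (b (Suc s) ^ n / fact n) * prod_list (map (\<lambda>j. c (Suc s) ^ (j - 1)) (drop (length js - n) js)))"
      using n by (simp only: Suc length_take sum_distrib_right min_absorb2 diff_le_self)
    also have "\<dots> = (\<Sum>is\<in>sorted_indices s (length js - n).
      weight b (is @ replicate n (Suc s)) * monomial (map c (is @ replicate n (Suc s))) js)"
    proof (rule sum.cong[OF refl], goal_cases)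
      case (1 "is")
      then have len: "length is = length js - n" "\<forall>i\<in>set is. i < Suc s"
        by (auto simp: sorted_indices_def)
      have "monomial (map c (is @ replicate n (Suc s))) js = monomial (map c is) (take (length js - n) js) *
         prod_list (map (\<lambda>j. c (Suc s) ^ (j - 1)) (drop (length js - n) js))"
        using monomial_append_replicate[of "map c is" n js "c (Suc s)"] len n by simp
      then show ?case unfolding weight_append_replicate[OF len(2)] by simp
    qed
    finally show ?case .
  qed
  then show ?case unfolding sum_sorted_indices_Suc .
qed

lemma monomial_eq_prod:
  "length xs = length js \<Longrightarrow> monomial xs js = (\<Prod>l<length js. (xs ! l) ^ (js ! l - 1))"
  by (induction xs js rule: list_induct2) (simp_all add: prod.lessThan_Suc_shift del: prod.lessThan_Suc)

lemma order_condition_iff: "order_condition a b s js \<longleftrightarrow> alpha b (c_coeff a) s js = beta js"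
proof -
  have "(\<Prod>l<length js. b (is ! l)) / sigma is * (\<Prod>l<length js. c_coeff a (is ! l) ^ (js ! l - 1)) =
      weight b is * monomial (map (c_coeff a) is) js" if "is \<in> sorted_indices s (length js)" for "is"
  proof -
    have len: "length is = length js" using that by (simp add: sorted_indices_def)
    have "prod_list (map b is) = (\<Prod>l<length js. b (is ! l))"
      using prod.list_conv_set_nth[of "map b is"] len by (simp add: lessThan_atLeast0)
    moreover have "monomial (map (c_coeff a) is) js = (\<Prod>l<length js. c_coeff a (is ! l) ^ (js ! l - 1))"
      using monomial_eq_prod[of "map (c_coeff a) is" js] len by (simp add: lessThan_atLeast0)
    ultimately show ?thesis by (simp add: weight_def)
  qed
  then have "(\<Sum>is | length is = length js \<and> sorted is \<and> set is \<subseteq> {1..s}.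
        (\<Prod>l<length js. b (is ! l)) / sigma is * (\<Prod>l<length js. c_coeff a (is ! l) ^ (js ! l - 1))) =
      alpha b (c_coeff a) s js"
    unfolding alpha_sum sorted_indices_def by (intro sum.cong) auto
  then show ?thesis unfolding order_condition_def beta_def by simp
qed

section \<open>Series in two noncommuting letters\<close>

text \<open>Words are lists of booleans, \<open>False\<close> for the first part of the system and \<open>True\<close> for
  the second. The head of a word belongs to the flow that is applied first.\<close>

primrec conv :: "(bool list \<Rightarrow> real) \<Rightarrow> (bool list \<Rightarrow> real) \<Rightarrow> bool list \<Rightarrow> real" where
  "conv f g [] = f [] * g []"
| "conv f g (x # w) = f [] * g (x # w) + conv (\<lambda>u. f (x # u)) g w"

definition conv_one :: "bool list \<Rightarrow> real" where
  "conv_one w = (if w = [] then 1 else 0)"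

text \<open>The coefficients of exp(t l), the series of the flow of a single part over time
  \<open>t\<close>.\<close>

definition letter_exp :: "bool \<Rightarrow> real \<Rightarrow> bool list \<Rightarrow> real" where
  "letter_exp l t w = (if set w \<subseteq> {l} then t ^ length w / fact (length w) else 0)"

primrec series_prod :: "(bool \<times> real) list \<Rightarrow> bool list \<Rightarrow> real" where
  "series_prod [] = conv_one"
| "series_prod (p # ps) = conv (letter_exp (fst p) (snd p)) (series_prod ps)"

primrec splitting_steps :: "(nat \<Rightarrow> real) \<Rightarrow> (nat \<Rightarrow> real) \<Rightarrow> nat \<Rightarrow> (bool \<times> real) list" where
  "splitting_steps a b 0 = [(False, a 1)]"
| "splitting_steps a b (Suc s) = splitting_steps a b s @ [(True, b (s + 1)), (False, a (s + 2))]"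

lemma conv_sum: "conv f g w = (\<Sum>k\<le>length w. f (take k w) * g (drop k w))"
proof (induction w arbitrary: f)
  case (Cons x w)
  show ?case unfolding conv.simps Cons.IH length_Cons
    by (subst sum.atMost_Suc_shift) simp
qed simp

lemma conv_add_left: "conv (\<lambda>u. f u + f' u) g w = conv f g w + conv f' g w"
  unfolding conv_sum by (simp add: algebra_simps sum.distrib)

lemma conv_cmult_left: "conv (\<lambda>u. c * f u) g w = c * conv f g w"
  unfolding conv_sum by (simp add: sum_distrib_left mult.assoc)

lemma conv_zero_left [simp]: "conv (\<lambda>u. 0) g w = 0"
  unfolding conv_sum by simp

lemma conv_assoc: "conv (conv f g) h = conv f (conv g h)"
proof
  fix w show "conv (conv f g) h w = conv f (conv g h) w"
  proof (induction w arbitrary: f)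
    case (Cons x w)
    then show ?case by (simp add: conv_add_left conv_cmult_left algebra_simps)
  qed simp
qed

lemma conv_one_left [simp]: "conv conv_one g = g"
proof
  fix w show "conv conv_one g w = g w" by (cases w) (simp_all add: conv_one_def)
qed

lemma conv_one_right [simp]: "conv g conv_one = g"
proof
  fix w show "conv g conv_one w = g w"
    by (induction w arbitrary: g) (simp_all add: conv_one_def)
qed

section \<open>Exponentials of one letter, inverses and palindromes\<close>

lemma sum_binomial_fact:
  "(\<Sum>k\<le>n. s ^ k / fact k * (t ^ (n - k) / fact (n - k))) = (s + t) ^ n / fact n" for s t :: real
proof -
  have "(s + t) ^ n / fact n = (\<Sum>k\<le>n. of_nat (n choose k) * s ^ k * t ^ (n - k)) / fact n"
    by (simp add: binomial_ring)
  also have "\<dots> = (\<Sum>k\<le>n. s ^ k / fact k * (t ^ (n - k) / fact (n - k)))"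
    unfolding sum_divide_distrib
  proof (rule sum.cong[OF refl], goal_cases)
    case (1 k)
    then show ?case using binomial_fact[of k n, where 'a = real] by simp
  qed
  finally show ?thesis ..
qed

lemma letter_exp_add: "conv (letter_exp l s) (letter_exp l t) = letter_exp l (s + t)"
proof
  fix w
  show "conv (letter_exp l s) (letter_exp l t) w = letter_exp l (s + t) w"
  proof (cases "set w \<subseteq> {l}")
    case True
    then have "set (take k w) \<subseteq> {l}" "set (drop k w) \<subseteq> {l}" for k
      using set_take_subset set_drop_subset by fast+
    then have "conv (letter_exp l s) (letter_exp l t) w =
        (\<Sum>k\<le>length w. s ^ k / fact k * (t ^ (length w - k) / fact (length w - k)))"
      unfolding conv_sum by (intro sum.cong) (auto simp: letter_exp_def min_def)
    then show ?thesis using True unfolding sum_binomial_fact by (simp add: letter_exp_def)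
  next
    case False
    have "letter_exp l s (take k w) * letter_exp l t (drop k w) = 0" for k
    proof -
      have "set w = set (take k w) \<union> set (drop k w)" by (metis append_take_drop_id set_append)
      then have "\<not> set (take k w) \<subseteq> {l} \<or> \<not> set (drop k w) \<subseteq> {l}" using False by blast
      then show ?thesis by (auto simp: letter_exp_def)
    qed
    then have "conv (letter_exp l s) (letter_exp l t) w = 0"
      unfolding conv_sum by (intro sum.neutral) blast
    then show ?thesis using False by (simp add: letter_exp_def)
  qed
qed

lemma letter_exp_0 [simp]: "letter_exp l 0 = conv_one"
  by (rule ext) (simp add: letter_exp_def conv_one_def)

lemma series_prod_append: "series_prod (ps @ qs) = conv (series_prod ps) (series_prod qs)"
  by (induction ps) (simp_all add: conv_assoc)

lemma series_prod_Nil_word [simp]: "series_prod ps [] = 1"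
  by (induction ps) (simp_all add: conv_one_def letter_exp_def)

lemma series_prod_uminus:
  "series_prod (map (\<lambda>p. (fst p, - snd p)) ps) w = (-1) ^ length w * series_prod ps w"
proof (induction ps arbitrary: w)
  case Nil
  show ?case by (simp add: conv_one_def)
next
  case (Cons p ps)
  have "letter_exp l (- t) u = (-1) ^ length u * letter_exp l t u" for l t u
    by (simp add: letter_exp_def power_minus[of t])
  moreover have "(-1) ^ length (take k w) * ((-1) ^ length (drop k w)) = (-1 :: real) ^ length w"
    if "k \<le> length w" for k
    using that by (simp add: min_absorb2 power_add[symmetric])
  ultimately show ?case unfolding series_prod.simps list.map fst_conv snd_conv conv_sum sum_distrib_left
    by (intro sum.cong) (auto simp: Cons.IH mult.assoc mult.left_commute)
qed

text \<open>The innermost exponentials cancel in pairs, exp(t l) exp(-t l) = 1, which peels the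
  product from the middle outwards.\<close>

lemma series_prod_rev_uminus:
  "conv (series_prod ps) (series_prod (rev (map (\<lambda>p. (fst p, - snd p)) ps))) = conv_one"
proof (induction ps)
  case (Cons p ps)
  let ?q = "series_prod (rev (map (\<lambda>p. (fst p, - snd p)) ps))"
  have "conv (series_prod (p # ps)) (series_prod (rev (map (\<lambda>p. (fst p, - snd p)) (p # ps)))) =
      conv (letter_exp (fst p) (snd p)) (conv (conv (series_prod ps) ?q) (letter_exp (fst p) (- snd p)))"
    by (simp add: series_prod_append conv_assoc)
  then show ?case by (simp add: Cons.IH letter_exp_add)
qed simp

lemma inverse_fact_alternating:
  "n > 0 \<Longrightarrow> (\<Sum>k\<le>n. 1 / fact k * ((-1) ^ (n - k) / fact (n - k))) = (0 :: real)"
  using sum_binomial_fact[of 1 "-1" n] by (simp add: power_0_left)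

text \<open>A palindromic product is inverse to itself with reversed signs, as is the exact series.
  For words of even length, the two extreme terms of this identity coincide.\<close>

lemma series_prod_palindrome_even:
  assumes "rev ps = ps" "even (length w)"
    and "\<And>k. 0 < k \<Longrightarrow> k < length w \<Longrightarrow> series_prod ps (take k w) = 1 / fact k"
    and "\<And>k. 0 < k \<Longrightarrow> k < length w \<Longrightarrow> series_prod ps (drop k w) = 1 / fact (length w - k)"
  shows "series_prod ps w = 1 / fact (length w)"
proof (cases "w = []")
  case False
  define n where "n = length w"
  define S where "S = series_prod ps"
  have n: "n > 0" using False by (simp add: n_def)
  have "series_prod (rev (map (\<lambda>p. (fst p, - snd p)) ps)) = (\<lambda>w. (-1) ^ length w * S w)"
    using series_prod_uminus[of ps] assms(1) unfolding S_def by (subst rev_map) auto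
  then have "conv S (\<lambda>w. (-1) ^ length w * S w) w = conv_one w"
    using series_prod_rev_uminus[of ps] unfolding S_def by metis
  then have "(\<Sum>k\<le>n. S (take k w) * ((-1) ^ (n - k) * S (drop k w))) = 0"
    using False unfolding conv_sum by (simp add: conv_one_def n_def)
  also have "0 = (\<Sum>k\<le>n. 1 / fact k * ((-1) ^ (n - k) / fact (n - k)) :: real)"
    using inverse_fact_alternating[OF n] by simp
  finally have eq: "(\<Sum>k\<le>n. S (take k w) * ((-1) ^ (n - k) * S (drop k w))) =
      (\<Sum>k\<le>n. 1 / fact k * ((-1) ^ (n - k) / fact (n - k)))" .
  have split: "(\<Sum>k\<le>n. f k) = f 0 + f n + (\<Sum>k\<in>{1..<n}. f k)" for f :: "nat \<Rightarrow> real"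
  proof -
    have "{..n} = insert 0 (insert n {1..<n})" using n by auto
    then show ?thesis using n by simp
  qed
  have "(\<Sum>k\<in>{1..<n}. S (take k w) * ((-1) ^ (n - k) * S (drop k w))) =
      (\<Sum>k\<in>{1..<n}. 1 / fact k * ((-1) ^ (n - k) / fact (n - k)))"
    by (rule sum.cong) (use assms(3,4) in \<open>auto simp: S_def n_def\<close>)
  moreover have "S [] = 1" by (simp add: S_def)
  moreover have "even n" using assms(2) by (simp add: n_def)
  ultimately have "S w = 1 / fact n" using eq unfolding split by (simp add: n_def)
  then show ?thesis by (simp add: S_def n_def)
qed simp

lemma length_splitting_steps [simp]: "length (splitting_steps a b s) = 2 * s + 1"
  by (induction s) auto

lemma splitting_steps_nth:
  "i \<le> s \<Longrightarrow> splitting_steps a b s ! (2 * i) = (False, a (i + 1)) \<and>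
    (i < s \<longrightarrow> splitting_steps a b s ! (2 * i + 1) = (True, b (i + 1)))"
proof (induction s)
  case (Suc s)
  show ?case
  proof (cases "i = Suc s")
    case True
    then show ?thesis by (simp add: nth_append)
  next
    case False
    then show ?thesis using Suc by (cases "i = s") (auto simp: nth_append)
  qed
qed simp

lemma rev_splitting_steps:
  assumes "symmetric_coeffs a b s"
  shows "rev (splitting_steps a b s) = splitting_steps a b s"
proof (rule nth_equalityI)
  fix n assume "n < length (rev (splitting_steps a b s))"
  then have n: "n \<le> 2 * s" by simp
  have rn: "rev (splitting_steps a b s) ! n = splitting_steps a b s ! (2 * s - n)"
    using n by (simp add: rev_nth)
  show "rev (splitting_steps a b s) ! n = splitting_steps a b s ! n"
  proof (cases "even n")
    case True
    then obtain i where i: "n = 2 * i" by blast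
    have "i + 1 \<in> {1..s + 1}" using n i by simp
    then have "a (s + 2 - (i + 1)) = a (i + 1)"
      using assms unfolding symmetric_coeffs_def by blast
    moreover have "s + 2 - (i + 1) = s - i + 1" using n i by simp
    ultimately have "a (s - i + 1) = a (i + 1)" by (simp only:)
    moreover have "2 * s - n = 2 * (s - i)" using n i by auto
    ultimately show ?thesis using rn splitting_steps_nth[of i s a b] splitting_steps_nth[of "s - i" s a b] n i
      by simp
  next
    case False
    then obtain i where i: "n = 2 * i + 1" using oddE by blast
    then have "i < s" using n by simp
    have "i + 1 \<in> {1..s}" using \<open>i < s\<close> by simp
    then have "b (s + 1 - (i + 1)) = b (i + 1)"
      using assms unfolding symmetric_coeffs_def by blast
    moreover have "s + 1 - (i + 1) = s - i - 1 + 1" using \<open>i < s\<close> by simp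
    ultimately have "b (s - i - 1 + 1) = b (i + 1)" by (simp only:)
    moreover have "2 * s - n = 2 * (s - i - 1) + 1" using \<open>i < s\<close> i by auto
    ultimately show ?thesis
      using rn splitting_steps_nth[of i s a b] splitting_steps_nth[of "s - i - 1" s a b] i \<open>i < s\<close>
      by simp
  qed
qed simp

section \<open>Order conditions in terms of words\<close>

abbreviation nB :: "bool list \<Rightarrow> nat" where
  "nB w \<equiv> length (filter (\<lambda>x. x) w)"

definition Bpow :: "nat \<Rightarrow> bool list \<Rightarrow> real" where
  "Bpow n w = (if w = replicate n True then 1 else 0)"

text \<open>With A and B for the two letters this is exp((x_1 - t)A) B exp((x_2 - x_1)A) B ... B
  exp((T - x_k)A): evolution under A from time \<open>t\<close> to \<open>T\<close>, with one B
  inserted at each of the times x_i.\<close>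

primrec pulse_series :: "real \<Rightarrow> real list \<Rightarrow> real \<Rightarrow> bool list \<Rightarrow> real" where
  "pulse_series t [] T = letter_exp False (T - t)"
| "pulse_series t (x # xs) T = conv (letter_exp False (x - t)) (conv (Bpow (Suc 0)) (pulse_series x xs T))"

lemma Bpow_0 [simp]: "Bpow 0 = conv_one"
  by (rule ext) (simp add: Bpow_def conv_one_def)

lemma conv_Bpow_1: "conv (Bpow (Suc 0)) g w = (case w of [] \<Rightarrow> 0 | x # v \<Rightarrow> if x then g v else 0)"
proof (cases w)
  case (Cons x v)
  have "(\<lambda>u. Bpow (Suc 0) (x # u)) = (if x then conv_one else (\<lambda>u. 0))"
    by (rule ext) (simp add: Bpow_def conv_one_def)
  then show ?thesis using Cons by (simp add: Bpow_def)
qed (simp add: Bpow_def)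

lemma Bpow_Suc: "conv (Bpow (Suc 0)) (Bpow n) = Bpow (Suc n)"
  by (rule ext) (auto simp: conv_Bpow_1 Bpow_def split: list.splits)

text \<open>Between equal times the exponential is the unit, so \<open>n\<close> insertions at the
  same time collapse to B^n.\<close>

lemma pulse_series_append_replicate:
  "pulse_series t (xs @ replicate n c) T =
     conv (pulse_series t xs c) (conv (Bpow n) (letter_exp False (T - c)))"
proof (induction xs arbitrary: t)
  case Nil
  show ?case
  proof (induction n arbitrary: t)
    case 0
    show ?case by (simp add: letter_exp_add)
  next
    case (Suc n)
    from Suc[of c] have "pulse_series c (replicate n c) T = conv (Bpow n) (letter_exp False (T - c))"
      by simp
    then show ?case by (simp add: conv_assoc Bpow_Suc[of n, symmetric])
  qed
next
  case (Cons x xs)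
  then show ?case by (simp add: conv_assoc)
qed

lemma conv_Bpow_letter_exp_eq_0:
  assumes "nB v \<noteq> n"
  shows "conv (Bpow n) (letter_exp False t) v = 0"
  unfolding conv_sum
proof (rule sum.neutral, rule ballI)
  fix k
  show "Bpow n (take k v) * letter_exp False t (drop k v) = 0"
  proof (rule ccontr)
    assume "Bpow n (take k v) * letter_exp False t (drop k v) \<noteq> 0"
    then have 1: "take k v = replicate n True" and 2: "set (drop k v) \<subseteq> {False}"
      by (auto simp: Bpow_def letter_exp_def split: if_splits)
    have "nB v = nB (take k v) + nB (drop k v)"
      by (metis append_take_drop_id filter_append length_append)
    moreover have "filter (\<lambda>x. x) (drop k v) = []" using 2 by (auto simp: filter_empty_conv)
    ultimately show False using assms 1 by simp
  qed
qed

text \<open>The cut-off \<open>N\<close> may be any bound for the number of letters; a common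
  \<open>N\<close> for all factors of a word lets the double sums be exchanged.\<close>

lemma letter_exp_True_eq_sum:
  assumes "nB u \<le> N"
  shows "letter_exp True t u = (\<Sum>n\<le>N. t ^ n / fact n * Bpow n u)"
proof (cases "set u \<subseteq> {True}")
  case True
  then have u: "u = replicate (length u) True" by (intro replicate_length_same[symmetric]) auto
  have "filter (\<lambda>x. x) u = u" using True by (auto simp: filter_id_conv)
  then have "nB u = length u" by simp
  then have "length u \<le> N" using assms by simp
  have "(\<Sum>n\<le>N. t ^ n / fact n * Bpow n u) = (\<Sum>n\<le>N. if n = length u then t ^ n / fact n else 0)"
  proof (rule sum.cong[OF refl])
    fix n
    have "u = replicate n True \<longleftrightarrow> n = length u"
    proof
      assume "u = replicate n True"
      then show "n = length u" by (metis length_replicate)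
    next
      assume n: "n = length u"
      show "u = replicate n True" unfolding n by (rule u)
    qed
    then show "t ^ n / fact n * Bpow n u = (if n = length u then t ^ n / fact n else 0)"
      unfolding Bpow_def by simp
  qed
  then show ?thesis using True \<open>length u \<le> N\<close> by (simp add: letter_exp_def)
next
  case False
  then have "Bpow n u = 0" for n by (auto simp: Bpow_def)
  then show ?thesis using False by (simp add: letter_exp_def)
qed

text \<open>Each exp(b_i B) is expanded into divided powers of B. A list \<open>is\<close> records
  how often each step contributes a letter: its blocks give the factors b_i^n / n!, hence
  \<open>weight\<close>, and all A-steps between two chosen B's merge into one exponential over the
  difference of the nodes.\<close>

lemma series_prod_splitting_steps:
  "series_prod (splitting_steps a b s) w =
     (\<Sum>is\<in>sorted_indices s (nB w). weight b is * pulse_series 0 (map (c_coeff a) is) (c_coeff a (s + 1)) w)"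
proof -
  \<comment> \<open>The product up to the last B-step, without the closing A-step. The induction
    needs a free end time \<open>T\<close>: at the next stage the new node \<open>c\<close> takes
    its place.\<close>
  define pre where "pre = rec_nat conv_one (\<lambda>s f. conv f (conv (letter_exp False (a (s + 1))) (letter_exp True (b (s + 1)))))"
  have pre: "pre 0 = conv_one"
    "pre (Suc s) = conv (pre s) (conv (letter_exp False (a (s + 1))) (letter_exp True (b (s + 1))))" for s
    by (simp_all add: pre_def)
  have "series_prod (splitting_steps a b s) = conv (pre s) (letter_exp False (a (s + 1)))"
  proof (induction s)
    case (Suc s)
    then show ?case by (simp add: series_prod_append pre conv_assoc)
  qed (simp add: pre)
  moreover have "conv (pre s) (letter_exp False (T - c_coeff a s)) w =
      (\<Sum>is\<in>sorted_indices s (nB w). weight b is * pulse_series 0 (map (c_coeff a) is) T w)" for T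
  proof (induction s arbitrary: T w)
    case 0
    show ?case
    proof (cases "nB w = 0")
      case False
      then have "\<not> set w \<subseteq> {False}" by (auto simp: filter_empty_conv)
      then show ?thesis using False by (simp add: pre sum_sorted_indices_0 letter_exp_def)
    qed (simp add: pre sum_sorted_indices_0 c_coeff_def weight_def)
  next
    case (Suc s)
    define c where "c = c_coeff a (Suc s)"
    define Q where "Q n = conv (Bpow n) (letter_exp False (T - c))" for n
    define P where "P is = pulse_series 0 (map (c_coeff a) is) c" for "is"
    define t where "t = b (Suc s)"
    have c: "a (s + 1) = c - c_coeff a s" by (simp add: c_def c_coeff_def)
    have E: "conv (letter_exp True t) (letter_exp False (T - c)) v = (\<Sum>n\<le>nB w. t ^ n / fact n * Q n v)"
      if "nB v \<le> nB w" for v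
    proof -
      have "nB (take k v) \<le> nB w" for k
      proof -
        have "nB v = nB (take k v) + nB (drop k v)"
          by (metis append_take_drop_id filter_append length_append)
        then show ?thesis using that by simp
      qed
      then have "conv (letter_exp True t) (letter_exp False (T - c)) v =
          (\<Sum>k\<le>length v. \<Sum>n\<le>nB w. t ^ n / fact n * (Bpow n (take k v) * letter_exp False (T - c) (drop k v)))"
        unfolding conv_sum
        by (intro sum.cong refl) (simp add: letter_exp_True_eq_sum[where N = "nB w"] sum_distrib_right mult.assoc)
      also have "\<dots> = (\<Sum>n\<le>nB w. t ^ n / fact n * Q n v)"
        unfolding Q_def conv_sum sum_distrib_left by (rule sum.swap)
      finally show ?thesis .
    qed
    have "conv (pre (Suc s)) (letter_exp False (T - c)) w =
        conv (conv (pre s) (letter_exp False (c - c_coeff a s))) (conv (letter_exp True t) (letter_exp False (T - c))) w"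
      by (simp add: pre conv_assoc c[symmetric, simplified] flip: t_def)
    also have "\<dots> = (\<Sum>k\<le>length w. (\<Sum>is\<in>sorted_indices s (nB (take k w)). weight b is * P is (take k w)) *
        (\<Sum>n\<le>nB w. t ^ n / fact n * Q n (drop k w)))"
      unfolding conv_sum[of _ _ w]
    proof (rule sum.cong[OF refl], goal_cases)
      case (1 k)
      have "nB w = nB (take k w) + nB (drop k w)"
        by (metis append_take_drop_id filter_append length_append)
      then show ?case using Suc[of c "take k w"] E[of "drop k w"] by (simp add: P_def)
    qed
    also have "\<dots> = (\<Sum>k\<le>length w. \<Sum>n\<le>nB w. \<Sum>is\<in>sorted_indices s (nB w - n).
        weight b is * (t ^ n / fact n) * (P is (take k w) * Q n (drop k w)))"
    proof (rule sum.cong[OF refl], goal_cases)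
      case (1 k)
      have nB: "nB w = nB (take k w) + nB (drop k w)"
        by (metis append_take_drop_id filter_append length_append)
      \<comment> \<open>Only \<open>n\<close> equal to the number of second letters in
        \<open>drop k w\<close> contributes. Hence the number of insertions left for the prefix can
        be written as \<open>nB w - n\<close>, which no longer depends on the cut.\<close>
      have "(\<Sum>is\<in>sorted_indices s (nB (take k w)). weight b is * P is (take k w)) * (t ^ n / fact n * Q n (drop k w)) =
          (\<Sum>is\<in>sorted_indices s (nB w - n). weight b is * (t ^ n / fact n) * (P is (take k w) * Q n (drop k w)))" for n
      proof (cases "nB (drop k w) = n")
        case True
        then have "nB w - n = nB (take k w)" using nB by simp
        then show ?thesis unfolding sum_distrib_right by (simp add: mult_ac)
      next
        case False
        then have "Q n (drop k w) = 0" unfolding Q_def by (rule conv_Bpow_letter_exp_eq_0)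
        then show ?thesis by simp
      qed
      then show ?case unfolding sum_distrib_left[of _ "\<lambda>n. t ^ n / fact n * Q n (drop k w)"] by simp
    qed
    also have "\<dots> = (\<Sum>n\<le>nB w. \<Sum>is\<in>sorted_indices s (nB w - n). \<Sum>k\<le>length w.
        weight b is * (t ^ n / fact n) * (P is (take k w) * Q n (drop k w)))"
      by (subst sum.swap) (rule sum.cong[OF refl], rule sum.swap)
    also have "\<dots> = (\<Sum>n\<le>nB w. \<Sum>is\<in>sorted_indices s (nB w - n).
        weight b (is @ replicate n (Suc s)) *
        pulse_series 0 (map (c_coeff a) (is @ replicate n (Suc s))) T w)"
    proof (intro sum.cong refl, goal_cases)
      case (1 n "is")
      then have lt: "\<forall>i\<in>set is. i < Suc s" by (auto simp: sorted_indices_def)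
      have "(\<Sum>k\<le>length w. weight b is * (t ^ n / fact n) * (P is (take k w) * Q n (drop k w))) =
          weight b is * (t ^ n / fact n) * conv (P is) (Q n) w"
        unfolding conv_sum sum_distrib_left ..
      then show ?case
        by (simp add: weight_append_replicate[OF lt] pulse_series_append_replicate P_def Q_def c_def t_def)
    qed
    finally show ?case by (simp add: sum_sorted_indices_Suc c_def)
  qed
  moreover have "a (s + 1) = c_coeff a (s + 1) - c_coeff a s" by (simp add: c_coeff_def)
  ultimately show ?thesis by metis
qed

section \<open>Words as lists of exponents between second letters\<close>

fun encode_tail :: "nat list \<Rightarrow> bool list" where
  "encode_tail [] = []"
| "encode_tail (p # ps) = True # replicate p False @ encode_tail ps"

lemma word_encoding:
  obtains p ps where "w = replicate p False @ encode_tail ps" "nB w = length ps"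
    "length w = p + sum_list ps + length ps"
proof -
  have "\<exists>p ps. w = replicate p False @ encode_tail ps \<and> nB w = length ps \<and>
      length w = p + sum_list ps + length ps"
  proof (induction w)
    case Nil
    show ?case by (rule exI[of _ 0], rule exI[of _ "[]"]) simp
  next
    case (Cons x w)
    then obtain p ps where w: "w = replicate p False @ encode_tail ps" "nB w = length ps"
      "length w = p + sum_list ps + length ps" by blast
    show ?case
    proof (cases x)
      case True
      then show ?thesis using w by (intro exI[of _ 0] exI[of _ "p # ps"]) auto
    next
      case False
      then show ?thesis using w by (intro exI[of _ "Suc p"] exI[of _ ps]) auto
    qed
  qed
  then show thesis using that by blast
qed

text \<open>Here \<open>hd (xs @ [1])\<close> is the next node, or the end time 1 after the last
  one.\<close>

fun gap_product :: "real list \<Rightarrow> nat list \<Rightarrow> real" where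
  "gap_product (x # xs) (p # ps) = (hd (xs @ [1]) - x) ^ p / fact p * gap_product xs ps"
| "gap_product _ _ = 1"

text \<open>The cut must fall right before the first second letter: an earlier cut leaves a first
  letter where B is required, a later one puts a second letter into the exponential of the
  first.\<close>

lemma conv_letter_exp_Bpow:
  "conv (letter_exp False d) (conv (Bpow (Suc 0)) g) (replicate p False @ True # w) = d ^ p / fact p * g w"
proof -
  let ?v = "replicate p False @ True # w"
  have "letter_exp False d (take k ?v) * conv (Bpow (Suc 0)) g (drop k ?v) =
      (if k = p then d ^ p / fact p * g w else 0)" if "k \<le> length ?v" for k
  proof -
    consider "k < p" | "k = p" | "p < k" by linarith
    then show ?thesis
    proof cases
      case 1
      then have "drop k ?v = False # (replicate (p - k - 1) False @ True # w)"
        by (cases "p - k") (auto simp: drop_replicate)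
      then have "conv (Bpow (Suc 0)) g (drop k ?v) = 0" by (simp only: conv_Bpow_1) simp
      then show ?thesis using 1 by simp
    next
      case 2
      then have "drop k ?v = True # w" by simp
      then have "conv (Bpow (Suc 0)) g (drop k ?v) = g w" by (simp only: conv_Bpow_1) simp
      moreover have "letter_exp False d (take k ?v) = d ^ p / fact p"
        using 2 by (auto simp: letter_exp_def)
      ultimately show ?thesis using 2 by simp
    next
      case 3
      then have "True \<in> set (take k ?v)" by (cases "k - p") auto
      then have "letter_exp False d (take k ?v) = 0" by (auto simp: letter_exp_def)
      then show ?thesis using 3 by simp
    qed
  qed
  then have "conv (letter_exp False d) (conv (Bpow (Suc 0)) g) ?v =
      (\<Sum>k\<le>length ?v. if k = p then d ^ p / fact p * g w else 0)"
    unfolding conv_sum[of _ _ ?v] by (intro sum.cong) auto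
  then show ?thesis by simp
qed

lemma pulse_series_encode:
  "length xs = length ps \<Longrightarrow> pulse_series t xs 1 (replicate p False @ encode_tail ps) =
     (hd (xs @ [1]) - t) ^ p / fact p * gap_product xs ps"
proof (induction xs ps arbitrary: t p rule: list_induct2)
  case Nil
  show ?case by (auto simp: letter_exp_def)
next
  case (Cons x xs q ps)
  then show ?case by (simp add: conv_letter_exp_Bpow)
qed

text \<open>The product of the \<open>(c\<^sub>l\<^sub>+\<^sub>1 - c\<^sub>l)^p\<^sub>l / p\<^sub>l!\<close> is a linear combination of monomials in
  \<open>c\<^sub>1, \<dots>, c\<^sub>k\<close>. Here \<open>\<mu>\<close> gives the values of the monomials, and \<open>e\<close> is the exponent that the
  expansion of the preceding factors has put on the next variable.\<close>

fun gap_expansion :: "(nat list \<Rightarrow> real) \<Rightarrow> nat \<Rightarrow> nat list \<Rightarrow> real" where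
  "gap_expansion \<mu> e [] = \<mu> []"
| "gap_expansion \<mu> e (p # ps) = (\<Sum>i\<le>p. (-1) ^ i / (fact i * fact (p - i)) *
     gap_expansion (\<lambda>js. \<mu> ((e + i + 1) # js)) (p - i) ps)"

text \<open>Only multi-indices of the length of \<open>ps\<close> and of bounded weight are ever
  evaluated. With \<open>e\<close> the number of leading first letters the bound is the length of
  the encoded word, which is how weights come to be compared with word lengths. The power that
  reaches the end time 1 is lost, so the weight may be smaller.\<close>

lemma gap_expansion_cong:
  assumes "\<And>js. length js = length ps \<Longrightarrow> \<forall>j\<in>set js. 1 \<le> j \<Longrightarrow> sum_list js \<le> e + sum_list ps + length ps
     \<Longrightarrow> \<mu> js = \<nu> js"
  shows "gap_expansion \<mu> e ps = gap_expansion \<nu> e ps"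
  using assms
proof (induction ps arbitrary: \<mu> \<nu> e)
  case (Cons p ps)
  have "gap_expansion (\<lambda>js. \<mu> ((e + i + 1) # js)) (p - i) ps =
      gap_expansion (\<lambda>js. \<nu> ((e + i + 1) # js)) (p - i) ps" if "i \<le> p" for i
    by (rule Cons.IH, rule Cons.prems) (use that in auto)
  then show ?case by simp
qed simp

lemma gap_expansion_cmult: "gap_expansion (\<lambda>js. c * \<mu> js) e ps = c * gap_expansion \<mu> e ps"
  by (induction ps arbitrary: \<mu> e) (simp_all add: sum_distrib_left mult_ac)

lemma gap_expansion_sum:
  "gap_expansion (\<lambda>js. \<Sum>i\<in>I. \<mu> i js) e ps = (\<Sum>i\<in>I. gap_expansion (\<mu> i) e ps)"
proof (induction ps arbitrary: \<mu> e)
  case (Cons p ps)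
  show ?case unfolding gap_expansion.simps Cons.IH sum_distrib_left by (rule sum.swap)
qed simp

lemma gap_expansion_monomial:
  "length xs = length ps \<Longrightarrow> gap_expansion (monomial xs) e ps = hd (xs @ [1]) ^ e * gap_product xs ps"
proof (induction xs ps arbitrary: e rule: list_induct2)
  case (Cons x xs p ps)
  let ?y = "hd (xs @ [1])"
  have "gap_expansion (monomial (x # xs)) e (p # ps) =
      (\<Sum>i\<le>p. (-1) ^ i / (fact i * fact (p - i)) * (x ^ (e + i) * (?y ^ (p - i) * gap_product xs ps)))"
    by (simp add: gap_expansion_cmult Cons.IH)
  also have "\<dots> = x ^ e * gap_product xs ps * (\<Sum>i\<le>p. (- x) ^ i / fact i * (?y ^ (p - i) / fact (p - i)))"
    unfolding sum_distrib_left by (intro sum.cong refl) (simp add: power_add power_minus[of x] mult_ac)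
  finally show ?case unfolding sum_binomial_fact by (simp add: mult_ac)
qed simp

text \<open>The beta integral of y^x (1 - y)^p over [0, 1], with the second factor expanded.
  Pascal's rule reduces \<open>Suc p\<close> at \<open>x\<close> to \<open>p\<close> at
  \<open>x\<close> and at \<open>x + 1\<close>.\<close>

lemma sum_alternating_binomial_inverse:
  "(\<Sum>i\<le>p. (-1) ^ i * real (p choose i) / real (x + i + 1)) = fact p * fact x / fact (x + p + 1)"
proof (induction p arbitrary: x)
  case 0
  show ?case by (simp add: fact_Suc)
next
  case (Suc p)
  define h where "h i = 1 / real (x + i + 1)" for i
  have "(\<Sum>i\<le>Suc p. (-1) ^ i * real (Suc p choose i) * h i) =
      h 0 + (\<Sum>i\<le>p. (-1) ^ Suc i * real (Suc p choose Suc i) * h (Suc i))"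
    by (subst sum.atMost_Suc_shift) simp
  also have "\<dots> = (h 0 + (\<Sum>i\<le>p. (-1) ^ Suc i * real (p choose Suc i) * h (Suc i))) -
      (\<Sum>i\<le>p. (-1) ^ i * real (p choose i) * h (Suc i))"
    by (simp add: algebra_simps sum.distrib sum_subtractf sum_negf)
  also have "h 0 + (\<Sum>i\<le>p. (-1) ^ Suc i * real (p choose Suc i) * h (Suc i)) =
      (\<Sum>i\<le>Suc p. (-1) ^ i * real (p choose i) * h i)"
    by (subst sum.atMost_Suc_shift) simp
  also have "\<dots> = (\<Sum>i\<le>p. (-1) ^ i * real (p choose i) * h i)" by simp
  finally have "(\<Sum>i\<le>Suc p. (-1) ^ i * real (Suc p choose i) / real (x + i + 1)) =
      fact p * fact x / fact (x + p + 1) - fact p * fact (x + 1) / fact (x + 1 + p + 1)"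
    using Suc.IH[of x] Suc.IH[of "x + 1"] by (simp add: h_def)
  also have "\<dots> = fact (Suc p) * fact x / fact (x + Suc p + 1)"
  proof -
    define F where "F = (fact (x + p + 1) :: real)"
    define z where "z = real (x + p + 2)"
    have "fact (x + 1 + p + 1) = z * F" "fact (x + Suc p + 1) = z * F"
      by (simp_all add: F_def z_def algebra_simps)
    moreover have "fact (x + 1) = real (x + 1) * fact x" "fact (Suc p) = (z - real (x + 1)) * fact p"
      by (simp_all add: z_def)
    moreover have "u / F - u * y / (z * F) = (z - y) * u / (z * F)" for u y
    proof -
      have "F \<noteq> 0" "z \<noteq> 0" by (auto simp: F_def z_def)
      then show ?thesis by (simp add: field_simps)
    qed
    from this[of "fact p * fact x" "real (x + 1)"]
    have "fact p * fact x / F - fact p * (real (x + 1) * fact x) / (z * F) =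
        (z - real (x + 1)) * fact p * fact x / (z * F)" by (simp only: mult_ac)
    ultimately show ?thesis unfolding F_def[symmetric] by (simp only:)
  qed
  finally show ?case .
qed

text \<open>The prefix \<open>qs\<close> holds the indices already chosen. After appending
  \<open>e + i + 1\<close> the remaining exponent is \<open>p - i\<close>, so weight plus exponent,
  and with it the factorial from the induction hypothesis, does not depend on \<open>i\<close>. What
  remains is the alternating sum above.\<close>

lemma gap_expansion_beta:
  "gap_expansion (\<lambda>js. beta (qs @ js)) e ps =
     beta qs * fact (sum_list qs + e) / fact (sum_list qs + e + sum_list ps + length ps)"
proof (induction ps arbitrary: qs e)
  case (Cons p ps)
  define x where "x = sum_list qs + e"
  define N where "N = x + 1 + p + sum_list ps + length ps"
  have "gap_expansion (\<lambda>js. beta (qs @ js)) e (p # ps) = (\<Sum>i\<le>p. (-1) ^ i / (fact i * fact (p - i)) *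
      (beta (qs @ [e + i + 1]) * fact (x + 1 + p) / fact N))"
    unfolding gap_expansion.simps
  proof (intro sum.cong refl, goal_cases)
    case (1 i)
    then show ?case using Cons[of "qs @ [e + i + 1]" "p - i"] by (simp add: x_def N_def add_ac)
  qed
  also have "\<dots> = beta qs * fact (x + 1 + p) / fact N / fact p *
      (\<Sum>i\<le>p. (-1) ^ i * real (p choose i) / real (x + i + 1))"
    unfolding sum_distrib_left
  proof (intro sum.cong refl, goal_cases)
    case (1 i)
    then have "real (p choose i) = fact p / (fact i * fact (p - i))" by (simp add: binomial_fact)
    then show ?case by (simp add: beta_snoc x_def add_ac mult_ac)
  qed
  also have "\<dots> = beta qs * fact x / fact N"
    unfolding sum_alternating_binomial_inverse by (simp add: add_ac del: fact_Suc)
  finally show ?case by (simp add: x_def N_def add_ac)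
qed simp

lemma series_prod_splitting_steps_exact:
  assumes "c_coeff a (s + 1) = 1"
    and "\<And>js. length js = nB w \<Longrightarrow> \<forall>j\<in>set js. 1 \<le> j \<Longrightarrow> sum_list js \<le> length w
      \<Longrightarrow> alpha b (c_coeff a) s js = beta js"
  shows "series_prod (splitting_steps a b s) w = 1 / fact (length w)"
proof -
  obtain p ps where w: "w = replicate p False @ encode_tail ps" "nB w = length ps"
    "length w = p + sum_list ps + length ps"
    by (rule word_encoding)
  let ?I = "sorted_indices s (length ps)"
  have "series_prod (splitting_steps a b s) w =
      (\<Sum>is\<in>?I. weight b is * pulse_series 0 (map (c_coeff a) is) 1 w)"
    \<comment> \<open>Consistency makes the end time equal to 1, the value built into
      \<open>gap_product\<close>.\<close>
    unfolding series_prod_splitting_steps w(2) assms(1) ..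
  also have "\<dots> = (\<Sum>is\<in>?I. 1 / fact p * gap_expansion (\<lambda>js. weight b is * monomial (map (c_coeff a) is) js) p ps)"
  proof (intro sum.cong refl, goal_cases)
    case (1 "is")
    then have "length (map (c_coeff a) is) = length ps" by (simp add: sorted_indices_def)
    then show ?case
      by (simp only: w(1) pulse_series_encode gap_expansion_cmult gap_expansion_monomial diff_0_right) simp
  qed
  also have "\<dots> = 1 / fact p * gap_expansion (\<lambda>js. \<Sum>is\<in>?I. weight b is * monomial (map (c_coeff a) is) js) p ps"
    unfolding gap_expansion_sum sum_distrib_left ..
  also have "gap_expansion (\<lambda>js. \<Sum>is\<in>?I. weight b is * monomial (map (c_coeff a) is) js) p ps =
      gap_expansion (\<lambda>js. beta ([] @ js)) p ps"
  proof (rule gap_expansion_cong)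
    fix js assume js: "length js = length ps" "\<forall>j\<in>set js. 1 \<le> j" "sum_list js \<le> p + sum_list ps + length ps"
    then have "alpha b (c_coeff a) s js = beta js" using assms(2) w by simp
    then show "(\<Sum>is\<in>?I. weight b is * monomial (map (c_coeff a) is) js) = beta ([] @ js)"
      unfolding alpha_sum js(1) by simp
  qed
  finally show ?thesis unfolding gap_expansion_beta w(3) by simp
qed

section \<open>Smooth functions on sequence space\<close>

text \<open>\<open>C_k D n\<close> mentions continuity only at order \<open>n\<close>. Collecting
  all lower orders makes continuity of the function itself part of every induction.\<close>

definition smooth_n :: "nat \<Rightarrow> nat \<Rightarrow> ((nat \<Rightarrow> real) \<Rightarrow> real) \<Rightarrow> bool" where
  "smooth_n D n g \<longleftrightarrow> (\<forall>m\<le>n. C_k D m g)"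

definition smooth :: "nat \<Rightarrow> ((nat \<Rightarrow> real) \<Rightarrow> real) \<Rightarrow> bool" where
  "smooth D g \<longleftrightarrow> (\<forall>n. smooth_n D n g)"

definition cube :: "nat \<Rightarrow> real \<Rightarrow> (nat \<Rightarrow> real) set" where
  "cube D M = {x \<in> space_R D. \<forall>i<D. \<bar>x i\<bar> \<le> M}"

lemma space_R_upd [simp]: "x \<in> space_R D \<Longrightarrow> j < D \<Longrightarrow> x(j := t) \<in> space_R D"
  by (auto simp: space_R_def)

lemma C_k_cong:
  "(\<And>x. x \<in> space_R D \<Longrightarrow> g x = h x) \<Longrightarrow> C_k D n g \<longleftrightarrow> C_k D n h"
proof (induction n arbitrary: g h)
  case 0
  then show ?case by (auto cong: continuous_on_cong)
next
  case (Suc n)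
  have eq: "(\<lambda>t. g (x(j := t))) = (\<lambda>t. h (x(j := t)))" if "x \<in> space_R D" "j < D" for x j
    by (rule ext) (rule Suc.prems[OF space_R_upd[OF that]])
  have "C_k D n (partial_deriv j g) \<longleftrightarrow> C_k D n (partial_deriv j h)" if "j < D" for j
    by (rule Suc.IH) (use eq that in \<open>auto simp: partial_deriv_def\<close>)
  then show ?case using eq by (auto cong: conj_cong)
qed

lemma smooth_n_cong: "(\<And>x. x \<in> space_R D \<Longrightarrow> g x = h x) \<Longrightarrow> smooth_n D n g \<longleftrightarrow> smooth_n D n h"
  unfolding smooth_n_def using C_k_cong by blast

lemma smooth_cong: "(\<And>x. x \<in> space_R D \<Longrightarrow> g x = h x) \<Longrightarrow> smooth D g \<longleftrightarrow> smooth D h"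
  unfolding smooth_def using smooth_n_cong by blast

lemma smooth_n_0: "smooth_n D 0 g \<longleftrightarrow> continuous_on (space_R D) g"
  by (simp add: smooth_n_def)

lemma smooth_n_mono: "smooth_n D n g \<Longrightarrow> m \<le> n \<Longrightarrow> smooth_n D m g"
  by (simp add: smooth_n_def)

lemma smooth_n_Suc_iff:
  "smooth_n D (Suc n) g \<longleftrightarrow> continuous_on (space_R D) g \<and>
    (\<forall>j<D. (\<forall>x\<in>space_R D. (\<lambda>t. g (x(j := t))) differentiable (at (x j))) \<and>
           smooth_n D n (partial_deriv j g))"
proof -
  have "(\<forall>m\<le>Suc n. C_k D m g) \<longleftrightarrow> C_k D 0 g \<and> (\<forall>m\<le>n. C_k D (Suc m) g)"
    by (metis Suc_le_mono le0 not0_implies_Suc)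
  then show ?thesis unfolding smooth_n_def by auto
qed

text \<open>The introduction rule behind the closure properties: candidates for the partial
  derivatives are supplied in closed form, and agreement on \<open>space_R D\<close>
  suffices.\<close>

lemma smooth_n_SucI:
  assumes "continuous_on (space_R D) g"
    and "\<And>j x. j < D \<Longrightarrow> x \<in> space_R D \<Longrightarrow> ((\<lambda>t. g (x(j := t))) has_real_derivative g' j x) (at (x j))"
    and "\<And>j. j < D \<Longrightarrow> smooth_n D n (g' j)"
  shows "smooth_n D (Suc n) g"
proof -
  have "smooth_n D n (partial_deriv j g)" if "j < D" for j
  proof -
    have "smooth_n D n (partial_deriv j g) \<longleftrightarrow> smooth_n D n (g' j)"
      by (rule smooth_n_cong) (use assms(2) that in \<open>simp add: partial_deriv_def DERIV_imp_deriv\<close>)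
    then show ?thesis using assms(3) that by blast
  qed
  then show ?thesis unfolding smooth_n_Suc_iff
    using assms(1,2) real_differentiable_def by blast
qed

lemma smooth_n_partial:
  assumes "smooth_n D (Suc n) g" "j < D" "x \<in> space_R D"
  shows "((\<lambda>t. g (x(j := t))) has_real_derivative partial_deriv j g (x(j := t))) (at t)"
proof -
  have "(\<lambda>t'. g ((x(j := t))(j := t'))) differentiable (at ((x(j := t)) j))"
    using assms(1,2) space_R_upd[OF assms(3,2)] unfolding smooth_n_Suc_iff by blast
  then have "(\<lambda>t. g (x(j := t))) differentiable (at t)"
    by (simp only: fun_upd_upd fun_upd_same)
  then have "((\<lambda>t. g (x(j := t))) has_real_derivative deriv (\<lambda>t. g (x(j := t))) t) (at t)"
    by (simp add: DERIV_deriv_iff_real_differentiable)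
  then show ?thesis by (simp add: partial_deriv_def)
qed

lemma smooth_n_partial_at:
  assumes "smooth_n D (Suc n) g" "j < D" "x \<in> space_R D"
  shows "((\<lambda>t. g (x(j := t))) has_real_derivative partial_deriv j g x) (at (x j))"
  using smooth_n_partial[OF assms, of "x j"] by (simp only: fun_upd_triv)

lemma smooth_n_continuous: "smooth_n D n g \<Longrightarrow> continuous_on (space_R D) g"
  by (metis smooth_n_0 smooth_n_mono le0)

lemma smooth_continuous: "smooth D g \<Longrightarrow> continuous_on (space_R D) g"
  unfolding smooth_def using smooth_n_continuous by blast

lemma smooth_partial_deriv: "smooth D g \<Longrightarrow> j < D \<Longrightarrow> smooth D (partial_deriv j g)"
  unfolding smooth_def using smooth_n_Suc_iff by blast

lemma smooth_n_const: "smooth_n D n (\<lambda>x. c)"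
proof (induction n arbitrary: c)
  case (Suc n)
  show ?case by (rule smooth_n_SucI[where g' = "\<lambda>_ _. 0"]) (auto intro: Suc)
qed (simp add: smooth_n_0)

lemma smooth_n_coord: "smooth_n D n (\<lambda>x. x i)"
proof (cases n)
  case 0
  then show ?thesis by (auto simp: smooth_n_0 intro: continuous_on_subset[OF continuous_on_product_coordinates])
next
  case (Suc k)
  show ?thesis unfolding Suc
    by (rule smooth_n_SucI[where g' = "\<lambda>j _. if i = j then 1 else 0"])
      (auto intro: smooth_n_const continuous_on_subset[OF continuous_on_product_coordinates])
qed

lemma smooth_n_add: "smooth_n D n f \<Longrightarrow> smooth_n D n g \<Longrightarrow> smooth_n D n (\<lambda>x. f x + g x)"
proof (induction n arbitrary: f g)
  case 0
  then show ?case by (auto simp: smooth_n_0 intro: continuous_on_add)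
next
  case (Suc n)
  show ?case
  proof (rule smooth_n_SucI[where g' = "\<lambda>j x. partial_deriv j f x + partial_deriv j g x"])
    fix j x assume *: "j < D" "x \<in> space_R D"
    show "((\<lambda>t. f (x(j := t)) + g (x(j := t))) has_real_derivative
        partial_deriv j f x + partial_deriv j g x) (at (x j))"
      by (rule DERIV_add[OF smooth_n_partial_at[OF Suc.prems(1) *] smooth_n_partial_at[OF Suc.prems(2) *]])
  qed (use Suc smooth_n_Suc_iff in \<open>auto intro: continuous_on_add smooth_n_continuous\<close>)
qed

lemma smooth_n_mult: "smooth_n D n f \<Longrightarrow> smooth_n D n g \<Longrightarrow> smooth_n D n (\<lambda>x. f x * g x)"
proof (induction n arbitrary: f g)
  case 0
  then show ?case by (auto simp: smooth_n_0 intro: continuous_on_mult)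
next
  case (Suc n)
  show ?case
  proof (rule smooth_n_SucI[where g' = "\<lambda>j x. partial_deriv j f x * g x + partial_deriv j g x * f x"])
    fix j x assume *: "j < D" "x \<in> space_R D"
    show "((\<lambda>t. f (x(j := t)) * g (x(j := t))) has_real_derivative
        partial_deriv j f x * g x + partial_deriv j g x * f x) (at (x j))"
      using DERIV_mult[OF smooth_n_partial_at[OF Suc.prems(1) *] smooth_n_partial_at[OF Suc.prems(2) *]]
      by (simp only: fun_upd_triv)
  next
    fix j assume "j < D"
    then show "smooth_n D n (\<lambda>x. partial_deriv j f x * g x + partial_deriv j g x * f x)"
      using Suc.prems smooth_n_mono[OF Suc.prems(1), of n] smooth_n_mono[OF Suc.prems(2), of n]
      by (intro smooth_n_add Suc.IH) (auto simp: smooth_n_Suc_iff)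
  qed (use Suc.prems in \<open>auto intro: continuous_on_mult smooth_n_continuous\<close>)
qed

lemma smooth_n_sum: "(\<And>i. i \<in> I \<Longrightarrow> smooth_n D n (f i)) \<Longrightarrow> smooth_n D n (\<lambda>x. \<Sum>i\<in>I. f i x)"
proof (induction I rule: infinite_finite_induct)
  case (insert i I)
  then show ?case by (simp add: smooth_n_add)
qed (simp_all add: smooth_n_const)

lemma tendsto_coordinatewise:
  fixes f :: "'a \<Rightarrow> nat \<Rightarrow> real"
  assumes "\<And>i. ((\<lambda>x. f x i) \<longlongrightarrow> l i) F"
  shows "(f \<longlongrightarrow> l) F"
proof -
  have "limitin (product_topology (\<lambda>i. euclidean) UNIV) f l F"
    unfolding limitin_componentwise using assms by auto
  then show ?thesis by (simp add: euclidean_product_topology)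
qed

lemma mean_value_coordinate:
  assumes "smooth_n D (Suc n) g" "l < D" "x \<in> space_R D"
  shows "\<exists>\<xi>. \<bar>\<xi> - v\<bar> \<le> \<bar>w - v\<bar> \<and> g (x(l := w)) - g (x(l := v)) = partial_deriv l g (x(l := \<xi>)) * (w - v)"
proof -
  note d = smooth_n_partial[OF assms]
  consider "v < w" | "w < v" | "v = w" by linarith
  then show ?thesis
  proof cases
    case 1
    then obtain z where "v < z" "z < w" "g (x(l := w)) - g (x(l := v)) = (w - v) * partial_deriv l g (x(l := z))"
      using MVT2[of v w "\<lambda>t. g (x(l := t))" "\<lambda>t. partial_deriv l g (x(l := t))"] d by blast
    then show ?thesis by (intro exI[of _ z]) (auto simp: mult.commute)
  next
    case 2
    then obtain z where "w < z" "z < v" "g (x(l := v)) - g (x(l := w)) = (v - w) * partial_deriv l g (x(l := z))"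
      using MVT2[of w v "\<lambda>t. g (x(l := t))" "\<lambda>t. partial_deriv l g (x(l := t))"] d by blast
    then show ?thesis by (intro exI[of _ z]) (auto simp: algebra_simps)
  next
    case 3
    then show ?thesis by (intro exI[of _ v]) auto
  qed
qed

text \<open>The increment of \<open>g\<close> along the curve is split into increments in one coordinate at a time.\<close>

lemma smooth_n_chain_rule:
  assumes g: "smooth_n D (Suc n) g" and t: "t \<in> S" and u: "\<And>s. s \<in> S \<Longrightarrow> u s \<in> space_R D"
    and u': "\<And>l. l < D \<Longrightarrow> ((\<lambda>s. u s l) has_real_derivative u' l) (at t within S)"
  shows "((\<lambda>s. g (u s)) has_real_derivative (\<Sum>l<D. partial_deriv l g (u t) * u' l)) (at t within S)"
proof -
  define y where "y l s = (\<lambda>i. if i < l then u s i else u t i)" for l s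
  have ysp: "y l s \<in> space_R D" if "s \<in> S" for l s
    using u[OF that] u[OF t] by (auto simp: y_def space_R_def)
  have y0: "y 0 s = u t" for s by (simp add: y_def)
  have yD: "y D s = u s" if "s \<in> S" for s
    using u[OF that] u[OF t] by (auto simp: y_def space_R_def fun_eq_iff)
  have ysuc: "y (Suc l) s = (y l s)(l := u s l)" for l s
    by (auto simp: y_def fun_eq_iff less_Suc_eq)
  have yself: "(y l s)(l := u t l) = y l s" for l s
    by (auto simp: y_def fun_eq_iff)
  have lim_u: "((\<lambda>s. u s l) \<longlongrightarrow> u t l) (at t within S)" for l
  proof (cases "l < D")
    case True
    then show ?thesis using u'[OF True] DERIV_continuous continuous_within by blast
  next
    case False
    then have "\<forall>\<^sub>F s in at t within S. u s l = u t l"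
      using u t by (auto simp: space_R_def eventually_at_filter)
    then show ?thesis by (rule tendsto_eventually)
  qed
  have step: "((\<lambda>s. (g (y (Suc l) s) - g (y l s)) / (s - t)) \<longlongrightarrow> partial_deriv l g (u t) * u' l) (at t within S)"
    if l: "l < D" for l
  proof -
    have "\<forall>s\<in>S. \<exists>\<xi>. \<bar>\<xi> - u t l\<bar> \<le> \<bar>u s l - u t l\<bar> \<and>
        g (y (Suc l) s) - g (y l s) = partial_deriv l g ((y l s)(l := \<xi>)) * (u s l - u t l)"
    proof
      fix s assume "s \<in> S"
      from mean_value_coordinate[OF g l ysp[OF this, of l], of "u t l" "u s l"]
      show "\<exists>\<xi>. \<bar>\<xi> - u t l\<bar> \<le> \<bar>u s l - u t l\<bar> \<and>
        g (y (Suc l) s) - g (y l s) = partial_deriv l g ((y l s)(l := \<xi>)) * (u s l - u t l)"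
        unfolding ysuc yself .
    qed
    then obtain \<xi> where \<xi>: "\<And>s. s \<in> S \<Longrightarrow> \<bar>\<xi> s - u t l\<bar> \<le> \<bar>u s l - u t l\<bar>"
      "\<And>s. s \<in> S \<Longrightarrow> g (y (Suc l) s) - g (y l s) = partial_deriv l g ((y l s)(l := \<xi> s)) * (u s l - u t l)"
      by (auto dest!: bchoice)
    have evS: "\<forall>\<^sub>F s in at t within S. s \<in> S" by (simp add: eventually_at_filter)
    have "((\<lambda>s. \<xi> s - u t l) \<longlongrightarrow> 0) (at t within S)"
    proof (rule Lim_null_comparison)
      show "\<forall>\<^sub>F s in at t within S. norm (\<xi> s - u t l) \<le> \<bar>u s l - u t l\<bar>"
        using evS by eventually_elim (use \<xi>(1) in auto)
      show "((\<lambda>s. \<bar>u s l - u t l\<bar>) \<longlongrightarrow> 0) (at t within S)"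
        using tendsto_rabs[OF tendsto_diff[OF lim_u[of l] tendsto_const[of "u t l"]]] by simp
    qed
    then have lim\<xi>: "(\<xi> \<longlongrightarrow> u t l) (at t within S)" by (simp add: LIM_zero_iff)
    have "((\<lambda>s. (y l s)(l := \<xi> s)) \<longlongrightarrow> u t) (at t within S)"
    proof (rule tendsto_coordinatewise)
      fix i
      show "((\<lambda>s. ((y l s)(l := \<xi> s)) i) \<longlongrightarrow> u t i) (at t within S)"
        using lim\<xi> lim_u[of i] by (cases "i = l"; cases "i < l") (auto simp: y_def)
    qed
    moreover have "continuous_on (space_R D) (partial_deriv l g)"
      using g l smooth_n_continuous unfolding smooth_n_Suc_iff by blast
    moreover have "\<forall>\<^sub>F s in at t within S. (y l s)(l := \<xi> s) \<in> space_R D"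
      using evS by eventually_elim (use ysp l in auto)
    ultimately have "((\<lambda>s. partial_deriv l g ((y l s)(l := \<xi> s))) \<longlongrightarrow> partial_deriv l g (u t)) (at t within S)"
      using continuous_on_tendsto_compose u[OF t] by blast
    moreover have "((\<lambda>s. (u s l - u t l) / (s - t)) \<longlongrightarrow> u' l) (at t within S)"
      using u'[OF l] by (simp add: has_field_derivative_iff)
    ultimately have "((\<lambda>s. partial_deriv l g ((y l s)(l := \<xi> s)) * ((u s l - u t l) / (s - t))) \<longlongrightarrow>
        partial_deriv l g (u t) * u' l) (at t within S)"
      by (rule tendsto_mult)
    then show ?thesis
    proof (rule Lim_transform_eventually)
      show "\<forall>\<^sub>F s in at t within S. partial_deriv l g ((y l s)(l := \<xi> s)) * ((u s l - u t l) / (s - t)) =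
          (g (y (Suc l) s) - g (y l s)) / (s - t)"
        using evS by eventually_elim (simp add: \<xi>(2))
    qed
  qed
  have "((\<lambda>s. \<Sum>l<D. (g (y (Suc l) s) - g (y l s)) / (s - t)) \<longlongrightarrow> (\<Sum>l<D. partial_deriv l g (u t) * u' l)) (at t within S)"
    by (rule tendsto_sum) (use step in auto)
  moreover have "\<forall>\<^sub>F s in at t within S. (\<Sum>l<D. (g (y (Suc l) s) - g (y l s)) / (s - t)) = (g (u s) - g (u t)) / (s - t)"
    unfolding eventually_at_filter
  proof (rule always_eventually, intro allI impI)
    fix s assume "s \<noteq> t" "s \<in> S"
    then show "(\<Sum>l<D. (g (y (Suc l) s) - g (y l s)) / (s - t)) = (g (u s) - g (u t)) / (s - t)"
      unfolding sum_divide_distrib[symmetric]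
      using sum_lessThan_telescope[of "\<lambda>l. g (y l s)" D] by (simp add: y0 yD)
  qed
  ultimately show ?thesis
    unfolding has_field_derivative_iff by (rule Lim_transform_eventually)
qed

lemma smooth_chain_rule:
  assumes "smooth D g" "t \<in> S" "\<And>s. s \<in> S \<Longrightarrow> u s \<in> space_R D"
    and "\<And>l. l < D \<Longrightarrow> ((\<lambda>s. u s l) has_real_derivative u' l) (at t within S)"
  shows "((\<lambda>s. g (u s)) has_real_derivative (\<Sum>l<D. partial_deriv l g (u t) * u' l)) (at t within S)"
  using smooth_n_chain_rule[of D 0 g] assms unfolding smooth_def by blast

abbreviation tuple :: "nat \<Rightarrow> (nat \<Rightarrow> (nat \<Rightarrow> real) \<Rightarrow> real) \<Rightarrow> (nat \<Rightarrow> real) \<Rightarrow> nat \<Rightarrow> real" where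
  "tuple D h x \<equiv> (\<lambda>l. if l < D then h l x else 0)"

lemma tuple_space_R [simp]: "tuple D h x \<in> space_R D"
  by (simp add: space_R_def)

text \<open>The outer function varies in the induction, because the chain rule produces its partial
  derivatives composed with the same inner functions, which are then needed at one order
  less.\<close>

lemma smooth_n_compose:
  assumes "smooth_n D' n g" "\<And>l. l < D' \<Longrightarrow> smooth_n D n (h l)"
  shows "smooth_n D n (\<lambda>x. g (tuple D' h x))"
  using assms
proof (induction n arbitrary: g)
  case 0
  have "continuous_on (space_R D) (\<lambda>x. tuple D' h x)"
  proof (rule continuous_on_coordinatewise_then_product)
    fix l show "continuous_on (space_R D) (\<lambda>x. tuple D' h x l)"
      using 0(2) by (cases "l < D'") (simp_all add: smooth_n_0)
  qed
  then have "continuous_on (space_R D) (\<lambda>x. g (tuple D' h x))"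
    by (rule continuous_on_compose2[OF smooth_n_continuous[OF 0(1)]]) auto
  then show ?case by (simp only: smooth_n_0)
next
  case (Suc n)
  have h: "smooth_n D n (h l)" if "l < D'" for l
    using Suc.prems(2)[OF that] smooth_n_mono by fastforce
  have cont: "continuous_on (space_R D) (\<lambda>x. g (tuple D' h x))"
  proof -
    have "continuous_on (space_R D) (\<lambda>x. tuple D' h x)"
    proof (rule continuous_on_coordinatewise_then_product)
      fix l show "continuous_on (space_R D) (\<lambda>x. tuple D' h x l)"
        using Suc.prems(2) smooth_n_continuous by (cases "l < D'") auto
    qed
    then show ?thesis
      by (rule continuous_on_compose2[OF smooth_n_continuous[OF Suc.prems(1)]]) auto
  qed
  show ?case
  proof (rule smooth_n_SucI[where g' = "\<lambda>j x. \<Sum>l<D'. partial_deriv l g (tuple D' h x) * partial_deriv j (h l) x"])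
    fix j x assume *: "j < D" "x \<in> space_R D"
    have "((\<lambda>s. g (tuple D' h (x(j := s)))) has_real_derivative
        (\<Sum>l<D'. partial_deriv l g (tuple D' h (x(j := x j))) * partial_deriv j (h l) x)) (at (x j))"
    proof (rule smooth_n_chain_rule[OF Suc.prems(1), where u = "\<lambda>s. tuple D' h (x(j := s))"])
      fix l assume "l < D'"
      then show "((\<lambda>s. tuple D' h (x(j := s)) l) has_real_derivative partial_deriv j (h l) x) (at (x j))"
        using smooth_n_partial_at[OF Suc.prems(2) *, of l] by (simp only: if_True)
    qed auto
    then show "((\<lambda>t. g (tuple D' h (x(j := t)))) has_real_derivative
        (\<Sum>l<D'. partial_deriv l g (tuple D' h x) * partial_deriv j (h l) x)) (at (x j))"
      by (simp only: fun_upd_triv)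
  next
    fix j assume "j < D"
    show "smooth_n D n (\<lambda>x. \<Sum>l<D'. partial_deriv l g (tuple D' h x) * partial_deriv j (h l) x)"
    proof (rule smooth_n_sum, rule smooth_n_mult)
      fix l assume "l \<in> {..<D'}"
      then have l: "l < D'" by simp
      show "smooth_n D n (\<lambda>x. partial_deriv l g (tuple D' h x))"
        by (rule Suc.IH) (use Suc.prems(1) l h in \<open>auto simp: smooth_n_Suc_iff\<close>)
      show "smooth_n D n (partial_deriv j (h l))"
        using Suc.prems(2)[OF l] \<open>j < D\<close> by (simp add: smooth_n_Suc_iff)
    qed
  qed (rule cont)
qed

text \<open>The integration variable is stored as coordinate \<open>D\<close> of a function on one
  more dimension. Joint smoothness is then the same notion as before, and it justifies
  differentiation under the integral sign.\<close>

lemma smooth_n_integral: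
  assumes "smooth_n (Suc D) n g"
  shows "smooth_n D n (\<lambda>x. integral {0..1} (\<lambda>s. g (x(D := s))))"
  using assms
proof (induction n arbitrary: g)
  case 0
  then have "continuous_on (space_R (Suc D)) g" by (simp add: smooth_n_0)
  moreover have "continuous_on (space_R D \<times> {0..1}) (\<lambda>p. (fst p)(D := snd p))"
  proof (rule continuous_on_coordinatewise_then_product)
    fix i
    show "continuous_on (space_R D \<times> {0..1}) (\<lambda>p. ((fst p)(D := snd p)) i)"
    proof (cases "i = D")
      case False
      have "continuous_on (space_R D \<times> {0..1}) (\<lambda>p. fst p i)"
        by (rule continuous_on_product_then_coordinatewise) (rule continuous_on_fst[OF continuous_on_id])
      then show ?thesis using False by simp
    qed (simp add: continuous_on_snd)
  qed
  ultimately have "continuous_on (space_R D \<times> {0..1}) (\<lambda>p. g ((fst p)(D := snd p)))"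
    by (rule continuous_on_compose2) (auto simp: space_R_def)
  then have "continuous_on (space_R D \<times> cbox 0 1) (\<lambda>(x, s). g (x(D := s)))"
    by (simp add: split_beta)
  from integral_continuous_on_param[OF this] show ?case by (simp only: smooth_n_0 cbox_interval)
next
  case (Suc n)
  have sec: "continuous_on S (\<lambda>s. g (x(D := s)))" if "x \<in> space_R D" "continuous_on (space_R (Suc D)) g" for S x g
  proof -
    have "continuous_on S (\<lambda>s. x(D := s))"
    proof (rule continuous_on_coordinatewise_then_product)
      fix i show "continuous_on S (\<lambda>s. (x(D := s)) i)"
        by (cases "i = D") (simp_all add: continuous_on_id)
    qed
    with that(2) show ?thesis
      by (rule continuous_on_compose2) (use that in \<open>auto simp: space_R_def\<close>)
  qed
  show ?case
  proof (rule smooth_n_SucI[where g' = "\<lambda>j x. integral {0..1} (\<lambda>s. partial_deriv j g (x(D := s)))"])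
    show "continuous_on (space_R D) (\<lambda>x. integral {0..1} (\<lambda>s. g (x(D := s))))"
      by (rule smooth_n_continuous[OF Suc.IH[OF smooth_n_mono[OF Suc.prems]]]) simp
  next
    fix j x assume *: "j < D" "x \<in> space_R D"
    have comm: "(x(j := t))(D := s) = (x(D := s))(j := t)" for t s
      using * by (intro fun_upd_twist) auto
    have sp: "x(D := s) \<in> space_R (Suc D)" for s using * by (auto simp: space_R_def)
    have "((\<lambda>t. integral (cbox 0 1) (\<lambda>s. g ((x(j := t))(D := s)))) has_real_derivative
        integral (cbox 0 1) (\<lambda>s. partial_deriv j g ((x(j := x j))(D := s)))) (at (x j) within UNIV)"
    proof (rule leibniz_rule_field_derivative[where fx = "\<lambda>t s. partial_deriv j g ((x(j := t))(D := s))"])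
      fix t s :: real
      show "((\<lambda>t. g ((x(j := t))(D := s))) has_real_derivative
          partial_deriv j g ((x(j := t))(D := s))) (at t within UNIV)"
        unfolding comm by (rule smooth_n_partial[OF Suc.prems _ sp]) (use * in simp)
    next
      fix t :: real
      show "(\<lambda>s. g ((x(j := t))(D := s))) integrable_on cbox 0 1"
      proof (rule integrable_continuous, rule sec)
        show "x(j := t) \<in> space_R D" by (rule space_R_upd[OF *(2,1)])
      qed (rule smooth_n_continuous[OF Suc.prems])
    next
      have c1: "continuous_on (UNIV \<times> cbox 0 1) (\<lambda>p. (x(j := fst p))(D := snd p) :: nat \<Rightarrow> real)"
      proof (rule continuous_on_coordinatewise_then_product)
        fix i
        show "continuous_on (UNIV \<times> cbox 0 1) (\<lambda>p. ((x(j := fst p))(D := snd p)) i)"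
          by (cases "i = D"; cases "i = j") (simp_all add: continuous_on_fst continuous_on_snd)
      qed
      have c2: "continuous_on (space_R (Suc D)) (partial_deriv j g)"
        using Suc.prems * smooth_n_continuous unfolding smooth_n_Suc_iff by (meson less_SucI)
      have "continuous_on (UNIV \<times> cbox 0 (1::real)) (\<lambda>p. partial_deriv j g ((x(j := fst p))(D := snd p)))"
        by (rule continuous_on_compose2[OF c2 c1]) (use * in \<open>auto simp: space_R_def\<close>)
      then show "continuous_on (UNIV \<times> cbox 0 1) (\<lambda>(t, s). partial_deriv j g ((x(j := t))(D := s)))"
        by (simp add: split_beta)
    qed auto
    then show "((\<lambda>t. integral {0..1} (\<lambda>s. g ((x(j := t))(D := s)))) has_real_derivative
        integral {0..1} (\<lambda>s. partial_deriv j g (x(D := s)))) (at (x j))"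
      by (simp only: fun_upd_triv cbox_interval)
  next
    fix j assume "j < D"
    then show "smooth_n D n (\<lambda>x. integral {0..1} (\<lambda>s. partial_deriv j g (x(D := s))))"
      using Suc.prems by (intro Suc.IH) (simp add: smooth_n_Suc_iff)
  qed
qed

lemma smooth_const: "smooth D (\<lambda>x. c)"
  unfolding smooth_def by (simp add: smooth_n_const)

lemma smooth_coord: "smooth D (\<lambda>x. x i)"
  unfolding smooth_def by (simp add: smooth_n_coord)

lemma smooth_add: "smooth D f \<Longrightarrow> smooth D g \<Longrightarrow> smooth D (\<lambda>x. f x + g x)"
  unfolding smooth_def by (simp add: smooth_n_add)

lemma smooth_mult: "smooth D f \<Longrightarrow> smooth D g \<Longrightarrow> smooth D (\<lambda>x. f x * g x)"
  unfolding smooth_def by (simp add: smooth_n_mult)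

lemma smooth_sum: "(\<And>i. i \<in> I \<Longrightarrow> smooth D (f i)) \<Longrightarrow> smooth D (\<lambda>x. \<Sum>i\<in>I. f i x)"
  unfolding smooth_def by (intro allI smooth_n_sum) simp

lemma smooth_compose:
  "smooth D' g \<Longrightarrow> (\<And>l. l < D' \<Longrightarrow> smooth D (h l)) \<Longrightarrow> smooth D (\<lambda>x. g (tuple D' h x))"
  unfolding smooth_def by (intro allI smooth_n_compose) simp_all

lemma smooth_integral:
  "smooth (Suc D) g \<Longrightarrow> smooth D (\<lambda>x. integral {0..1} (\<lambda>s. g (x(D := s))))"
  unfolding smooth_def by (intro allI smooth_n_integral) simp

lemmas smooth_intros = smooth_const smooth_coord smooth_add smooth_mult smooth_sum

lemma smooth_power: "smooth D f \<Longrightarrow> smooth D (\<lambda>x. f x ^ k)"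
  by (induction k) (simp_all add: smooth_const smooth_mult)

lemma smooth_field_iff:
  "smooth_field D f \<longleftrightarrow> f \<in> space_R D \<rightarrow> space_R D \<and> (\<forall>i<D. smooth D (\<lambda>x. f x i))"
  unfolding smooth_field_def smooth_def smooth_n_def by blast

section \<open>Bounds on compact cubes\<close>

lemma cube_subset: "cube D M \<subseteq> space_R D"
  by (auto simp: cube_def)

lemma cube_mono: "M \<le> N \<Longrightarrow> cube D M \<subseteq> cube D N"
  by (auto simp: cube_def)

text \<open>A product of compact intervals and, from coordinate \<open>D\<close> on, of singletons;
  Tychonoff's theorem applies.\<close>

lemma compact_cube: "compact (cube D M)"
proof -
  have "cube D M = PiE UNIV (\<lambda>i. if i < D then {- M..M} else {0})"
  proof (intro set_eqI iffI)
    fix x assume "x \<in> cube D M"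
    then show "x \<in> PiE UNIV (\<lambda>i. if i < D then {- M..M} else {0})"
      unfolding PiE_UNIV_domain by (auto simp: cube_def space_R_def abs_le_iff minus_le_iff)
  next
    fix x assume "x \<in> PiE UNIV (\<lambda>i. if i < D then {- M..M} else {0})"
    then have *: "x i \<in> (if i < D then {- M..M} else {0})" for i by blast
    have "x i = 0" if "i \<ge> D" for i using *[of i] that by simp
    moreover have "\<bar>x i\<bar> \<le> M" if "i < D" for i using *[of i] that by (simp add: abs_le_iff)
    ultimately show "x \<in> cube D M" by (simp add: cube_def space_R_def)
  qed
  moreover have "compactin (product_topology (\<lambda>i. euclidean) UNIV) (PiE UNIV (\<lambda>i. if i < D then {- M..M} else {0 :: real}))"
    unfolding compactin_PiE by auto
  ultimately show ?thesis by (simp add: euclidean_product_topology)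
qed

lemma smooth_bounded:
  assumes "smooth D g"
  obtains K where "K \<ge> 0" "\<And>x. x \<in> cube D M \<Longrightarrow> \<bar>g x\<bar> \<le> K"
proof -
  have "compact (g ` cube D M)"
    by (rule compact_continuous_image[OF continuous_on_subset[OF smooth_continuous[OF assms] cube_subset] compact_cube])
  then obtain K where "\<forall>y\<in>g ` cube D M. norm y \<le> K"
    using compact_imp_bounded bounded_iff by blast
  then show ?thesis using that[of "max K 0"] by fastforce
qed

lemma cube_convex:
  assumes "x \<in> cube D M" "y \<in> cube D M" "0 \<le> s" "s \<le> 1"
  shows "(\<lambda>i. y i + s * (x i - y i)) \<in> cube D M"
proof -
  have "\<bar>y i + s * (x i - y i)\<bar> \<le> M" if "i < D" for i
  proof -
    have "y i + s * (x i - y i) = (1 - s) * y i + s * x i" by (simp add: algebra_simps)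
    also have "\<bar>\<dots>\<bar> \<le> (1 - s) * \<bar>y i\<bar> + s * \<bar>x i\<bar>"
      using assms by (metis abs_mult abs_of_nonneg abs_triangle_ineq diff_ge_0_iff_ge)
    also have "\<dots> \<le> (1 - s) * M + s * M"
      using assms that by (intro add_mono mult_left_mono) (auto simp: cube_def)
    finally show ?thesis by (simp add: algebra_simps)
  qed
  then show ?thesis using assms by (auto simp: cube_def space_R_def)
qed

lemma smooth_lipschitz:
  assumes "smooth D g"
  obtains L where "L \<ge> 0" "\<And>x y. x \<in> cube D M \<Longrightarrow> y \<in> cube D M \<Longrightarrow> \<bar>g x - g y\<bar> \<le> L * (\<Sum>i<D. \<bar>x i - y i\<bar>)"
proof -
  have "\<forall>l. \<exists>K. l < D \<longrightarrow> K \<ge> 0 \<and> (\<forall>x\<in>cube D M. \<bar>partial_deriv l g x\<bar> \<le> K)"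
    using smooth_bounded[OF smooth_partial_deriv[OF assms]] by metis
  then obtain K where K: "\<And>l. l < D \<Longrightarrow> K l \<ge> 0" "\<And>l x. l < D \<Longrightarrow> x \<in> cube D M \<Longrightarrow> \<bar>partial_deriv l g x\<bar> \<le> K l"
    by metis
  define L where "L = (\<Sum>l<D. K l)"
  have KL: "K l \<le> L" if "l < D" for l
    unfolding L_def by (rule member_le_sum) (use K that in auto)
  have "L \<ge> 0" unfolding L_def by (rule sum_nonneg) (use K in auto)
  moreover have "\<bar>g x - g y\<bar> \<le> L * (\<Sum>i<D. \<bar>x i - y i\<bar>)" if xy: "x \<in> cube D M" "y \<in> cube D M" for x y
  proof -
    define u where "u s = (\<lambda>i. y i + s * (x i - y i))" for s :: real
    have usp: "u s \<in> space_R D" for s using xy by (auto simp: u_def cube_def space_R_def)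
    have "((\<lambda>s. g (u s)) has_real_derivative (\<Sum>l<D. partial_deriv l g (u s) * (x l - y l))) (at s)" for s
    proof (rule smooth_chain_rule[OF assms])
      show "((\<lambda>s. u s l) has_real_derivative x l - y l) (at s)" for l
        unfolding u_def by (auto intro!: derivative_eq_intros)
    qed (use usp in auto)
    then obtain z where z: "0 < z" "z < 1"
      "g (u 1) - g (u 0) = (1 - 0) * (\<Sum>l<D. partial_deriv l g (u z) * (x l - y l))"
      using MVT2[of 0 1 "\<lambda>s. g (u s)" "\<lambda>s. \<Sum>l<D. partial_deriv l g (u s) * (x l - y l)"] by auto
    have "u z \<in> cube D M" unfolding u_def by (rule cube_convex[OF xy]) (use z in auto)
    then have "\<bar>partial_deriv l g (u z) * (x l - y l)\<bar> \<le> L * \<bar>x l - y l\<bar>" if "l < D" for l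
      unfolding abs_mult using K(2) KL that by (intro mult_right_mono) (meson order_trans, simp)
    then have "\<bar>\<Sum>l<D. partial_deriv l g (u z) * (x l - y l)\<bar> \<le> (\<Sum>l<D. L * \<bar>x l - y l\<bar>)"
      by (intro order_trans[OF sum_abs] sum_mono) auto
    moreover have "u 1 = x" "u 0 = y" by (auto simp: u_def)
    ultimately show ?thesis using z(3) by (simp add: sum_distrib_left)
  qed
  ultimately show ?thesis using that by blast
qed

section \<open>Flows of smooth vector fields\<close>

lemma solves_ode_subset: "solves_ode D f S u \<Longrightarrow> T \<subseteq> S \<Longrightarrow> solves_ode D f T u"
  unfolding solves_ode_def by (blast intro: has_field_derivative_subset)

lemma closed_segment_0_real: "closed_segment 0 \<tau> = (if 0 \<le> \<tau> then {0..\<tau>} else {\<tau>..0 :: real})"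
  by (simp add: closed_segment_eq_real_ivl)

lemma mem_closed_segment_0_abs: "\<bar>\<tau>\<bar> \<le> T \<Longrightarrow> closed_segment 0 \<tau> \<subseteq> {- T..T :: real}"
  by (auto simp: closed_segment_0_real abs_le_iff split: if_splits)

text \<open>Forward in time exp(-K t) w is nonincreasing, backward in time exp(K t) w is
  nondecreasing. The two-sided bound on the derivative covers both signs of \<tau>.\<close>

lemma gronwall_zero:
  fixes w :: "real \<Rightarrow> real"
  assumes w: "\<And>t. t \<in> closed_segment 0 \<tau> \<Longrightarrow> (w has_real_derivative w' t) (at t within closed_segment 0 \<tau>)"
    and le: "\<And>t. t \<in> closed_segment 0 \<tau> \<Longrightarrow> \<bar>w' t\<bar> \<le> K * w t"
    and nn: "\<And>t. w t \<ge> 0" and w0: "w 0 = 0" and t: "t \<in> closed_segment 0 \<tau>"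
  shows "w t = 0"
proof (cases "t \<ge> 0")
  case True
  then have sub: "{0..t} \<subseteq> closed_segment 0 \<tau>" using t by (auto simp: closed_segment_0_real split: if_splits)
  have "((\<lambda>s. exp (- K * s) * w s) has_derivative (\<lambda>h. h * (exp (- K * s) * (w' s - K * w s)))) (at s within {0..t})"
    if "0 \<le> s" "s \<le> t" for s
  proof -
    have "((\<lambda>s. exp (- K * s) * w s) has_real_derivative exp (- K * s) * (w' s - K * w s)) (at s within {0..t})"
      using has_field_derivative_subset[OF w sub, of s] that sub
      by (auto intro!: derivative_eq_intros simp: algebra_simps)
    then show ?thesis by (simp add: has_field_derivative_def mult_commute_abs)
  qed
  from mvt_very_simple[OF True this] obtain s where s: "s \<in> {0..t}"
    "exp (- K * t) * w t - exp (- K * 0) * w 0 = (t - 0) * (exp (- K * s) * (w' s - K * w s))" by blast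
  have "w' s - K * w s \<le> 0" using le[of s] s(1) sub by (auto simp: abs_le_iff)
  then have "(t - 0) * (exp (- K * s) * (w' s - K * w s)) \<le> 0"
    using True by (intro mult_nonneg_nonpos) (auto intro: mult_nonneg_nonpos)
  then have "exp (- K * t) * w t \<le> 0" using s(2) w0 by simp
  then show ?thesis using nn[of t] by (simp add: mult_le_0_iff)
next
  case False
  then have "t \<le> 0" by simp
  then have sub: "{t..0} \<subseteq> closed_segment 0 \<tau>" using t by (auto simp: closed_segment_0_real split: if_splits)
  have "((\<lambda>s. exp (K * s) * w s) has_derivative (\<lambda>h. h * (exp (K * s) * (w' s + K * w s)))) (at s within {t..0})"
    if "t \<le> s" "s \<le> 0" for s
  proof -
    have "((\<lambda>s. exp (K * s) * w s) has_real_derivative exp (K * s) * (w' s + K * w s)) (at s within {t..0})"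
      using has_field_derivative_subset[OF w sub, of s] that sub
      by (auto intro!: derivative_eq_intros simp: algebra_simps)
    then show ?thesis by (simp add: has_field_derivative_def mult_commute_abs)
  qed
  from mvt_very_simple[OF \<open>t \<le> 0\<close> this] obtain s where s: "s \<in> {t..0}"
    "exp (K * 0) * w 0 - exp (K * t) * w t = (0 - t) * (exp (K * s) * (w' s + K * w s))" by blast
  have "w' s + K * w s \<ge> 0" using le[of s] s(1) sub by (auto simp: abs_le_iff)
  then have "(0 - t) * (exp (K * s) * (w' s + K * w s)) \<ge> 0"
    using \<open>t \<le> 0\<close> by (intro mult_nonneg_nonneg) auto
  then have "exp (K * t) * w t \<le> 0" using s(2) w0 by simp
  then show ?thesis using nn[of t] by (simp add: mult_le_0_iff)
qed

lemma smooth_field_lipschitz: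
  assumes "\<And>i. i < D \<Longrightarrow> smooth D (\<lambda>x. f x i)"
  obtains L where "L > 0" "\<And>i x y. i < D \<Longrightarrow> x \<in> cube D M \<Longrightarrow> y \<in> cube D M \<Longrightarrow>
    \<bar>f x i - f y i\<bar> \<le> L * (\<Sum>j<D. \<bar>x j - y j\<bar>)"
proof -
  have "\<forall>i. \<exists>L. i < D \<longrightarrow> L \<ge> 0 \<and> (\<forall>x\<in>cube D M. \<forall>y\<in>cube D M. \<bar>f x i - f y i\<bar> \<le> L * (\<Sum>j<D. \<bar>x j - y j\<bar>))"
  proof
    fix i
    show "\<exists>L. i < D \<longrightarrow> L \<ge> 0 \<and> (\<forall>x\<in>cube D M. \<forall>y\<in>cube D M. \<bar>f x i - f y i\<bar> \<le> L * (\<Sum>j<D. \<bar>x j - y j\<bar>))"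
    proof (cases "i < D")
      case True
      show ?thesis by (rule smooth_lipschitz[OF assms[OF True], of M]) blast
    qed simp
  qed
  then obtain l where l: "\<And>i. i < D \<Longrightarrow> l i \<ge> 0"
    "\<And>i x y. i < D \<Longrightarrow> x \<in> cube D M \<Longrightarrow> y \<in> cube D M \<Longrightarrow> \<bar>f x i - f y i\<bar> \<le> l i * (\<Sum>j<D. \<bar>x j - y j\<bar>)"
    by metis
  have "\<bar>f x i - f y i\<bar> \<le> ((\<Sum>i<D. l i) + 1) * (\<Sum>j<D. \<bar>x j - y j\<bar>)"
    if "i < D" "x \<in> cube D M" "y \<in> cube D M" for i x y
  proof -
    have "l i \<le> (\<Sum>i<D. l i)" by (rule member_le_sum) (use l that in auto)
    then have "l i * (\<Sum>j<D. \<bar>x j - y j\<bar>) \<le> ((\<Sum>i<D. l i) + 1) * (\<Sum>j<D. \<bar>x j - y j\<bar>)"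
      by (intro mult_right_mono sum_nonneg) auto
    then show ?thesis using l(2)[OF that] by linarith
  qed
  moreover have "(\<Sum>i<D. l i) \<ge> 0" by (rule sum_nonneg) (use l in auto)
  ultimately show ?thesis using that[of "(\<Sum>i<D. l i) + 1"] by simp
qed

lemma smooth_field_bounded:
  assumes "\<And>i. i < D \<Longrightarrow> smooth D (\<lambda>x. f x i)"
  obtains K where "K > 0" "\<And>i x. i < D \<Longrightarrow> x \<in> cube D M \<Longrightarrow> \<bar>f x i\<bar> \<le> K"
proof -
  have "\<forall>i. \<exists>K. i < D \<longrightarrow> K \<ge> 0 \<and> (\<forall>x\<in>cube D M. \<bar>f x i\<bar> \<le> K)"
  proof
    fix i
    show "\<exists>K. i < D \<longrightarrow> K \<ge> 0 \<and> (\<forall>x\<in>cube D M. \<bar>f x i\<bar> \<le> K)"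
    proof (cases "i < D")
      case True
      show ?thesis by (rule smooth_bounded[OF assms[OF True], of M]) blast
    qed simp
  qed
  then obtain k where k: "\<And>i. i < D \<Longrightarrow> k i \<ge> 0" "\<And>i x. i < D \<Longrightarrow> x \<in> cube D M \<Longrightarrow> \<bar>f x i\<bar> \<le> k i"
    by metis
  have "\<bar>f x i\<bar> \<le> (\<Sum>i<D. k i) + 1" if "i < D" "x \<in> cube D M" for i x
  proof -
    have "k i \<le> (\<Sum>i<D. k i)" by (rule member_le_sum) (use k that in auto)
    then show ?thesis using k(2)[OF that] by linarith
  qed
  moreover have "(\<Sum>i<D. k i) \<ge> 0" by (rule sum_nonneg) (use k in auto)
  ultimately show ?thesis using that[of "(\<Sum>i<D. k i) + 1"] by simp
qed

lemma solves_ode_bounded: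
  assumes "solves_ode D f (closed_segment 0 \<tau>) u"
  obtains M where "\<And>t. t \<in> closed_segment 0 \<tau> \<Longrightarrow> u t \<in> cube D M"
proof -
  have "\<forall>i. \<exists>K. i < D \<longrightarrow> (\<forall>t\<in>closed_segment 0 \<tau>. \<bar>u t i\<bar> \<le> K)"
  proof
    fix i
    show "\<exists>K. i < D \<longrightarrow> (\<forall>t\<in>closed_segment 0 \<tau>. \<bar>u t i\<bar> \<le> K)"
    proof (cases "i < D")
      case True
      then have "continuous_on (closed_segment 0 \<tau>) (\<lambda>t. u t i)"
        using assms unfolding solves_ode_def
        by (auto simp: continuous_on_eq_continuous_within intro: DERIV_continuous)
      then have "compact ((\<lambda>t. u t i) ` closed_segment 0 \<tau>)"
        by (rule compact_continuous_image) simp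
      then obtain K where "\<forall>y\<in>(\<lambda>t. u t i) ` closed_segment 0 \<tau>. norm y \<le> K"
        using compact_imp_bounded bounded_iff by blast
      then show ?thesis by auto
    qed simp
  qed
  then obtain k where k: "\<And>i t. i < D \<Longrightarrow> t \<in> closed_segment 0 \<tau> \<Longrightarrow> \<bar>u t i\<bar> \<le> k i" by metis
  have "\<bar>u t i\<bar> \<le> (\<Sum>j<D. \<bar>k j\<bar>)" if "i < D" "t \<in> closed_segment 0 \<tau>" for i t
  proof -
    have "\<bar>k i\<bar> \<le> (\<Sum>j<D. \<bar>k j\<bar>)" by (rule member_le_sum) (use that in auto)
    then show ?thesis using k[OF that] by linarith
  qed
  then show ?thesis using assms that[of "\<Sum>j<D. \<bar>k j\<bar>"] by (auto simp: cube_def solves_ode_def)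
qed

lemma ode_unique:
  assumes f: "\<And>i. i < D \<Longrightarrow> smooth D (\<lambda>x. f x i)"
    and u: "solves_ode D f (closed_segment 0 \<tau>) u" and v: "solves_ode D f (closed_segment 0 \<tau>) v"
    and init: "u 0 = v 0" and t: "t \<in> closed_segment 0 \<tau>"
  shows "u t = v t"
proof -
  let ?S = "closed_segment 0 \<tau>"
  obtain M1 where M1: "\<And>t. t \<in> ?S \<Longrightarrow> u t \<in> cube D M1" by (rule solves_ode_bounded[OF u]) blast
  obtain M2 where M2: "\<And>t. t \<in> ?S \<Longrightarrow> v t \<in> cube D M2" by (rule solves_ode_bounded[OF v]) blast
  define M where "M = max M1 M2"
  have uM: "u t \<in> cube D M" "v t \<in> cube D M" if "t \<in> ?S" for t
    using M1[OF that] M2[OF that] cube_mono[of M1 M D] cube_mono[of M2 M D] by (auto simp: M_def)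
  obtain L where L: "L > 0" "\<And>i x y. i < D \<Longrightarrow> x \<in> cube D M \<Longrightarrow> y \<in> cube D M \<Longrightarrow>
    \<bar>f x i - f y i\<bar> \<le> L * (\<Sum>j<D. \<bar>x j - y j\<bar>)"
    by (rule smooth_field_lipschitz[OF f, where M = M]) auto
  define d where "d t i = u t i - v t i" for t i
  \<comment> \<open>Squares keep \<open>w\<close> differentiable where the difference vanishes. With
    2xy \<le> x^2 + y^2 the Lipschitz bound becomes |w'| \<le> 2 L D w.\<close>
  define w where "w t = (\<Sum>i<D. (d t i)\<^sup>2)" for t
  define w' where "w' t = (\<Sum>i<D. 2 * d t i * (f (u t) i - f (v t) i))" for t
  have "w t = 0"
  proof (rule gronwall_zero[where w = w and t = t and \<tau> = \<tau> and w' = w' and K = "2 * L * D"])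
    fix t assume t: "t \<in> ?S"
    have "((\<lambda>t. (d t i)\<^sup>2) has_real_derivative 2 * d t i * (f (u t) i - f (v t) i)) (at t within ?S)"
      if "i < D" for i
    proof -
      have "((\<lambda>t. d t i) has_real_derivative f (u t) i - f (v t) i) (at t within ?S)"
        unfolding d_def using u v t that unfolding solves_ode_def by (intro DERIV_diff) auto
      from DERIV_power[OF this, of 2] show ?thesis by (simp add: mult_ac)
    qed
    then show "(w has_real_derivative w' t) (at t within ?S)"
      unfolding w_def w'_def by (intro DERIV_sum) simp
    have "\<bar>2 * d t i * (f (u t) i - f (v t) i)\<bar> \<le> (\<Sum>j<D. L * ((d t i)\<^sup>2 + (d t j)\<^sup>2))" if "i < D" for i
    proof -
      have "\<bar>f (u t) i - f (v t) i\<bar> \<le> L * (\<Sum>j<D. \<bar>d t j\<bar>)"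
        unfolding d_def by (rule L(2)) (use uM t that in auto)
      then have "\<bar>2 * d t i * (f (u t) i - f (v t) i)\<bar> \<le> 2 * \<bar>d t i\<bar> * (L * (\<Sum>j<D. \<bar>d t j\<bar>))"
        unfolding abs_mult by (intro mult_mono) auto
      also have "\<dots> = (\<Sum>j<D. L * (2 * \<bar>d t i\<bar> * \<bar>d t j\<bar>))"
        by (simp add: sum_distrib_left mult_ac)
      also have "\<dots> \<le> (\<Sum>j<D. L * ((d t i)\<^sup>2 + (d t j)\<^sup>2))"
      proof (intro sum_mono mult_left_mono)
        fix j
        show "2 * \<bar>d t i\<bar> * \<bar>d t j\<bar> \<le> (d t i)\<^sup>2 + (d t j)\<^sup>2"
          using sum_squares_bound[of "\<bar>d t i\<bar>" "\<bar>d t j\<bar>"] by simp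
      qed (use L(1) in auto)
      finally show ?thesis .
    qed
    then have "\<bar>w' t\<bar> \<le> (\<Sum>i<D. \<Sum>j<D. L * ((d t i)\<^sup>2 + (d t j)\<^sup>2))"
      unfolding w'_def by (intro order_trans[OF sum_abs] sum_mono) auto
    also have "\<dots> = L * ((\<Sum>i<D. \<Sum>j<D. (d t i)\<^sup>2) + (\<Sum>i<D. \<Sum>j<D. (d t j)\<^sup>2))"
      by (simp only: sum_distrib_left[symmetric] sum.distrib)
    also have "\<dots> = 2 * L * D * w t"
      by (simp add: w_def sum_distrib_left[symmetric] algebra_simps)
    finally show "\<bar>w' t\<bar> \<le> 2 * L * D * w t" .
  next
    show "w t \<ge> 0" for t unfolding w_def by (rule sum_nonneg) simp
    show "w 0 = 0" unfolding w_def d_def init by simp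
  qed (rule t)
  then have "\<forall>i\<in>{..<D}. (d t i)\<^sup>2 = 0"
    unfolding w_def by (subst (asm) sum_nonneg_eq_0_iff) auto
  then have "u t i = v t i" if "i < D" for i using that by (simp add: d_def)
  moreover have "u t i = v t i" if "i \<ge> D" for i
    using u v t that by (simp add: solves_ode_def space_R_def)
  ultimately show ?thesis by (metis ext not_le)
qed

lemma flow_eq:
  assumes "smooth_field D f" "solves_ode D f (closed_segment 0 \<tau>) u"
  shows "flow D f \<tau> (u 0) = u \<tau>"
  unfolding flow_def
proof (rule the_equality)
  fix y assume "\<exists>v. solves_ode D f (closed_segment 0 \<tau>) v \<and> v 0 = u 0 \<and> v \<tau> = y"
  then obtain v where v: "solves_ode D f (closed_segment 0 \<tau>) v" "v 0 = u 0" "v \<tau> = y" by blast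
  have "v \<tau> = u \<tau>"
    by (rule ode_unique[OF _ v(1) assms(2) v(2)]) (use assms(1) in \<open>auto simp: smooth_field_iff\<close>)
  then show "y = u \<tau>" using v(3) by simp
qed (use assms in blast)

section \<open>Existence of solutions by Picard iteration\<close>

lemma geometric_increments_converge:
  fixes a :: "nat \<Rightarrow> real"
  assumes "\<And>n. \<bar>a (Suc n) - a n\<bar> \<le> (1/2) ^ n"
  shows "\<exists>l. a \<longlonglongrightarrow> l \<and> (\<forall>n. \<bar>a n - l\<bar> \<le> 2 * (1/2) ^ n)"
proof -
  have bound: "\<bar>a (n + k) - a n\<bar> \<le> 2 * (1/2) ^ n - 2 * (1/2) ^ (n + k)" for n k
  proof (induction k)
    case (Suc k)
    have "\<bar>a (n + Suc k) - a n\<bar> \<le> \<bar>a (Suc (n + k)) - a (n + k)\<bar> + \<bar>a (n + k) - a n\<bar>" by simp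
    also have "\<dots> \<le> (1/2) ^ (n + k) + (2 * (1/2) ^ n - 2 * (1/2) ^ (n + k))"
      using assms[of "n + k"] Suc by linarith
    finally show ?case by simp
  qed simp
  have bound': "\<bar>a m - a n\<bar> \<le> 2 * (1/2) ^ n" if "n \<le> m" for m n
  proof -
    have "\<bar>a (n + (m - n)) - a n\<bar> \<le> 2 * (1/2) ^ n - 2 * (1/2) ^ (n + (m - n))" by (rule bound)
    moreover have "(0::real) \<le> 2 * (1/2) ^ (n + (m - n))" by simp
    moreover have "n + (m - n) = m" using that by simp
    ultimately show ?thesis by (simp only:)
  qed
  have "Cauchy a"
  proof (rule metric_CauchyI)
    fix e :: real assume "e > 0"
    then obtain N where N: "(1/2 :: real) ^ N < e / 4"
      using real_arch_pow_inv[of "e/4" "1/2"] by auto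
    have "dist (a m) (a n) < e" if "m \<ge> N" "n \<ge> N" for m n
      using bound'[OF that(1)] bound'[OF that(2)] N unfolding dist_real_def by linarith
    then show "\<exists>M. \<forall>m\<ge>M. \<forall>n\<ge>M. dist (a m) (a n) < e" by blast
  qed
  then obtain l where l: "a \<longlonglongrightarrow> l" using Cauchy_convergent convergent_def by blast
  have "\<bar>a n - l\<bar> \<le> 2 * (1/2) ^ n" for n
  proof -
    have "(\<lambda>m. \<bar>a n - a m\<bar>) \<longlonglongrightarrow> \<bar>a n - l\<bar>" by (intro tendsto_intros l)
    moreover have "\<forall>m\<ge>n. \<bar>a n - a m\<bar> \<le> 2 * (1/2) ^ n" using bound'[of n] abs_minus_commute[of "a n"] by simp
    ultimately show ?thesis using LIMSEQ_le_const2 by blast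
  qed
  then show ?thesis using l by blast
qed

text \<open>An integral over \<open>{0..t}\<close> is 0 for negative \<open>t\<close>; the
  difference of two integrals from \<open>-T\<close> is the antiderivative vanishing at 0 on both
  sides.\<close>

lemma antiderivative_from_0:
  fixes \<phi> :: "real \<Rightarrow> real"
  assumes "T \<ge> 0" "continuous_on {- T..T} \<phi>"
  defines "J \<equiv> (\<lambda>\<phi> t. integral {- T..t} \<phi> - integral {- T..0} \<phi>)"
  shows "t \<in> {- T..T} \<Longrightarrow> (J \<phi> has_real_derivative \<phi> t) (at t within {- T..T})"
    and "J \<phi> 0 = 0"
proof -
  assume t: "t \<in> {- T..T}"
  have "((\<lambda>t. integral {- T..t} \<phi>) has_real_derivative \<phi> t) (at t within {- T..T})"
    by (rule integral_has_real_derivative[OF assms(2) t])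
  from DERIV_diff[OF this DERIV_const] show "(J \<phi> has_real_derivative \<phi> t) (at t within {- T..T})"
    unfolding J_def by simp
qed (simp add: J_def)

lemma mean_value_from_0:
  fixes h :: "real \<Rightarrow> real"
  assumes h: "\<And>t. t \<in> {- T..T} \<Longrightarrow> (h has_real_derivative h' t) (at t within {- T..T})" and "h 0 = 0"
    and t: "t \<in> {- T..T}" and B: "\<And>t. t \<in> {- T..T} \<Longrightarrow> \<bar>h' t\<bar> \<le> B"
  shows "\<bar>h t\<bar> \<le> B * T"
proof -
  have "norm (h t - h 0) \<le> B * norm (t - 0)"
  proof (rule field_differentiable_bound[of "{- T..T}" h h' B t 0])
    show "(h has_field_derivative h' s) (at s within {- T..T})" if "s \<in> {- T..T}" for s
      using h that by blast
  qed (use t B in auto)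
  also have "\<dots> \<le> B * T" using t B[OF t] by (intro mult_left_mono) (auto simp: abs_le_iff)
  finally show ?thesis using assms(2) by simp
qed

text \<open>The time \<open>T\<close> depends only on the cube and not on the initial value; all
  later estimates that are uniform in \<open>x\<close> rest on this.\<close>

lemma ode_exists:
  assumes f: "\<And>i. i < D \<Longrightarrow> smooth D (\<lambda>x. f x i)" and "M \<ge> 0"
  shows "\<exists>T>0. \<forall>x\<in>cube D M. \<exists>u. u 0 = x \<and> solves_ode D f {- T..T} u \<and> (\<forall>t\<in>{- T..T}. u t \<in> cube D (M + 1))"
proof -
  obtain K where K: "K > 0" "\<And>i x. i < D \<Longrightarrow> x \<in> cube D (M + 1) \<Longrightarrow> \<bar>f x i\<bar> \<le> K"
    by (rule smooth_field_bounded[OF f, where M = "M + 1"]) auto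
  obtain L where L: "L > 0" "\<And>i x y. i < D \<Longrightarrow> x \<in> cube D (M + 1) \<Longrightarrow> y \<in> cube D (M + 1) \<Longrightarrow>
    \<bar>f x i - f y i\<bar> \<le> L * (\<Sum>j<D. \<bar>x j - y j\<bar>)"
    by (rule smooth_field_lipschitz[OF f, where M = "M + 1"]) auto
  \<comment> \<open>The bound 1/K keeps the iterates within distance 1 of \<open>x\<close>, hence in
    the larger cube. The other bound makes the iteration contract by 1/2; \<open>D + 1\<close> in
    place of \<open>D\<close> avoids division by 0 in dimension 0.\<close>
  define T where "T = min (1 / K) (1 / (2 * L * (D + 1)))"
  have T: "T > 0" "K * T \<le> 1" "L * D * T \<le> 1 / 2"
  proof -
    show "T > 0" using K(1) L(1) by (simp add: T_def)
    have "T \<le> 1 / K" by (simp add: T_def)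
    then show "K * T \<le> 1" using K(1) by (simp add: field_simps)
    have "T \<le> 1 / (2 * L * (D + 1))" by (simp add: T_def)
    moreover have "2 * L * (D + 1) > 0" using L(1) by simp
    ultimately have "T * (2 * L * (D + 1)) \<le> 1" by (simp only: pos_le_divide_eq)
    moreover have "L * T \<ge> 0" using L(1) \<open>T > 0\<close> by simp
    ultimately show "L * D * T \<le> 1 / 2" by (simp add: algebra_simps)
  qed
  let ?I = "{- T..T}"
  define J where "J \<phi> t = integral {- T..t} \<phi> - integral {- T..0} \<phi>" for \<phi> :: "real \<Rightarrow> real" and t
  have J: "(J \<phi> has_real_derivative \<phi> t) (at t within ?I)" "J \<phi> 0 = 0"
    if "continuous_on ?I \<phi>" "t \<in> ?I" for \<phi> t
    using antiderivative_from_0(1)[of T \<phi> t] antiderivative_from_0(2)[of T \<phi>] T(1) that unfolding J_def by auto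
  have "\<exists>u. u 0 = x \<and> solves_ode D f ?I u \<and> (\<forall>t\<in>?I. u t \<in> cube D (M + 1))" if x: "x \<in> cube D M" for x
  proof -
    define U where "U = rec_nat (\<lambda>t. x) (\<lambda>n v t. tuple D (\<lambda>i _. x i + J (\<lambda>s. f (v s) i) t) x)"
    have U0: "U 0 t = x" and USuc: "U (Suc n) t = (\<lambda>i. if i < D then x i + J (\<lambda>s. f (U n s) i) t else 0)" for n t
      unfolding U_def by simp_all
    have cf: "continuous_on ?I (\<lambda>s. f (v s) i)"
      if "i < D" "\<And>j. j < D \<Longrightarrow> continuous_on ?I (\<lambda>t. v t j)" "\<And>t. t \<in> ?I \<Longrightarrow> v t \<in> cube D (M + 1)" for v i
    proof -
      have "continuous_on ?I v"
      proof (rule continuous_on_coordinatewise_then_product)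
        fix j
        show "continuous_on ?I (\<lambda>t. v t j)"
        proof (cases "j < D")
          case False
          have "continuous_on ?I (\<lambda>t. v t j) \<longleftrightarrow> continuous_on ?I (\<lambda>t. 0 :: real)"
            by (rule continuous_on_cong) (use that(3) False in \<open>auto simp: cube_def space_R_def\<close>)
          then show ?thesis by simp
        qed (use that in auto)
      qed
      then show ?thesis
        by (rule continuous_on_compose2[OF smooth_continuous[OF f[OF that(1)]]])
          (use that(3) cube_subset in blast)
    qed
    have inv: "(\<forall>j<D. continuous_on ?I (\<lambda>t. U n t j)) \<and> (\<forall>t\<in>?I. U n t \<in> cube D (M + 1))" for n
    proof (induction n)
      case 0
      show ?case using x cube_mono[of M "M + 1" D] by (auto simp: U0)
    next
      case (Suc n)
      have c: "continuous_on ?I (\<lambda>s. f (U n s) i)" if "i < D" for i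
        by (rule cf) (use that Suc in auto)
      have "continuous_on ?I (\<lambda>t. U (Suc n) t j)" if "j < D" for j
      proof -
        have "continuous_on ?I (J (\<lambda>s. f (U n s) j))"
          using J(1)[OF c[OF that]] DERIV_continuous continuous_on_eq_continuous_within by blast
        then show ?thesis using that by (simp add: USuc continuous_on_add)
      qed
      moreover have "U (Suc n) t \<in> cube D (M + 1)" if t: "t \<in> ?I" for t
      proof -
        have "\<bar>U (Suc n) t i\<bar> \<le> M + 1" if i: "i < D" for i
        proof -
          have "\<bar>J (\<lambda>s. f (U n s) i) t\<bar> \<le> K * T"
            by (rule mean_value_from_0[OF J(1)[OF c[OF i]] J(2)[OF c[OF i] t] t]) (use K(2) i Suc in auto)
          moreover have "\<bar>x i\<bar> \<le> M" using x i by (simp add: cube_def)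
          ultimately show ?thesis using T(2) i by (simp add: USuc)
        qed
        then show ?thesis by (auto simp: cube_def space_R_def USuc)
      qed
      ultimately show ?case by blast
    qed
    have c: "continuous_on ?I (\<lambda>s. f (U n s) i)" if "i < D" for n i
      by (rule cf) (use that inv in auto)
    have Jdiff: "\<bar>J (\<lambda>s. f (v s) i) t - J (\<lambda>s. f (w s) i) t\<bar> \<le> L * D * B * T"
      if i: "i < D" and t: "t \<in> ?I" and cc: "continuous_on ?I (\<lambda>s. f (v s) i)" "continuous_on ?I (\<lambda>s. f (w s) i)"
        and bx: "\<And>s. s \<in> ?I \<Longrightarrow> v s \<in> cube D (M + 1)" "\<And>s. s \<in> ?I \<Longrightarrow> w s \<in> cube D (M + 1)"
        and B: "\<And>s j. s \<in> ?I \<Longrightarrow> j < D \<Longrightarrow> \<bar>v s j - w s j\<bar> \<le> B" for v w i t B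
    proof (rule mean_value_from_0[where h = "\<lambda>t. J (\<lambda>s. f (v s) i) t - J (\<lambda>s. f (w s) i) t" and t = t and h' = "\<lambda>s. f (v s) i - f (w s) i"])
      fix s assume s: "s \<in> ?I"
      show "((\<lambda>t. J (\<lambda>s. f (v s) i) t - J (\<lambda>s. f (w s) i) t) has_real_derivative f (v s) i - f (w s) i) (at s within ?I)"
        by (rule DERIV_diff[OF J(1)[OF cc(1) s] J(1)[OF cc(2) s]])
      have "\<bar>f (v s) i - f (w s) i\<bar> \<le> L * (\<Sum>j<D. \<bar>v s j - w s j\<bar>)"
        by (rule L(2)) (use i s bx in auto)
      also have "\<dots> \<le> L * (\<Sum>j<D. B)"
        by (intro mult_left_mono sum_mono) (use B s L(1) in auto)
      finally show "\<bar>f (v s) i - f (w s) i\<bar> \<le> L * D * B" by simp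
    qed (use J(2)[OF cc(1) t] J(2)[OF cc(2) t] t in auto)
    have incr: "\<bar>U (Suc n) t i - U n t i\<bar> \<le> (1/2) ^ n" if "i < D" "t \<in> ?I" for n t i
      using that
    proof (induction n arbitrary: t i)
      case 0
      have "\<bar>J (\<lambda>s. f (U 0 s) i) t\<bar> \<le> K * T"
        by (rule mean_value_from_0[OF J(1)[OF c[OF 0(1)]] J(2)[OF c[OF 0(1)] 0(2)] 0(2)])
          (use K(2) 0 inv in auto)
      then have "\<bar>J (\<lambda>s. f (U 0 s) i) t\<bar> \<le> 1" using T(2) by linarith
      then show ?case using 0 by (simp add: USuc[of 0] U0)
    next
      case (Suc n)
      have "\<bar>J (\<lambda>s. f (U (Suc n) s) i) t - J (\<lambda>s. f (U n s) i) t\<bar> \<le> L * D * (1/2) ^ n * T"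
        by (rule Jdiff[OF Suc.prems c[OF Suc.prems(1)] c[OF Suc.prems(1)]]) (use inv Suc.IH in auto)
      also have "\<dots> = (1/2) ^ n * (L * D * T)" by simp
      also have "\<dots> \<le> (1/2) ^ n * (1/2)" by (rule mult_left_mono[OF T(3)]) simp
      finally show ?case using Suc.prems(1) by (simp add: USuc[of "Suc n"] USuc[of n])
    qed
    \<comment> \<open>The limit is chosen together with its rate. The rate does not depend on
      \<open>t\<close>, so the convergence is uniform, which gives continuity of \<open>u\<close>
      and permits passing to the limit in the integral equation.\<close>
    define u where "u t = (\<lambda>i. if i < D then SOME l. (\<lambda>n. U n t i) \<longlonglongrightarrow> l \<and>
      (\<forall>n. \<bar>U n t i - l\<bar> \<le> 2 * (1/2) ^ n) else 0)" for t
    have u: "(\<lambda>n. U n t i) \<longlonglongrightarrow> u t i \<and> (\<forall>n. \<bar>U n t i - u t i\<bar> \<le> 2 * (1/2) ^ n)"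
      if "i < D" "t \<in> ?I" for t i
      using someI_ex[OF geometric_increments_converge[OF incr[OF that]]] that(1) by (simp add: u_def)
    have lim: "(\<lambda>n. U n t i) \<longlonglongrightarrow> u t i" if "i < D" "t \<in> ?I" for t i
      using u[OF that] by blast
    have err: "\<bar>U n t i - u t i\<bar> \<le> 2 * (1/2) ^ n" if "i < D" "t \<in> ?I" for t i n
      using u[OF that] by blast
    have ubox: "u t \<in> cube D (M + 1)" if "t \<in> ?I" for t
    proof -
      have "\<bar>u t i\<bar> \<le> M + 1" if "i < D" for i
      proof (rule LIMSEQ_le_const2[OF tendsto_rabs[OF lim[OF that \<open>t \<in> ?I\<close>]]])
        show "\<exists>N. \<forall>n\<ge>N. \<bar>U n t i\<bar> \<le> M + 1" using inv \<open>t \<in> ?I\<close> that by (auto simp: cube_def)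
      qed
      then show ?thesis by (auto simp: cube_def space_R_def u_def)
    qed
    have null: "(\<lambda>n. B * (2 * (1/2) ^ n) * C) \<longlonglongrightarrow> 0" for B C :: real
      by (intro tendsto_mult_left_zero tendsto_mult_right_zero LIMSEQ_power_zero) simp
    have ucont: "continuous_on ?I (\<lambda>t. u t i)" if i: "i < D" for i
    proof (rule uniform_limit_theorem[where f = "\<lambda>n t. U n t i" and F = sequentially])
      show "\<forall>\<^sub>F n in sequentially. continuous_on ?I (\<lambda>t. U n t i)" using inv i by simp
      show "uniform_limit ?I (\<lambda>n t. U n t i) (\<lambda>t. u t i) sequentially"
      proof (rule uniform_limitI)
        fix e :: real assume "e > 0"
        have "\<forall>\<^sub>F n in sequentially. dist (1 * (2 * (1/2 :: real) ^ n) * 1) 0 < e"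
          by (rule tendstoD[OF null \<open>e > 0\<close>])
        then show "\<forall>\<^sub>F n in sequentially. \<forall>t\<in>?I. dist (U n t i) (u t i) < e"
        proof eventually_elim
          case (elim n)
          show ?case
          proof
            fix t assume "t \<in> ?I"
            from err[OF i this, of n] elim show "dist (U n t i) (u t i) < e" by (simp add: dist_real_def)
          qed
        qed
      qed
    qed simp
    have cu: "continuous_on ?I (\<lambda>s. f (u s) i)" if "i < D" for i
      by (rule cf) (use that ucont ubox in auto)
    have fixpt: "u t i = x i + J (\<lambda>s. f (u s) i) t" if "i < D" "t \<in> ?I" for t i
    proof -
      have "(\<lambda>n. J (\<lambda>s. f (U n s) i) t - J (\<lambda>s. f (u s) i) t) \<longlonglongrightarrow> 0"
      proof (rule Lim_null_comparison[OF always_eventually null[of "L * D" T]], rule allI)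
        fix n
        have "\<bar>J (\<lambda>s. f (U n s) i) t - J (\<lambda>s. f (u s) i) t\<bar> \<le> L * D * (2 * (1/2) ^ n) * T"
          by (rule Jdiff[OF that c[OF that(1)] cu[OF that(1)]]) (use inv ubox err in auto)
        then show "norm (J (\<lambda>s. f (U n s) i) t - J (\<lambda>s. f (u s) i) t) \<le> L * D * (2 * (1/2) ^ n) * T"
          by simp
      qed
      then have "(\<lambda>n. x i + J (\<lambda>s. f (U n s) i) t) \<longlonglongrightarrow> x i + J (\<lambda>s. f (u s) i) t"
        by (intro tendsto_add tendsto_const) (simp add: LIM_zero_iff)
      moreover have "(\<lambda>n. U (Suc n) t i) \<longlonglongrightarrow> u t i" using LIMSEQ_Suc[OF lim[OF that]] .
      ultimately show ?thesis using that LIMSEQ_unique by (simp add: USuc)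
    qed
    have zero: "0 \<in> ?I" using T(1) by simp
    have "u 0 = x"
    proof
      fix i
      show "u 0 i = x i"
      proof (cases "i < D")
        case True
        then show ?thesis using fixpt[OF True zero] J(2)[OF cu[OF True] zero] by simp
      next
        case False
        then show ?thesis using x by (simp add: u_def cube_def space_R_def)
      qed
    qed
    moreover have "solves_ode D f ?I u"
      unfolding solves_ode_def
    proof (intro ballI conjI allI impI)
      fix t i assume t: "t \<in> ?I"
      show "u t \<in> space_R D" using ubox[OF t] cube_subset by blast
      assume i: "i < D"
      have "((\<lambda>t. x i + J (\<lambda>s. f (u s) i) t) has_real_derivative 0 + f (u t) i) (at t within ?I)"
        by (rule DERIV_add[OF DERIV_const J(1)[OF cu[OF i] t]])
      then have "((\<lambda>t. x i + J (\<lambda>s. f (u s) i) t) has_real_derivative f (u t) i) (at t within ?I)" by simp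
      then show "((\<lambda>t. u t i) has_real_derivative f (u t) i) (at t within ?I)"
        by (rule has_field_derivative_transform_within[where d = 1]) (use t fixpt[OF i] in auto)
    qed
    ultimately show ?thesis using ubox by blast
  qed
  then show ?thesis using T(1) by blast
qed

lemma flow_exists:
  assumes "smooth_field D f" "M \<ge> 0"
  obtains T where "T > 0" "\<And>x. x \<in> cube D M \<Longrightarrow> solves_ode D f {- T..T} (\<lambda>t. flow D f t x)"
    "\<And>x. x \<in> cube D M \<Longrightarrow> flow D f 0 x = x"
    "\<And>x t. x \<in> cube D M \<Longrightarrow> \<bar>t\<bar> \<le> T \<Longrightarrow> flow D f t x \<in> cube D (M + 1)"
proof -
  obtain T where T: "T > 0" "\<And>x. x \<in> cube D M \<Longrightarrow>
      \<exists>u. u 0 = x \<and> solves_ode D f {- T..T} u \<and> (\<forall>t\<in>{- T..T}. u t \<in> cube D (M + 1))"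
    using ode_exists[of D f M] assms unfolding smooth_field_iff by blast
  have *: "\<exists>u. u 0 = x \<and> solves_ode D f {- T..T} u \<and> (\<forall>t\<in>{- T..T}. u t \<in> cube D (M + 1) \<and> flow D f t x = u t)"
    if x: "x \<in> cube D M" for x
  proof -
    obtain u where u: "u 0 = x" "solves_ode D f {- T..T} u" "\<forall>t\<in>{- T..T}. u t \<in> cube D (M + 1)"
      using T(2)[OF x] by blast
    have "flow D f t x = u t" if "t \<in> {- T..T}" for t
    proof -
      have "closed_segment 0 t \<subseteq> {- T..T}" by (rule mem_closed_segment_0_abs) (use that in auto)
      then show ?thesis using flow_eq[OF assms(1) solves_ode_subset[OF u(2)]] u(1) by blast
    qed
    then show ?thesis using u by blast
  qed
  show ?thesis
  proof (rule that[OF T(1)])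
    fix x assume "x \<in> cube D M"
    from *[OF this] obtain u where u: "u 0 = x" "solves_ode D f {- T..T} u"
      "\<And>t. t \<in> {- T..T} \<Longrightarrow> u t \<in> cube D (M + 1)" "\<And>t. t \<in> {- T..T} \<Longrightarrow> flow D f t x = u t" by blast
    show "flow D f 0 x = x" using u(1) u(4)[of 0] T(1) by simp
    show "flow D f t x \<in> cube D (M + 1)" if "\<bar>t\<bar> \<le> T" for t
      using u(3)[of t] u(4)[of t] that by (auto simp: abs_le_iff)
    show "solves_ode D f {- T..T} (\<lambda>t. flow D f t x)"
      unfolding solves_ode_def
    proof (intro ballI conjI allI impI)
      fix t i assume t: "t \<in> {- T..T}"
      show "flow D f t x \<in> space_R D" using u(2,4) t unfolding solves_ode_def by simp
      assume "i < D"
      then have "((\<lambda>t. u t i) has_real_derivative f (u t) i) (at t within {- T..T})"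
        using u(2) t unfolding solves_ode_def by blast
      then have "((\<lambda>t. flow D f t x i) has_real_derivative f (u t) i) (at t within {- T..T})"
        by (rule has_field_derivative_transform_within[where d = 1]) (use t u(4) in auto)
      then show "((\<lambda>t. flow D f t x i) has_real_derivative f (flow D f t x) i) (at t within {- T..T})"
        using u(4)[OF t] by simp
    qed
  qed
qed

lemma flow_group:
  assumes f: "smooth_field D f" and sol: "solves_ode D f {- T..T} (\<lambda>t. flow D f t x)"
    and st: "\<bar>t\<bar> + \<bar>s\<bar> \<le> T"
  shows "flow D f s (flow D f t x) = flow D f (t + s) x"
proof -
  have "solves_ode D f (closed_segment 0 s) (\<lambda>r. flow D f (t + r) x)"
    unfolding solves_ode_def
  proof (intro ballI conjI allI impI)
    fix r i assume r: "r \<in> closed_segment 0 s"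
    have sub: "(+) t ` closed_segment 0 s \<subseteq> {- T..T}"
      using st by (auto simp: closed_segment_0_real split: if_splits)
    then have tr: "t + r \<in> {- T..T}" using r by blast
    then show "flow D f (t + r) x \<in> space_R D" using sol unfolding solves_ode_def by blast
    assume "i < D"
    then have "((\<lambda>t. flow D f t x i) has_real_derivative f (flow D f (t + r) x) i) (at (t + r) within {- T..T})"
      using sol tr unfolding solves_ode_def by blast
    from has_field_derivative_subset[OF this sub]
    show "((\<lambda>r. flow D f (t + r) x i) has_real_derivative f (flow D f (t + r) x) i) (at r within closed_segment 0 s)"
      unfolding DERIV_at_within_shift .
  qed
  from flow_eq[OF f this] show ?thesis by simp
qed

section \<open>Lie series\<close>

definition lie :: "nat \<Rightarrow> ((nat \<Rightarrow> real) \<Rightarrow> nat \<Rightarrow> real) \<Rightarrow> ((nat \<Rightarrow> real) \<Rightarrow> real) \<Rightarrow> (nat \<Rightarrow> real) \<Rightarrow> real" where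
  "lie D f h x = (\<Sum>j<D. partial_deriv j h x * f x j)"

text \<open>Pull-backs compose in the opposite order: in h o Psi o Phi the operators of Psi are
  applied to h first and those of Phi to the result. So the flow that is applied first owns the
  outermost derivative, the head of the word.\<close>

primrec lie_word :: "nat \<Rightarrow> (bool \<Rightarrow> (nat \<Rightarrow> real) \<Rightarrow> nat \<Rightarrow> real) \<Rightarrow> bool list \<Rightarrow> ((nat \<Rightarrow> real) \<Rightarrow> real)
    \<Rightarrow> (nat \<Rightarrow> real) \<Rightarrow> real" where
  "lie_word D F [] h = h"
| "lie_word D F (l # w) h = lie D (F l) (lie_word D F w h)"

definition words :: "nat \<Rightarrow> bool list set" where
  "words n = {w. length w = n}"

definition lie_coeff :: "nat \<Rightarrow> (bool \<Rightarrow> (nat \<Rightarrow> real) \<Rightarrow> nat \<Rightarrow> real) \<Rightarrow> (bool list \<Rightarrow> real)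
    \<Rightarrow> ((nat \<Rightarrow> real) \<Rightarrow> real) \<Rightarrow> nat \<Rightarrow> (nat \<Rightarrow> real) \<Rightarrow> real" where
  "lie_coeff D F S h n x = (\<Sum>w\<in>words n. S w * lie_word D F w h x)"

definition uniform_O :: "nat \<Rightarrow> real \<Rightarrow> nat \<Rightarrow> (real \<Rightarrow> (nat \<Rightarrow> real) \<Rightarrow> real) \<Rightarrow> bool" where
  "uniform_O D M N r \<longleftrightarrow> (\<exists>C. \<forall>\<^sub>F \<tau> in nhds 0. \<forall>x\<in>cube D M. \<bar>r \<tau> x\<bar> \<le> C * \<bar>\<tau>\<bar> ^ N)"

definition locally_bounded :: "nat \<Rightarrow> (real \<Rightarrow> (nat \<Rightarrow> real) \<Rightarrow> nat \<Rightarrow> real) \<Rightarrow> bool" where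
  "locally_bounded D \<Phi> \<longleftrightarrow> (\<forall>M\<ge>0. \<exists>M'\<ge>0. \<forall>\<^sub>F \<tau> in nhds 0. \<forall>x\<in>cube D M. \<Phi> \<tau> x \<in> cube D M')"

text \<open>The Lie series with coefficients \<open>S\<close> is asymptotic to the action of \<Phi>
  on functions; convergence is not claimed, as the fields are merely smooth. Quantifying over all
  smooth \<open>h\<close> and all cubes makes the notion stable under composition.\<close>

definition represents :: "nat \<Rightarrow> (bool \<Rightarrow> (nat \<Rightarrow> real) \<Rightarrow> nat \<Rightarrow> real) \<Rightarrow> (real \<Rightarrow> (nat \<Rightarrow> real) \<Rightarrow> nat \<Rightarrow> real)
    \<Rightarrow> (bool list \<Rightarrow> real) \<Rightarrow> bool" where
  "represents D F \<Phi> S \<longleftrightarrow> locally_bounded D \<Phi> \<and>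
     (\<forall>h M N. smooth D h \<longrightarrow> 0 \<le> M \<longrightarrow>
        uniform_O D M N (\<lambda>\<tau> x. h (\<Phi> \<tau> x) - (\<Sum>n<N. \<tau> ^ n * lie_coeff D F S h n x)))"

lemma finite_words [simp]: "finite (words n)"
  unfolding words_def using finite_lists_length_eq[of "UNIV :: bool set" n] by simp

lemma words_0 [simp]: "words 0 = {[]}"
  by (auto simp: words_def)

lemma sum_words_Suc:
  "(\<Sum>w\<in>words (Suc n). g w) = (\<Sum>w\<in>words n. g (False # w)) + (\<Sum>w\<in>words n. g (True # w))"
  for g :: "bool list \<Rightarrow> real"
proof -
  have "words (Suc n) = (#) False ` words n \<union> (#) True ` words n"
  proof (intro set_eqI iffI)
    fix w assume "w \<in> words (Suc n)"
    then obtain x v where "w = x # v" "length v = n" by (cases w) (auto simp: words_def)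
    then show "w \<in> (#) False ` words n \<union> (#) True ` words n" by (cases x) (auto simp: words_def)
  qed (auto simp: words_def)
  moreover have "(#) False ` words n \<inter> (#) True ` words n = {}" by auto
  ultimately show ?thesis by (simp add: sum.union_disjoint sum.reindex)
qed

lemma sum_words_append:
  fixes g :: "bool list \<Rightarrow> bool list \<Rightarrow> real"
  assumes "j \<le> n"
  shows "(\<Sum>w\<in>words n. g (take j w) (drop j w)) = (\<Sum>u\<in>words j. \<Sum>v\<in>words (n - j). g u v)"
proof -
  have "(\<Sum>u\<in>words j. \<Sum>v\<in>words (n - j). g u v) = (\<Sum>p\<in>words j \<times> words (n - j). g (fst p) (snd p))"
    by (simp add: sum.cartesian_product split_beta)
  also have "\<dots> = (\<Sum>w\<in>words n. g (take j w) (drop j w))"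
    by (rule sum.reindex_bij_witness[where i = "\<lambda>w. (take j w, drop j w)" and j = "\<lambda>p. fst p @ snd p"])
      (use assms in \<open>auto simp: words_def\<close>)
  finally show ?thesis ..
qed

lemma lie_smooth:
  assumes "\<And>i. i < D \<Longrightarrow> smooth D (\<lambda>x. f x i)" "smooth D h"
  shows "smooth D (lie D f h)"
  unfolding lie_def[abs_def]
  by (intro smooth_sum smooth_mult) (use assms smooth_partial_deriv in auto)

lemma partial_deriv_cong:
  assumes "\<And>x. x \<in> space_R D \<Longrightarrow> g x = h x" "x \<in> space_R D" "j < D"
  shows "partial_deriv j g x = partial_deriv j h x"
proof -
  have "(\<lambda>t. g (x(j := t))) = (\<lambda>t. h (x(j := t)))"
    by (rule ext) (rule assms(1)[OF space_R_upd[OF assms(2,3)]])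
  then show ?thesis unfolding partial_deriv_def by simp
qed

lemma lie_cong:
  assumes "\<And>x. x \<in> space_R D \<Longrightarrow> g x = h x" "x \<in> space_R D"
  shows "lie D f g x = lie D f h x"
  unfolding lie_def by (intro sum.cong refl) (use partial_deriv_cong[OF assms] in simp)

lemma smooth_partial_at:
  assumes "smooth D g" "j < D" "x \<in> space_R D"
  shows "((\<lambda>t. g (x(j := t))) has_real_derivative partial_deriv j g x) (at (x j))"
  using smooth_n_partial_at[of D 0 g] assms unfolding smooth_def by blast

lemma lie_sum:
  assumes "\<And>i. i \<in> I \<Longrightarrow> smooth D (h i)" "x \<in> space_R D"
  shows "lie D f (\<lambda>x. \<Sum>i\<in>I. c i * h i x) x = (\<Sum>i\<in>I. c i * lie D f (h i) x)"
proof -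
  have "partial_deriv j (\<lambda>x. \<Sum>i\<in>I. c i * h i x) x = (\<Sum>i\<in>I. c i * partial_deriv j (h i) x)" if "j < D" for j
    unfolding partial_deriv_def[of j "\<lambda>x. \<Sum>i\<in>I. c i * h i x"]
    by (intro DERIV_imp_deriv DERIV_sum DERIV_cmult smooth_partial_at) (use assms that in auto)
  then have "lie D f (\<lambda>x. \<Sum>i\<in>I. c i * h i x) x = (\<Sum>j<D. \<Sum>i\<in>I. c i * (partial_deriv j (h i) x * f x j))"
    unfolding lie_def by (intro sum.cong refl) (simp add: sum_distrib_right mult.assoc)
  also have "\<dots> = (\<Sum>i\<in>I. \<Sum>j<D. c i * (partial_deriv j (h i) x * f x j))" by (rule sum.swap)
  finally show ?thesis unfolding lie_def by (simp add: sum_distrib_left)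
qed

locale two_fields =
  fixes D :: nat and F :: "bool \<Rightarrow> (nat \<Rightarrow> real) \<Rightarrow> nat \<Rightarrow> real"
  assumes F: "\<And>l. smooth_field D (F l)"
begin

lemma F_smooth: "i < D \<Longrightarrow> smooth D (\<lambda>x. F l x i)"
  using F smooth_field_iff by blast

lemma lie_word_smooth: "smooth D h \<Longrightarrow> smooth D (lie_word D F w h)"
  by (induction w) (auto intro: lie_smooth F_smooth)

lemma lie_word_append: "lie_word D F (u @ v) h = lie_word D F u (lie_word D F v h)"
  by (induction u) auto

lemma lie_word_sum:
  assumes "\<And>i. i \<in> I \<Longrightarrow> smooth D (h i)" "x \<in> space_R D"
  shows "lie_word D F w (\<lambda>x. \<Sum>i\<in>I. c i * h i x) x = (\<Sum>i\<in>I. c i * lie_word D F w (h i) x)"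
  using assms(2)
proof (induction w arbitrary: x)
  case (Cons l w)
  have "lie D (F l) (lie_word D F w (\<lambda>x. \<Sum>i\<in>I. c i * h i x)) x =
      lie D (F l) (\<lambda>x. \<Sum>i\<in>I. c i * lie_word D F w (h i) x) x"
    by (rule lie_cong) (use Cons in auto)
  also have "\<dots> = (\<Sum>i\<in>I. c i * lie D (F l) (lie_word D F w (h i)) x)"
    by (rule lie_sum) (use assms(1) Cons.prems lie_word_smooth in auto)
  finally show ?case by simp
qed simp

lemma lie_coeff_smooth: "smooth D h \<Longrightarrow> smooth D (lie_coeff D F S h n)"
  unfolding lie_coeff_def[abs_def] by (intro smooth_sum smooth_mult smooth_const lie_word_smooth)

lemma lie_coeff_conv:
  assumes h: "smooth D h" and x: "x \<in> space_R D"
  shows "lie_coeff D F (conv S1 S2) h k x = (\<Sum>n\<le>k. lie_coeff D F S1 (lie_coeff D F S2 h (k - n)) n x)"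
proof -
  have "lie_coeff D F S1 (lie_coeff D F S2 h m) n x =
      (\<Sum>u\<in>words n. \<Sum>v\<in>words m. S1 u * S2 v * lie_word D F (u @ v) h x)" for n m
    unfolding lie_coeff_def[abs_def]
    by (subst lie_word_sum) (simp_all add: lie_word_smooth h x lie_word_append sum_distrib_left mult.assoc)
  moreover have "(\<Sum>u\<in>words n. \<Sum>v\<in>words (k - n). S1 u * S2 v * lie_word D F (u @ v) h x) =
      (\<Sum>w\<in>words k. S1 (take n w) * S2 (drop n w) * lie_word D F w h x)" if "n \<le> k" for n
    using sum_words_append[OF that, of "\<lambda>u v. S1 u * S2 v * lie_word D F (u @ v) h x"] by simp
  ultimately have "(\<Sum>n\<le>k. lie_coeff D F S1 (lie_coeff D F S2 h (k - n)) n x) =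
      (\<Sum>n\<le>k. \<Sum>w\<in>words k. S1 (take n w) * S2 (drop n w) * lie_word D F w h x)" by simp
  also have "\<dots> = (\<Sum>w\<in>words k. \<Sum>n\<le>k. S1 (take n w) * S2 (drop n w) * lie_word D F w h x)"
    by (rule sum.swap)
  also have "\<dots> = lie_coeff D F (conv S1 S2) h k x"
    unfolding lie_coeff_def by (intro sum.cong refl) (auto simp: words_def conv_sum sum_distrib_right)
  finally show ?thesis ..
qed

end

section \<open>Remainders that are uniform on cubes\<close>

lemma uniform_O_cong:
  assumes "\<And>\<tau> x. x \<in> cube D M \<Longrightarrow> r \<tau> x = r' \<tau> x" "uniform_O D M N r"
  shows "uniform_O D M N r'"
  using assms unfolding uniform_O_def by (simp cong: ball_cong)

lemma uniform_O_zero: "uniform_O D M N (\<lambda>\<tau> x. 0)"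
  unfolding uniform_O_def by (intro exI[of _ 0]) simp

lemma uniform_O_add:
  assumes "uniform_O D M N r" "uniform_O D M N r'"
  shows "uniform_O D M N (\<lambda>\<tau> x. r \<tau> x + r' \<tau> x)"
proof -
  obtain C C' where "\<forall>\<^sub>F \<tau> in nhds 0. \<forall>x\<in>cube D M. \<bar>r \<tau> x\<bar> \<le> C * \<bar>\<tau>\<bar> ^ N"
    "\<forall>\<^sub>F \<tau> in nhds 0. \<forall>x\<in>cube D M. \<bar>r' \<tau> x\<bar> \<le> C' * \<bar>\<tau>\<bar> ^ N"
    using assms unfolding uniform_O_def by blast
  then have "\<forall>\<^sub>F \<tau> in nhds 0. \<forall>x\<in>cube D M. \<bar>r \<tau> x + r' \<tau> x\<bar> \<le> (C + C') * \<bar>\<tau>\<bar> ^ N"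
  proof eventually_elim
    case (elim \<tau>)
    show ?case
    proof
      fix x assume "x \<in> cube D M"
      then have "\<bar>r \<tau> x\<bar> \<le> C * \<bar>\<tau>\<bar> ^ N" "\<bar>r' \<tau> x\<bar> \<le> C' * \<bar>\<tau>\<bar> ^ N" using elim by auto
      then show "\<bar>r \<tau> x + r' \<tau> x\<bar> \<le> (C + C') * \<bar>\<tau>\<bar> ^ N" by (simp add: distrib_right)
    qed
  qed
  then show ?thesis unfolding uniform_O_def by blast
qed

lemma uniform_O_sum:
  "(\<And>i. i \<in> I \<Longrightarrow> uniform_O D M N (r i)) \<Longrightarrow> uniform_O D M N (\<lambda>\<tau> x. \<Sum>i\<in>I. r i \<tau> x)"
proof (induction I rule: infinite_finite_induct)
  case (insert i I)
  then show ?case using uniform_O_add by simp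
qed (simp_all add: uniform_O_zero)

lemma uniform_O_power:
  assumes "uniform_O D M N r"
  shows "uniform_O D M (n + N) (\<lambda>\<tau> x. \<tau> ^ n * r \<tau> x)"
proof -
  obtain C where "\<forall>\<^sub>F \<tau> in nhds 0. \<forall>x\<in>cube D M. \<bar>r \<tau> x\<bar> \<le> C * \<bar>\<tau>\<bar> ^ N"
    using assms unfolding uniform_O_def by blast
  then have "\<forall>\<^sub>F \<tau> in nhds 0. \<forall>x\<in>cube D M. \<bar>\<tau> ^ n * r \<tau> x\<bar> \<le> C * \<bar>\<tau>\<bar> ^ (n + N)"
  proof eventually_elim
    case (elim \<tau>)
    show ?case
    proof
      fix x assume "x \<in> cube D M"
      then have "\<bar>\<tau>\<bar> ^ n * \<bar>r \<tau> x\<bar> \<le> \<bar>\<tau>\<bar> ^ n * (C * \<bar>\<tau>\<bar> ^ N)"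
        using elim by (intro mult_left_mono) auto
      then show "\<bar>\<tau> ^ n * r \<tau> x\<bar> \<le> C * \<bar>\<tau>\<bar> ^ (n + N)"
        by (simp add: abs_mult power_abs power_add mult_ac)
    qed
  qed
  then show ?thesis unfolding uniform_O_def by blast
qed

lemma uniform_O_compose:
  assumes "uniform_O D M' N r" "\<forall>\<^sub>F \<tau> in nhds 0. \<forall>x\<in>cube D M. \<Phi> \<tau> x \<in> cube D M'"
  shows "uniform_O D M N (\<lambda>\<tau> x. r \<tau> (\<Phi> \<tau> x))"
proof -
  obtain C where "\<forall>\<^sub>F \<tau> in nhds 0. \<forall>x\<in>cube D M'. \<bar>r \<tau> x\<bar> \<le> C * \<bar>\<tau>\<bar> ^ N"
    using assms unfolding uniform_O_def by blast
  then have "\<forall>\<^sub>F \<tau> in nhds 0. \<forall>x\<in>cube D M. \<bar>r \<tau> (\<Phi> \<tau> x)\<bar> \<le> C * \<bar>\<tau>\<bar> ^ N"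
    using assms(2) by eventually_elim blast
  then show ?thesis unfolding uniform_O_def by blast
qed

lemma eventually_nhds_0_scale:
  assumes "\<forall>\<^sub>F \<tau> in nhds (0 :: real). P \<tau>"
  shows "\<forall>\<^sub>F \<tau> in nhds 0. P (c * \<tau>)"
proof -
  have "((\<lambda>\<tau>. c * \<tau>) \<longlongrightarrow> c * 0) (nhds 0)"
    by (intro tendsto_mult tendsto_const filterlim_ident)
  then show ?thesis using assms unfolding filterlim_iff by simp
qed

lemma locally_bounded_compose:
  assumes "locally_bounded D \<Phi>" "locally_bounded D \<Psi>"
  shows "locally_bounded D (\<lambda>\<tau> x. \<Psi> \<tau> (\<Phi> \<tau> x))"
  unfolding locally_bounded_def
proof (intro allI impI)
  fix M :: real assume "M \<ge> 0"
  then obtain M1 where M1: "M1 \<ge> 0" "\<forall>\<^sub>F \<tau> in nhds 0. \<forall>x\<in>cube D M. \<Phi> \<tau> x \<in> cube D M1"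
    using assms(1) unfolding locally_bounded_def by blast
  then obtain M2 where M2: "M2 \<ge> 0" "\<forall>\<^sub>F \<tau> in nhds 0. \<forall>x\<in>cube D M1. \<Psi> \<tau> x \<in> cube D M2"
    using assms(2) unfolding locally_bounded_def by blast
  have "\<forall>\<^sub>F \<tau> in nhds 0. \<forall>x\<in>cube D M. \<Psi> \<tau> (\<Phi> \<tau> x) \<in> cube D M2"
    using M1(2) M2(2) by eventually_elim blast
  then show "\<exists>M'\<ge>0. \<forall>\<^sub>F \<tau> in nhds 0. \<forall>x\<in>cube D M. \<Psi> \<tau> (\<Phi> \<tau> x) \<in> cube D M'" using M2(1) by blast
qed

lemma eventually_abs_le: "T > 0 \<Longrightarrow> \<forall>\<^sub>F \<tau> in nhds 0. \<bar>\<tau>\<bar> \<le> (T :: real)"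
  unfolding eventually_nhds_metric by (intro exI[of _ T]) (auto simp: dist_real_def)

lemma flow_locally_bounded:
  assumes "smooth_field D f"
  shows "locally_bounded D (\<lambda>\<tau>. flow D f (c * \<tau>))"
  unfolding locally_bounded_def
proof (intro allI impI)
  fix M :: real assume M: "M \<ge> 0"
  obtain T where T: "T > 0" "\<And>x t. x \<in> cube D M \<Longrightarrow> \<bar>t\<bar> \<le> T \<Longrightarrow> flow D f t x \<in> cube D (M + 1)"
    by (rule flow_exists[OF assms M]) blast
  have "\<forall>\<^sub>F \<tau> in nhds 0. \<bar>c * \<tau>\<bar> \<le> T"
    by (rule eventually_nhds_0_scale[OF eventually_abs_le[OF T(1)]])
  then have "\<forall>\<^sub>F \<tau> in nhds 0. \<forall>x\<in>cube D M. flow D f (c * \<tau>) x \<in> cube D (M + 1)"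
    by eventually_elim (use T(2) in blast)
  then show "\<exists>M'\<ge>0. \<forall>\<^sub>F \<tau> in nhds 0. \<forall>x\<in>cube D M. flow D f (c * \<tau>) x \<in> cube D M'"
    using M by (intro exI[of _ "M + 1"]) auto
qed

lemma lie_funpow_smooth:
  assumes "smooth_field D f" "smooth D h"
  shows "smooth D ((lie D f ^^ n) h)"
  using assms by (induction n) (auto simp: smooth_field_iff intro: lie_smooth)

text \<open>Along a solution the n-th time derivative of \<open>h\<close> is the n-fold Lie
  derivative. The remainder in Taylor's formula is bounded because the flow stays in the compact
  cube of size \<open>M + 1\<close>.\<close>

lemma flow_taylor:
  assumes f: "smooth_field D f" and h: "smooth D h" and M: "M \<ge> 0"
  shows "uniform_O D M N (\<lambda>\<tau> x. h (flow D f (c * \<tau>) x) - (\<Sum>n<N. \<tau> ^ n * (c ^ n / fact n * (lie D f ^^ n) h x)))"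
proof -
  obtain T where T: "T > 0" "\<And>x. x \<in> cube D M \<Longrightarrow> solves_ode D f {- T..T} (\<lambda>t. flow D f t x)"
    "\<And>x. x \<in> cube D M \<Longrightarrow> flow D f 0 x = x"
    "\<And>x t. x \<in> cube D M \<Longrightarrow> \<bar>t\<bar> \<le> T \<Longrightarrow> flow D f t x \<in> cube D (M + 1)"
    by (rule flow_exists[OF f M]) blast
  obtain K where K: "K \<ge> 0" "\<And>x. x \<in> cube D (M + 1) \<Longrightarrow> \<bar>(lie D f ^^ N) h x\<bar> \<le> K"
    by (rule smooth_bounded[OF lie_funpow_smooth[OF f h], of "M + 1" N]) blast
  have bound: "\<bar>h (flow D f t x) - (\<Sum>n<N. (lie D f ^^ n) h x / fact n * t ^ n)\<bar> \<le> K * \<bar>t\<bar> ^ N"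
    if x: "x \<in> cube D M" and t: "\<bar>t\<bar> < T" for t x
  proof -
    define diff where "diff n t = (lie D f ^^ n) h (flow D f t x)" for n t
    have "(diff m has_real_derivative diff (Suc m) s) (at s)" if "\<bar>s\<bar> < T" for m s
    proof -
      have s: "s \<in> {- T..T}" and int: "s \<in> interior {- T..T}" using that by auto
      have "((\<lambda>s. (lie D f ^^ m) h (flow D f s x)) has_real_derivative
          (\<Sum>l<D. partial_deriv l ((lie D f ^^ m) h) (flow D f s x) * f (flow D f s x) l)) (at s within {- T..T})"
        by (rule smooth_chain_rule[OF lie_funpow_smooth[OF f h] s])
          (use T(2)[OF x] s in \<open>auto simp: solves_ode_def\<close>)
      then show ?thesis
        unfolding at_within_interior[OF int] diff_def by (simp add: lie_def)
    qed
    then have "\<exists>s. \<bar>s\<bar> \<le> \<bar>t\<bar> \<and> h (flow D f t x) = (\<Sum>m<N. diff m 0 / fact m * t ^ m) + diff N s / fact N * t ^ N"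
      using t by (intro Maclaurin_bi_le[where f = "\<lambda>t. h (flow D f t x)"]) (auto simp: diff_def[of 0])
    then obtain s where s: "\<bar>s\<bar> \<le> \<bar>t\<bar>"
      "h (flow D f t x) = (\<Sum>m<N. diff m 0 / fact m * t ^ m) + diff N s / fact N * t ^ N" by blast
    have "\<bar>diff N s\<bar> \<le> K" unfolding diff_def by (rule K(2)[OF T(4)[OF x]]) (use s t in auto)
    moreover have "\<bar>diff N s / fact N\<bar> \<le> \<bar>diff N s\<bar>"
      using divide_left_mono[of 1 "fact N" "\<bar>diff N s\<bar>"] by (simp add: fact_ge_1)
    ultimately have "\<bar>diff N s / fact N * t ^ N\<bar> \<le> K * \<bar>t\<bar> ^ N"
      unfolding abs_mult power_abs by (intro mult_right_mono) auto
    then show ?thesis using s(2) T(3)[OF x] by (simp add: diff_def)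
  qed
  \<comment> \<open>Halving makes the inequality with \<open>T\<close> strict; two-sided derivatives
    exist only at interior times.\<close>
  have "T / 2 > 0" using T(1) by simp
  have "\<forall>\<^sub>F \<tau> in nhds 0. \<bar>c * \<tau>\<bar> \<le> T / 2"
    by (rule eventually_nhds_0_scale[OF eventually_abs_le[OF \<open>T / 2 > 0\<close>]])
  then have "\<forall>\<^sub>F \<tau> in nhds 0. \<forall>x\<in>cube D M. \<bar>h (flow D f (c * \<tau>) x) -
      (\<Sum>n<N. \<tau> ^ n * (c ^ n / fact n * (lie D f ^^ n) h x))\<bar> \<le> (K * \<bar>c\<bar> ^ N) * \<bar>\<tau>\<bar> ^ N"
  proof eventually_elim
    case (elim \<tau>)
    then have "\<bar>c * \<tau>\<bar> < T" using T(1) by linarith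
    then show ?case using bound[of _ "c * \<tau>"] by (simp add: power_mult_distrib abs_mult mult_ac)
  qed
  then show ?thesis unfolding uniform_O_def by blast
qed

context two_fields
begin

text \<open>The function h o Psi is expanded to order \<open>N\<close> on a cube that contains the
  image of Phi. Its n-th coefficient, composed with Phi, is needed only to order
  \<open>N - n\<close>, owing to the factor \<tau>^n. Collecting powers over the triangle n + m < N
  yields the convolution.\<close>

lemma represents_compose:
  assumes "represents D F \<Phi> S1" "represents D F \<Psi> S2"
  shows "represents D F (\<lambda>\<tau> x. \<Psi> \<tau> (\<Phi> \<tau> x)) (conv S1 S2)"
proof -
  have "uniform_O D M N (\<lambda>\<tau> x. h (\<Psi> \<tau> (\<Phi> \<tau> x)) - (\<Sum>n<N. \<tau> ^ n * lie_coeff D F (conv S1 S2) h n x))"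
    if h: "smooth D h" and M: "M \<ge> 0" for h M N
  proof -
    obtain M1 where M1: "M1 \<ge> 0" "\<forall>\<^sub>F \<tau> in nhds 0. \<forall>x\<in>cube D M. \<Phi> \<tau> x \<in> cube D M1"
      using assms(1) M unfolding represents_def locally_bounded_def by blast
    define g where "g n = lie_coeff D F S2 h n" for n
    have g: "smooth D (g n)" for n unfolding g_def by (rule lie_coeff_smooth[OF h])
    have "uniform_O D M1 N (\<lambda>\<tau> y. h (\<Psi> \<tau> y) - (\<Sum>n<N. \<tau> ^ n * g n y))"
      using assms(2) h M1(1) unfolding represents_def g_def by blast
    then have 1: "uniform_O D M N (\<lambda>\<tau> x. h (\<Psi> \<tau> (\<Phi> \<tau> x)) - (\<Sum>n<N. \<tau> ^ n * g n (\<Phi> \<tau> x)))"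
      using M1(2) by (rule uniform_O_compose)
    have shifted: "uniform_O D M (n + (N - n)) (\<lambda>\<tau> x. \<tau> ^ n * (g n (\<Phi> \<tau> x) - (\<Sum>m<N - n. \<tau> ^ m * lie_coeff D F S1 (g n) m x)))" for n
      using assms(1) g M unfolding represents_def by (intro uniform_O_power) blast
    have 2: "uniform_O D M N (\<lambda>\<tau> x. \<Sum>n<N. \<tau> ^ n * (g n (\<Phi> \<tau> x) - (\<Sum>m<N - n. \<tau> ^ m * lie_coeff D F S1 (g n) m x)))"
    proof (intro uniform_O_sum)
      fix n assume "n \<in> {..<N}"
      then have "n + (N - n) = N" by simp
      then show "uniform_O D M N (\<lambda>\<tau> x. \<tau> ^ n * (g n (\<Phi> \<tau> x) - (\<Sum>m<N - n. \<tau> ^ m * lie_coeff D F S1 (g n) m x)))"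
        using shifted[of n] by (simp only:)
    qed
    have tri: "(\<Sum>n<N. \<tau> ^ n * (\<Sum>m<N - n. \<tau> ^ m * lie_coeff D F S1 (g n) m x)) =
        (\<Sum>k<N. \<tau> ^ k * lie_coeff D F (conv S1 S2) h k x)" if x: "x \<in> cube D M" for \<tau> x
    proof -
      have "(\<Sum>n<N. \<tau> ^ n * (\<Sum>m<N - n. \<tau> ^ m * lie_coeff D F S1 (g n) m x)) =
          (\<Sum>n<N. \<Sum>m<N - n. \<tau> ^ (m + n) * lie_coeff D F S1 (g n) m x)"
        by (simp add: sum_distrib_left power_add mult_ac)
      also have "\<dots> = (\<Sum>(n, m)\<in>(SIGMA n:{..<N}. {..<N - n}). \<tau> ^ (m + n) * lie_coeff D F S1 (g n) m x)"
        by (rule sum.Sigma) auto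
      also have "(SIGMA n:{..<N}. {..<N - n}) = {(n, m). n + m < N}" by auto
      also have "(\<Sum>(n, m)\<in>{(n, m). n + m < N}. \<tau> ^ (m + n) * lie_coeff D F S1 (g n) m x) =
          (\<Sum>k<N. \<Sum>n\<le>k. \<tau> ^ ((k - n) + n) * lie_coeff D F S1 (g n) (k - n) x)"
        by (rule sum.triangle_reindex)
      also have "\<dots> = (\<Sum>k<N. \<tau> ^ k * (\<Sum>n\<le>k. lie_coeff D F S1 (g n) (k - n) x))"
        by (simp add: sum_distrib_left)
      also have "\<dots> = (\<Sum>k<N. \<tau> ^ k * lie_coeff D F (conv S1 S2) h k x)"
      proof (intro sum.cong refl arg_cong2[where f = "(*)"])
        fix k
        have "x \<in> space_R D" using x cube_subset by blast
        then have "lie_coeff D F (conv S1 S2) h k x = (\<Sum>n\<le>k. lie_coeff D F S1 (g (k - n)) n x)"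
          unfolding g_def by (rule lie_coeff_conv[OF h])
        also have "\<dots> = (\<Sum>n\<le>k. lie_coeff D F S1 (g n) (k - n) x)"
          by (rule sum.reindex_bij_witness[where i = "\<lambda>n. k - n" and j = "\<lambda>n. k - n"]) auto
        finally show "(\<Sum>n\<le>k. lie_coeff D F S1 (g n) (k - n) x) = lie_coeff D F (conv S1 S2) h k x" ..
      qed
      finally show ?thesis .
    qed
    show ?thesis
      by (rule uniform_O_cong[OF _ uniform_O_add[OF 1 2]])
        (simp add: tri right_diff_distrib sum_subtractf)
  qed
  then show ?thesis
    using assms locally_bounded_compose unfolding represents_def by blast
qed

lemma represents_id: "represents D F (\<lambda>\<tau> x. x) conv_one"
proof -
  have "(\<Sum>n<N. \<tau> ^ n * lie_coeff D F conv_one h n x) = (if N = 0 then 0 else h x)" for \<tau> x h N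
  proof -
    have "lie_coeff D F conv_one h n x = (if n = 0 then h x else 0)" for n
    proof (cases "n = 0")
      case False
      then have "conv_one w * lie_word D F w h x = 0" if "w \<in> words n" for w
        using that by (auto simp: words_def conv_one_def)
      then have "lie_coeff D F conv_one h n x = 0" unfolding lie_coeff_def by (intro sum.neutral) blast
      then show ?thesis using False by simp
    qed (simp add: lie_coeff_def conv_one_def)
    then have "(\<Sum>n<N. \<tau> ^ n * lie_coeff D F conv_one h n x) = (\<Sum>n<N. if n = 0 then h x else 0)"
      by (intro sum.cong) auto
    then show ?thesis by simp
  qed
  moreover have "uniform_O D M 0 (\<lambda>\<tau> x. h x - 0)" if "smooth D h" for h M
  proof -
    obtain K where "K \<ge> 0" "\<And>x. x \<in> cube D M \<Longrightarrow> \<bar>h x\<bar> \<le> K" by (rule smooth_bounded[OF \<open>smooth D h\<close>, of M]) blast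
    then show ?thesis unfolding uniform_O_def by (intro exI[of _ K]) simp
  qed
  ultimately have "uniform_O D M N (\<lambda>\<tau> x. h x - (\<Sum>n<N. \<tau> ^ n * lie_coeff D F conv_one h n x))"
    if "smooth D h" for h M N
    using that by (cases "N = 0") (simp_all add: uniform_O_zero)
  moreover have "locally_bounded D (\<lambda>\<tau> x. x)" unfolding locally_bounded_def by auto
  ultimately show ?thesis unfolding represents_def by blast
qed

lemma lie_coeff_letter_exp:
  "lie_coeff D F (letter_exp l c) h n x = c ^ n / fact n * (lie D (F l) ^^ n) h x"
proof -
  have "lie_word D F (replicate n l) h = (lie D (F l) ^^ n) h" by (induction n) auto
  moreover have "letter_exp l c w = (if w = replicate n l then c ^ n / fact n else 0)" if "w \<in> words n" for w
  proof -
    have "set w \<subseteq> {l} \<longleftrightarrow> w = replicate n l"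
    proof
      assume "set w \<subseteq> {l}"
      then have "replicate (length w) l = w" by (intro replicate_length_same) blast
      then show "w = replicate n l" using that by (simp add: words_def)
    qed (simp add: set_replicate_conv_if)
    then show ?thesis using that by (auto simp: letter_exp_def words_def)
  qed
  then have "lie_coeff D F (letter_exp l c) h n x =
      (\<Sum>w\<in>words n. if w = replicate n l then c ^ n / fact n * lie_word D F w h x else 0)"
    unfolding lie_coeff_def by (intro sum.cong) auto
  moreover have "replicate n l \<in> words n" by (simp add: words_def)
  ultimately show ?thesis by simp
qed

lemma represents_flow: "represents D F (\<lambda>\<tau>. flow D (F l) (c * \<tau>)) (letter_exp l c)"
  unfolding represents_def lie_coeff_letter_exp
  using flow_taylor[OF F] flow_locally_bounded[OF F] by blast

lemma sum_field: "smooth_field D (\<lambda>y i. F False y i + F True y i)"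
  using F[of False] F[of True] unfolding smooth_field_iff
  by (auto intro!: smooth_add simp: space_R_def Pi_def)

text \<open>The n-th power of the sum of the two derivations is the sum over all words of length n,
  so each word inherits the Taylor factor 1/n!.\<close>

lemma represents_exact:
  "represents D F (\<lambda>\<tau>. flow D (\<lambda>y i. F False y i + F True y i) \<tau>) (\<lambda>w. 1 / fact (length w))"
proof -
  let ?f = "\<lambda>y i. F False y i + F True y i"
  have sum_words: "(lie D ?f ^^ n) h x = (\<Sum>w\<in>words n. lie_word D F w h x)"
    if h: "smooth D h" and x: "x \<in> space_R D" for h n x
    using x
  proof (induction n arbitrary: x)
    case (Suc n)
    have "(lie D ?f ^^ Suc n) h x = lie D ?f (\<lambda>x. \<Sum>w\<in>words n. 1 * lie_word D F w h x) x"
      using lie_cong[OF Suc.IH Suc.prems] by simp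
    also have "\<dots> = (\<Sum>w\<in>words n. lie D ?f (lie_word D F w h) x)"
      by (subst lie_sum) (simp_all add: lie_word_smooth h Suc.prems)
    also have "\<dots> = (\<Sum>w\<in>words n. lie_word D F (False # w) h x + lie_word D F (True # w) h x)"
      by (simp add: lie_def distrib_left sum.distrib)
    finally show ?case by (simp add: sum_words_Suc sum.distrib)
  qed simp
  have "uniform_O D M N (\<lambda>\<tau> x. h (flow D ?f \<tau> x) -
      (\<Sum>n<N. \<tau> ^ n * lie_coeff D F (\<lambda>w. 1 / fact (length w)) h n x))"
    if h: "smooth D h" and M: "M \<ge> 0" for h M N
  proof (rule uniform_O_cong[OF _ flow_taylor[OF sum_field h M, where c = 1]])
    fix \<tau> x assume "x \<in> cube D M"
    then have x: "x \<in> space_R D" using cube_subset by blast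
    have "lie_coeff D F (\<lambda>w. 1 / fact (length w)) h n x = 1 ^ n / fact n * (lie D ?f ^^ n) h x" for n
      unfolding lie_coeff_def sum_words[OF h x] sum_distrib_left
      by (intro sum.cong) (auto simp: words_def)
    then show "h (flow D ?f (1 * \<tau>) x) - (\<Sum>n<N. \<tau> ^ n * (1 ^ n / fact n * (lie D ?f ^^ n) h x)) =
        h (flow D ?f \<tau> x) - (\<Sum>n<N. \<tau> ^ n * lie_coeff D F (\<lambda>w. 1 / fact (length w)) h n x)" by simp
  qed
  moreover have "locally_bounded D (\<lambda>\<tau>. flow D ?f \<tau>)"
    using flow_locally_bounded[OF sum_field, of 1] by simp
  ultimately show ?thesis unfolding represents_def by blast
qed

end

text \<open>The labels are polymorphic: they are letters in a Lie series, but vector fields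
  themselves in the expansion in \<epsilon>, where every field of the list is replaced by one in a
  larger dimension.\<close>

primrec run :: "('l \<Rightarrow> real \<Rightarrow> 'x \<Rightarrow> 'x) \<Rightarrow> ('l \<times> real) list \<Rightarrow> real \<Rightarrow> 'x \<Rightarrow> 'x" where
  "run \<phi> [] \<tau> x = x"
| "run \<phi> (p # ps) \<tau> x = run \<phi> ps \<tau> (\<phi> (fst p) (snd p * \<tau>) x)"

lemma run_append: "run \<phi> (ps @ qs) \<tau> x = run \<phi> qs \<tau> (run \<phi> ps \<tau> x)"
  by (induction ps arbitrary: x) auto

lemma splitting_eq_run:
  "splitting (\<phi> False) (\<phi> True) a b s \<tau> x = run \<phi> (splitting_steps a b s) \<tau> x"
  by (induction s) (simp_all add: run_append)

lemma (in two_fields) represents_run: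
  "represents D F (\<lambda>\<tau>. run (\<lambda>l. flow D (F l)) ps \<tau>) (series_prod ps)"
proof (induction ps)
  case Nil
  show ?case using represents_id by simp
next
  case (Cons p ps)
  show ?case using represents_compose[OF represents_flow Cons] by simp
qed

section \<open>Expansion in powers of the small parameter\<close>

lemma lie_const: "lie D f (\<lambda>x. c) x = 0"
  by (simp add: lie_def partial_deriv_def)

lemma lie_coord: "i < D \<Longrightarrow> lie D f (\<lambda>x. x i) x = f x i"
proof -
  assume i: "i < D"
  have "partial_deriv j (\<lambda>x. x i) x = (if j = i then 1 else 0)" for j
    by (cases "j = i") (auto simp: partial_deriv_def)
  then have "lie D f (\<lambda>x. x i) x = (\<Sum>j<D. if j = i then f x j else 0)"
    unfolding lie_def by (intro sum.cong) auto
  then show ?thesis using i by simp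
qed

lemma lie_add:
  assumes "smooth D g" "smooth D h" "x \<in> space_R D"
  shows "lie D f (\<lambda>x. g x + h x) x = lie D f g x + lie D f h x"
proof -
  have "partial_deriv j (\<lambda>x. g x + h x) x = partial_deriv j g x + partial_deriv j h x" if "j < D" for j
    unfolding partial_deriv_def[of j "\<lambda>x. g x + h x"]
    by (rule DERIV_imp_deriv[OF DERIV_add[OF smooth_partial_at[OF assms(1) that assms(3)]
          smooth_partial_at[OF assms(2) that assms(3)]]])
  then show ?thesis by (simp add: lie_def sum.distrib distrib_right)
qed

lemma lie_mult:
  assumes "smooth D g" "smooth D h" "x \<in> space_R D"
  shows "lie D f (\<lambda>x. g x * h x) x = lie D f g x * h x + lie D f h x * g x"
proof -
  have "partial_deriv j (\<lambda>x. g x * h x) x = partial_deriv j g x * h x + partial_deriv j h x * g x" if "j < D" for j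
    unfolding partial_deriv_def[of j "\<lambda>x. g x * h x"]
    using DERIV_mult[OF smooth_partial_at[OF assms(1) that assms(3)] smooth_partial_at[OF assms(2) that assms(3)]]
    by (intro DERIV_imp_deriv) (simp only: fun_upd_triv)
  then show ?thesis
    by (simp add: lie_def sum.distrib distrib_right distrib_left sum_distrib_left sum_distrib_right mult_ac)
qed

text \<open>A map that intertwines the fields carries solutions to solutions. The set
  \<open>V\<close> confines the relation to the given solution, for instance to a fixed value of the
  parameter coordinate.\<close>

lemma flow_conjugate:
  assumes f: "smooth_field D' f" and Z: "solves_ode D g (closed_segment 0 \<tau>) Z"
    and V: "\<And>t. t \<in> closed_segment 0 \<tau> \<Longrightarrow> Z t \<in> V"
    and P: "\<And>i. i < D' \<Longrightarrow> smooth D (\<lambda>z. P z i)"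
      "\<And>z. z \<in> V \<Longrightarrow> z \<in> space_R D \<Longrightarrow> P z \<in> space_R D'"
      "\<And>z i. z \<in> V \<Longrightarrow> z \<in> space_R D \<Longrightarrow> i < D' \<Longrightarrow> lie D g (\<lambda>z. P z i) z = f (P z) i"
  shows "flow D' f \<tau> (P (Z 0)) = P (Z \<tau>)"
proof -
  have "solves_ode D' f (closed_segment 0 \<tau>) (\<lambda>t. P (Z t))"
    unfolding solves_ode_def
  proof (intro ballI conjI allI impI)
    fix t i assume t: "t \<in> closed_segment 0 \<tau>"
    have sp: "Z t \<in> space_R D" using Z t unfolding solves_ode_def by blast
    then show "P (Z t) \<in> space_R D'" using P(2) V[OF t] by blast
    assume i: "i < D'"
    have "((\<lambda>t. P (Z t) i) has_real_derivative (\<Sum>l<D. partial_deriv l (\<lambda>z. P z i) (Z t) * g (Z t) l))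
        (at t within closed_segment 0 \<tau>)"
      by (rule smooth_chain_rule[OF P(1)[OF i] t]) (use Z t in \<open>auto simp: solves_ode_def\<close>)
    then show "((\<lambda>t. P (Z t) i) has_real_derivative f (P (Z t)) i) (at t within closed_segment 0 \<tau>)"
      using P(3)[OF V[OF t] sp i] by (simp add: lie_def)
  qed
  from flow_eq[OF f this] show ?thesis .
qed

text \<open>The coordinate \<open>D\<close> carries the parameter \<open>\<epsilon>\<close>: fields of this kind keep it constant.\<close>

definition param_field :: "nat \<Rightarrow> ((nat \<Rightarrow> real) \<Rightarrow> nat \<Rightarrow> real) \<Rightarrow> bool" where
  "param_field D f \<longleftrightarrow> smooth_field (Suc D) f \<and> (\<forall>y. f y D = 0)"

lemma param_constant:
  assumes "param_field D f" "solves_ode (Suc D) f (closed_segment 0 \<tau>) Z" "t \<in> closed_segment 0 \<tau>"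
  shows "Z t D = Z 0 D"
proof -
  have "\<exists>c. \<forall>t\<in>closed_segment 0 \<tau>. Z t D = c"
  proof (rule has_field_derivative_zero_constant)
    fix s assume "s \<in> closed_segment 0 \<tau>"
    then have "((\<lambda>t. Z t D) has_real_derivative f (Z s) D) (at s within closed_segment 0 \<tau>)"
      using assms(2) unfolding solves_ode_def by blast
    then show "((\<lambda>t. Z t D) has_real_derivative 0) (at s within closed_segment 0 \<tau>)"
      using assms(1) by (simp add: param_field_def)
  qed simp
  then show ?thesis using assms(3) by fastforce
qed

lemma param_flow:
  assumes f: "param_field D f" and M: "M \<ge> 0"
  shows "\<forall>\<^sub>F t in nhds 0. \<forall>z\<in>cube (Suc D) M. \<exists>Z. solves_ode (Suc D) f (closed_segment 0 t) Z \<and>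
    Z 0 = z \<and> Z t = flow (Suc D) f t z \<and> (\<forall>s\<in>closed_segment 0 t. Z s D = z D)"
proof -
  obtain T where T: "T > 0" "\<And>x. x \<in> cube (Suc D) M \<Longrightarrow> solves_ode (Suc D) f {- T..T} (\<lambda>t. flow (Suc D) f t x)"
    "\<And>x. x \<in> cube (Suc D) M \<Longrightarrow> flow (Suc D) f 0 x = x"
    by (rule flow_exists[of "Suc D" f M]) (use f M in \<open>auto simp: param_field_def\<close>)
  from eventually_abs_le[OF T(1)] show ?thesis
  proof eventually_elim
    case (elim t)
    show ?case
    proof
      fix z assume z: "z \<in> cube (Suc D) M"
      have sol: "solves_ode (Suc D) f (closed_segment 0 t) (\<lambda>t. flow (Suc D) f t z)"
        by (rule solves_ode_subset[OF T(2)[OF z] mem_closed_segment_0_abs[OF elim]])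
      show "\<exists>Z. solves_ode (Suc D) f (closed_segment 0 t) Z \<and>
          Z 0 = z \<and> Z t = flow (Suc D) f t z \<and> (\<forall>s\<in>closed_segment 0 t. Z s D = z D)"
        by (rule exI[of _ "\<lambda>t. flow (Suc D) f t z"])
          (use sol T(3)[OF z] param_constant[OF f sol] in auto)
    qed
  qed
qed

text \<open>The quantity \<open>e\<close> is conserved by all steps and selects the member of the
  family \<phi>. The cube has to be enlarged after each step, hence the universal quantification
  over \<open>M\<close> in the hypothesis on single steps.\<close>

lemma run_semiconjugate:
  assumes step: "\<And>l M. l \<in> fst ` set ps \<Longrightarrow> M \<ge> 0 \<Longrightarrow>
      \<forall>\<^sub>F t in nhds 0. \<forall>z\<in>cube D M. \<phi> (e z) l t (P z) = P (\<Phi> l t z) \<and> e (\<Phi> l t z) = e z"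
    and lb: "\<And>l c. l \<in> fst ` set ps \<Longrightarrow> locally_bounded D (\<lambda>\<tau>. \<Phi> l (c * \<tau>))"
    and M: "M \<ge> 0"
  shows "\<forall>\<^sub>F \<tau> in nhds 0. \<forall>z\<in>cube D M. run (\<phi> (e z)) ps \<tau> (P z) = P (run \<Phi> ps \<tau> z) \<and> e (run \<Phi> ps \<tau> z) = e z"
  using assms
proof (induction ps arbitrary: M)
  case (Cons p ps)
  obtain M' where M': "M' \<ge> 0" "\<forall>\<^sub>F \<tau> in nhds 0. \<forall>x\<in>cube D M. \<Phi> (fst p) (snd p * \<tau>) x \<in> cube D M'"
    using Cons.prems(2)[of "fst p" "snd p"] Cons.prems(3) unfolding locally_bounded_def by auto
  have "\<forall>\<^sub>F \<tau> in nhds 0. \<forall>z\<in>cube D M'. run (\<phi> (e z)) ps \<tau> (P z) = P (run \<Phi> ps \<tau> z) \<and> e (run \<Phi> ps \<tau> z) = e z"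
    by (rule Cons.IH) (use Cons.prems(1,2) M'(1) in auto)
  moreover have "\<forall>\<^sub>F \<tau> in nhds 0. \<forall>z\<in>cube D M. \<phi> (e z) (fst p) (snd p * \<tau>) (P z) = P (\<Phi> (fst p) (snd p * \<tau>) z) \<and>
      e (\<Phi> (fst p) (snd p * \<tau>) z) = e z"
    by (rule eventually_nhds_0_scale) (use Cons.prems(1,3) in auto)
  ultimately show ?case using M'(2)
  proof eventually_elim
    case (elim \<tau>)
    show ?case
    proof
      fix z assume z: "z \<in> cube D M"
      let ?y = "\<Phi> (fst p) (snd p * \<tau>) z"
      have "?y \<in> cube D M'" using elim(3) z by blast
      then have "run (\<phi> (e ?y)) ps \<tau> (P ?y) = P (run \<Phi> ps \<tau> ?y) \<and> e (run \<Phi> ps \<tau> ?y) = e ?y"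
        using elim(1) by blast
      moreover have "\<phi> (e z) (fst p) (snd p * \<tau>) (P z) = P ?y" "e ?y = e z" using elim(2) z by blast+
      ultimately show "run (\<phi> (e z)) (p # ps) \<tau> (P z) = P (run \<Phi> (p # ps) \<tau> z) \<and>
          e (run \<Phi> (p # ps) \<tau> z) = e z" by simp
    qed
  qed
qed simp

lemma run_map: "run \<phi> (map (\<lambda>p. (g (fst p), snd p)) ps) \<tau> x = run (\<lambda>l. \<phi> (g l)) ps \<tau> x"
  by (induction ps arbitrary: x) auto

lemma locally_bounded_run:
  "(\<And>l c. l \<in> fst ` set ps \<Longrightarrow> locally_bounded D (\<lambda>\<tau>. \<Phi> l (c * \<tau>))) \<Longrightarrow> locally_bounded D (run \<Phi> ps)"
proof (induction ps)
  case Nil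
  show ?case by (auto simp: locally_bounded_def)
next
  case (Cons p ps)
  have "locally_bounded D (\<lambda>\<tau>. \<Phi> (fst p) (snd p * \<tau>))" by (rule Cons.prems) simp
  moreover have "locally_bounded D (run \<Phi> ps)" by (rule Cons.IH) (rule Cons.prems, simp)
  ultimately have "locally_bounded D (\<lambda>\<tau> x. run \<Phi> ps \<tau> (\<Phi> (fst p) (snd p * \<tau>) x))"
    by (rule locally_bounded_compose)
  then show ?case by simp
qed

text \<open>In the variables \<open>(x\<^sub>0, d, \<epsilon>)\<close> with \<open>x = x\<^sub>0 + \<epsilon> d\<close>, the system becomes
  \<open>x\<^sub>0' = f(x\<^sub>0, 0)\<close>, \<open>d' = (f(x\<^sub>0 + \<epsilon> d, \<epsilon>) - f(x\<^sub>0, 0)) / \<epsilon>\<close>. By Hadamard's lemma the quotient is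
  smooth also at \<open>\<epsilon> = 0\<close>, so that the expansion can be iterated.\<close>

definition hadamard_point :: "nat \<Rightarrow> (nat \<Rightarrow> real) \<Rightarrow> real \<Rightarrow> nat \<Rightarrow> real" where
  "hadamard_point D z s = (\<lambda>l. if l < D then z l + s * z (2 * D) * z (D + l)
     else if l = D then s * z (2 * D) else 0)"

text \<open>The difference of \<open>g\<close> at the points with s = 1 and s = 0 is the integral of
  its derivative in s, in which every term contains the factor \<epsilon> =
  \<open>z (2 * D)\<close>; this integrand has the factor removed. The coordinates of
  \<open>z\<close> are x_0 below \<open>D\<close>, then d, then \<epsilon>.\<close>

definition hadamard_quotient :: "nat \<Rightarrow> ((nat \<Rightarrow> real) \<Rightarrow> real) \<Rightarrow> (nat \<Rightarrow> real) \<Rightarrow> real" where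
  "hadamard_quotient D g z = integral {0..1} (\<lambda>s.
     (\<Sum>l<D. partial_deriv l g (hadamard_point D z s) * z (D + l)) + partial_deriv D g (hadamard_point D z s))"

definition hadamard_field :: "nat \<Rightarrow> ((nat \<Rightarrow> real) \<Rightarrow> nat \<Rightarrow> real) \<Rightarrow> (nat \<Rightarrow> real) \<Rightarrow> nat \<Rightarrow> real" where
  "hadamard_field D f z = (\<lambda>i. if i < D then f (hadamard_point D z 0) i
     else if i < 2 * D then hadamard_quotient D (\<lambda>y. f y (i - D)) z else 0)"

lemma hadamard_point_space [simp]: "hadamard_point D z s \<in> space_R (Suc D)"
  by (simp add: hadamard_point_def space_R_def)

text \<open>The variable s becomes the coordinate after \<epsilon>, in which the integrand is
  polynomial composed with smooth derivatives of \<open>g\<close>, so that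
  \<open>smooth_integral\<close> applies.\<close>

lemma hadamard_quotient_smooth:
  assumes "smooth (Suc D) g"
  shows "smooth (Suc (2 * D)) (hadamard_quotient D g)"
proof -
  let ?n = "Suc (2 * D)"
  define h where "h l z = (if l < D then z l + z ?n * z (2 * D) * z (D + l) else z ?n * z (2 * D))"
    for l and z :: "nat \<Rightarrow> real"
  have h: "smooth (Suc ?n) (h l)" for l
    unfolding h_def[abs_def] by (cases "l < D") (auto intro!: smooth_intros)
  have pt: "tuple (Suc D) h (z(?n := s)) = hadamard_point D z s" for z s
    by (auto simp: h_def hadamard_point_def fun_eq_iff less_Suc_eq)
  have "smooth (Suc ?n) (\<lambda>z. (\<Sum>l<D. partial_deriv l g (tuple (Suc D) h z) * z (D + l)) + partial_deriv D g (tuple (Suc D) h z))"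
    by (intro smooth_add smooth_sum smooth_mult smooth_coord smooth_compose[OF smooth_partial_deriv[OF assms]] h) auto
  from smooth_integral[OF this] show ?thesis
    unfolding hadamard_quotient_def[abs_def] pt by simp
qed

lemma hadamard_quotient_eq:
  assumes "smooth (Suc D) g"
  shows "g (hadamard_point D z 1) = g (hadamard_point D z 0) + z (2 * D) * hadamard_quotient D g z"
proof -
  let ?q = "\<lambda>s. (\<Sum>l<D. partial_deriv l g (hadamard_point D z s) * z (D + l)) + partial_deriv D g (hadamard_point D z s)"
  have cont: "continuous_on {0..1} (\<lambda>s. partial_deriv l g (hadamard_point D z s))" if "l < Suc D" for l
  proof -
    have "continuous_on {0..1} (hadamard_point D z)"
    proof (rule continuous_on_coordinatewise_then_product)
      fix i show "continuous_on {0..1} (\<lambda>s. hadamard_point D z s i)"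
        unfolding hadamard_point_def by (cases "i < D"; cases "i = D") (auto intro!: continuous_intros)
    qed
    then show ?thesis
      by (rule continuous_on_compose2[OF smooth_continuous[OF smooth_partial_deriv[OF assms that]]]) auto
  qed
  have "continuous_on {0..1} ?q"
    by (intro continuous_on_add continuous_on_sum continuous_on_mult cont continuous_on_const) auto
  then have int: "?q integrable_on {0..1}" by (rule integrable_continuous_real)
  have "((\<lambda>s. z (2 * D) * ?q s) has_integral g (hadamard_point D z 1) - g (hadamard_point D z 0)) {0..1}"
  proof (rule fundamental_theorem_of_calculus)
    fix s :: real assume s: "s \<in> {0..1}"
    have "((\<lambda>s. g (hadamard_point D z s)) has_real_derivative (\<Sum>l<Suc D. partial_deriv l g (hadamard_point D z s) *
        (if l < D then z (2 * D) * z (D + l) else z (2 * D)))) (at s within {0..1})"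
    proof (rule smooth_chain_rule[OF assms s])
      fix l assume "l < Suc D"
      then show "((\<lambda>s. hadamard_point D z s l) has_real_derivative
          (if l < D then z (2 * D) * z (D + l) else z (2 * D))) (at s within {0..1})"
        unfolding hadamard_point_def by (cases "l < D") (auto intro!: derivative_eq_intros)
    qed simp
    also have "(\<Sum>l<Suc D. partial_deriv l g (hadamard_point D z s) *
        (if l < D then z (2 * D) * z (D + l) else z (2 * D))) = z (2 * D) * ?q s"
      by (simp add: distrib_left sum_distrib_left mult_ac)
    finally show "((\<lambda>s. g (hadamard_point D z s)) has_vector_derivative z (2 * D) * ?q s) (at s within {0..1})"
      by (simp add: has_real_derivative_iff_has_vector_derivative)
  qed simp
  moreover have "((\<lambda>s. z (2 * D) * ?q s) has_integral z (2 * D) * hadamard_quotient D g z) {0..1}"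
    unfolding hadamard_quotient_def by (intro has_integral_mult_right integrable_integral int)
  ultimately have "g (hadamard_point D z 1) - g (hadamard_point D z 0) = z (2 * D) * hadamard_quotient D g z"
    by (rule has_integral_unique)
  then show ?thesis by simp
qed

lemma hadamard_point_smooth: "smooth n (\<lambda>z. hadamard_point D z s i)"
  unfolding hadamard_point_def by (cases "i < D"; cases "i = D") (auto intro!: smooth_intros)

lemma hadamard_param_field:
  assumes "param_field D f"
  shows "param_field (2 * D) (hadamard_field D f)"
proof -
  have f: "smooth (Suc D) (\<lambda>y. f y i)" if "i < Suc D" for i
    using assms that unfolding param_field_def smooth_field_iff by blast
  have "smooth (Suc (2 * D)) (\<lambda>z. hadamard_field D f z i)" for i
  proof -
    consider "i < D" | "D \<le> i" "i < 2 * D" | "2 * D \<le> i" by linarith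
    then show ?thesis
    proof cases
      case 1
      have "smooth (Suc (2 * D)) (\<lambda>z. f (tuple (Suc D) (\<lambda>l z. hadamard_point D z 0 l) z) i)"
        by (rule smooth_compose[OF f]) (use 1 hadamard_point_smooth in auto)
      moreover have "tuple (Suc D) (\<lambda>l z. hadamard_point D z 0 l) z = hadamard_point D z 0" for z
        by (auto simp: hadamard_point_def fun_eq_iff)
      ultimately show ?thesis using 1 by (simp add: hadamard_field_def)
    next
      case 2
      then show ?thesis using hadamard_quotient_smooth[OF f, of "i - D"] by (simp add: hadamard_field_def)
    next
      case 3
      then show ?thesis by (simp add: hadamard_field_def smooth_const)
    qed
  qed
  then show ?thesis
    unfolding param_field_def smooth_field_iff by (auto simp: hadamard_field_def space_R_def)
qed

text \<open>One flow in the enlarged space projects to two flows of the original field: s = 1 gives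
  the system with parameter \<epsilon>, and s = 0 the one with parameter 0.\<close>

lemma hadamard_flow:
  assumes f: "param_field D f" and M: "M \<ge> 0" and s: "s \<in> {0, 1}"
  shows "\<forall>\<^sub>F t in nhds 0. \<forall>z\<in>cube (Suc (2 * D)) M.
    flow (Suc D) f t (hadamard_point D z s) = hadamard_point D (flow (Suc (2 * D)) (hadamard_field D f) t z) s \<and>
    flow (Suc (2 * D)) (hadamard_field D f) t z (2 * D) = z (2 * D)"
  using param_flow[OF hadamard_param_field[OF f] M]
proof eventually_elim
  case (elim t)
  show ?case
  proof
    fix z assume "z \<in> cube (Suc (2 * D)) M"
    then obtain Z where Z: "solves_ode (Suc (2 * D)) (hadamard_field D f) (closed_segment 0 t) Z" "Z 0 = z"
      "Z t = flow (Suc (2 * D)) (hadamard_field D f) t z"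
      "\<forall>s\<in>closed_segment 0 t. Z s (2 * D) = z (2 * D)"
      using elim by blast
    have f': "smooth_field (Suc D) f" using f by (simp add: param_field_def)
    have "flow (Suc D) f t (hadamard_point D (Z 0) s) = hadamard_point D (Z t) s"
    proof (rule flow_conjugate[OF f' Z(1), where V = UNIV and P = "\<lambda>z. hadamard_point D z s"])
      fix y i assume y: "y \<in> space_R (Suc (2 * D))" and i: "i < Suc D"
      let ?H = "hadamard_field D f"
      show "lie (Suc (2 * D)) ?H (\<lambda>z. hadamard_point D z s i) y = f (hadamard_point D y s) i"
      proof -
        let ?n = "Suc (2 * D)"
        have eps: "lie ?n ?H (\<lambda>z. s * z (2 * D)) y = 0"
          using lie_mult[OF smooth_const smooth_coord y, of ?H s "2 * D"] lie_coord[of "2 * D" ?n ?H y]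
          by (simp add: lie_const) (simp add: hadamard_field_def)
        show ?thesis
        proof (cases "i < D")
          case True
          have sm: "smooth (Suc D) (\<lambda>y. f y i)" using f' i unfolding smooth_field_iff by blast
          have "lie ?n ?H (\<lambda>z. z i + (s * z (2 * D)) * z (D + i)) y =
              lie ?n ?H (\<lambda>z. z i) y + lie ?n ?H (\<lambda>z. (s * z (2 * D)) * z (D + i)) y"
            by (intro lie_add smooth_mult smooth_const smooth_coord y)
          also have "lie ?n ?H (\<lambda>z. (s * z (2 * D)) * z (D + i)) y = ?H y (D + i) * (s * y (2 * D))"
            using lie_mult[OF smooth_mult[OF smooth_const smooth_coord] smooth_coord y, of ?H s "2 * D" "D + i"]
              lie_coord[of "D + i" ?n ?H y] eps True by simp
          also have "lie ?n ?H (\<lambda>z. z i) y = ?H y i" by (rule lie_coord) (use True in simp)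
          also have "?H y i + ?H y (D + i) * (s * y (2 * D)) =
              f (hadamard_point D y 0) i + s * (y (2 * D) * hadamard_quotient D (\<lambda>y. f y i) y)"
            using True by (simp add: hadamard_field_def)
          also have "\<dots> = f (hadamard_point D y s) i"
            using s hadamard_quotient_eq[OF sm, of y] by auto
          finally show ?thesis using True by (simp add: hadamard_point_def)
        next
          case False
          then have "i = D" using i by simp
          then show ?thesis using f eps by (simp add: hadamard_point_def param_field_def)
        qed
      qed
    qed (simp_all add: hadamard_point_smooth)
    moreover have "Z t (2 * D) = z (2 * D)" using Z(4) by simp
    ultimately show "flow (Suc D) f t (hadamard_point D z s) = hadamard_point D (flow (Suc (2 * D)) (hadamard_field D f) t z) s \<and>
        flow (Suc (2 * D)) (hadamard_field D f) t z (2 * D) = z (2 * D)"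
      unfolding Z(3)[symmetric] Z(2) by blast
  qed
qed

lemma cube_memI:
  assumes "x \<in> space_R D"
  obtains M where "M \<ge> 1" "\<And>n \<epsilon>. D \<le> n \<Longrightarrow> \<bar>\<epsilon>\<bar> \<le> 1 \<Longrightarrow> x(n := \<epsilon>) \<in> cube (Suc n) M" "x \<in> cube D M"
proof -
  define M where "M = (\<Sum>i<D. \<bar>x i\<bar>) + 1"
  have x: "\<bar>x i\<bar> \<le> M" for i
  proof (cases "i < D")
    case True
    then have "\<bar>x i\<bar> \<le> (\<Sum>i<D. \<bar>x i\<bar>)" by (intro member_le_sum) auto
    then show ?thesis by (simp add: M_def)
  next
    case False
    then show ?thesis using assms by (simp add: space_R_def M_def sum_nonneg)
  qed
  have "M \<ge> 1" by (simp add: M_def sum_nonneg)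
  moreover have "x(n := \<epsilon>) \<in> cube (Suc n) M" if "D \<le> n" "\<bar>\<epsilon>\<bar> \<le> 1" for n \<epsilon>
  proof -
    have "\<bar>\<epsilon>\<bar> \<le> M" using that(2) \<open>M \<ge> 1\<close> by linarith
    then have "\<bar>(x(n := \<epsilon>)) i\<bar> \<le> M" for i
      unfolding fun_upd_apply using x[of i] by simp
    moreover have "x(n := \<epsilon>) \<in> space_R (Suc n)" using assms that(1) by (simp add: space_R_def)
    ultimately show ?thesis by (simp only: cube_def mem_Collect_eq) blast
  qed
  moreover have "x \<in> cube D M" using x assms by (simp add: cube_def)
  ultimately show ?thesis by (rule that)
qed

text \<open>Each step of the induction doubles \<open>D\<close> and writes the component as its
  value at \<epsilon> = 0 plus \<epsilon> times a component of the enlarged system, to which the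
  hypothesis applies. The deviation d starts at 0, so the same sequence \<open>x\<close> is the
  initial value in every dimension.\<close>

lemma run_eps_expansion:
  assumes "\<forall>p\<in>set ps. param_field D (fst p)" "x \<in> space_R D" "i < D"
  shows "\<exists>R C. \<forall>\<^sub>F \<tau> in nhds 0. \<forall>\<epsilon>. \<bar>\<epsilon>\<bar> \<le> 1 \<longrightarrow>
    \<bar>run (flow (Suc D)) ps \<tau> (x(D := \<epsilon>)) i - (\<Sum>k<n. \<epsilon> ^ k * R k \<tau>)\<bar> \<le> C * \<bar>\<epsilon>\<bar> ^ n"
  using assms
proof (induction n arbitrary: D ps i)
  case 0
  obtain M where M: "M \<ge> 1" "\<And>n \<epsilon>. D \<le> n \<Longrightarrow> \<bar>\<epsilon>\<bar> \<le> 1 \<Longrightarrow> x(n := \<epsilon>) \<in> cube (Suc n) M"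
    by (rule cube_memI[OF 0(2)]) blast
  have "locally_bounded (Suc D) (run (flow (Suc D)) ps)"
    by (rule locally_bounded_run) (use 0(1) in \<open>auto simp: param_field_def intro!: flow_locally_bounded\<close>)
  then obtain M' where "\<forall>\<^sub>F \<tau> in nhds 0. \<forall>z\<in>cube (Suc D) M. run (flow (Suc D)) ps \<tau> z \<in> cube (Suc D) M'"
    using M(1) unfolding locally_bounded_def by (meson order_trans zero_le_one)
  then have "\<forall>\<^sub>F \<tau> in nhds 0. \<forall>\<epsilon>. \<bar>\<epsilon>\<bar> \<le> 1 \<longrightarrow>
    \<bar>run (flow (Suc D)) ps \<tau> (x(D := \<epsilon>)) i - (\<Sum>k<0. \<epsilon> ^ k * 0)\<bar> \<le> M' * \<bar>\<epsilon>\<bar> ^ 0"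
  proof eventually_elim
    case (elim \<tau>)
    show ?case
    proof (intro allI impI)
      fix \<epsilon> :: real assume "\<bar>\<epsilon>\<bar> \<le> 1"
      then have "run (flow (Suc D)) ps \<tau> (x(D := \<epsilon>)) \<in> cube (Suc D) M'" using elim M(2) by blast
      then show "\<bar>run (flow (Suc D)) ps \<tau> (x(D := \<epsilon>)) i - (\<Sum>k<0. \<epsilon> ^ k * 0)\<bar> \<le> M' * \<bar>\<epsilon>\<bar> ^ 0"
        using 0(3) by (simp add: cube_def)
    qed
  qed
  then show ?case by (intro exI[of _ "\<lambda>_ _. 0"] exI[of _ M'])
next
  case (Suc n)
  define H where "H = hadamard_field D"
  define \<Phi> where "\<Phi> = run (\<lambda>f. flow (Suc (2 * D)) (H f)) ps"
  have H: "param_field (2 * D) (H f)" if "f \<in> fst ` set ps" for f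
    using Suc.prems(1) that hadamard_param_field unfolding H_def by auto
  obtain M where M: "M \<ge> 1" "\<And>n \<epsilon>. D \<le> n \<Longrightarrow> \<bar>\<epsilon>\<bar> \<le> 1 \<Longrightarrow> x(n := \<epsilon>) \<in> cube (Suc n) M"
    by (rule cube_memI[OF Suc.prems(2)]) blast
  have conj: "\<forall>\<^sub>F \<tau> in nhds 0. \<forall>z\<in>cube (Suc (2 * D)) M.
      run (flow (Suc D)) ps \<tau> (hadamard_point D z s) = hadamard_point D (\<Phi> \<tau> z) s \<and> \<Phi> \<tau> z (2 * D) = z (2 * D)"
    if s: "s \<in> {0, 1}" for s
    unfolding \<Phi>_def
  proof (rule run_semiconjugate[where \<phi> = "\<lambda>_. flow (Suc D)" and e = "\<lambda>z. z (2 * D)"])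
    fix f M assume "f \<in> fst ` set ps" "(M :: real) \<ge> 0"
    then show "\<forall>\<^sub>F t in nhds 0. \<forall>z\<in>cube (Suc (2 * D)) M.
        flow (Suc D) f t (hadamard_point D z s) = hadamard_point D (flow (Suc (2 * D)) (H f) t z) s \<and>
        flow (Suc (2 * D)) (H f) t z (2 * D) = z (2 * D)"
      unfolding H_def using Suc.prems(1) s by (intro hadamard_flow) auto
  next
    fix f c assume "f \<in> fst ` set ps"
    then show "locally_bounded (Suc (2 * D)) (\<lambda>\<tau>. flow (Suc (2 * D)) (H f) (c * \<tau>))"
      using H by (intro flow_locally_bounded) (simp add: param_field_def)
  qed (use M in simp)
  have "\<exists>R C. \<forall>\<^sub>F \<tau> in nhds 0. \<forall>\<epsilon>. \<bar>\<epsilon>\<bar> \<le> 1 \<longrightarrow>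
      \<bar>run (flow (Suc (2 * D))) (map (\<lambda>p. (H (fst p), snd p)) ps) \<tau> (x(2 * D := \<epsilon>)) (D + i) -
       (\<Sum>k<n. \<epsilon> ^ k * R k \<tau>)\<bar> \<le> C * \<bar>\<epsilon>\<bar> ^ n"
    by (rule Suc.IH) (use H Suc.prems in \<open>auto simp: space_R_def\<close>)
  then obtain R C where R: "\<forall>\<^sub>F \<tau> in nhds 0. \<forall>\<epsilon>. \<bar>\<epsilon>\<bar> \<le> 1 \<longrightarrow>
      \<bar>\<Phi> \<tau> (x(2 * D := \<epsilon>)) (D + i) - (\<Sum>k<n. \<epsilon> ^ k * R k \<tau>)\<bar> \<le> C * \<bar>\<epsilon>\<bar> ^ n"
    unfolding run_map \<Phi>_def by blast
  \<comment> \<open>The leading coefficient is the run from \<open>x\<close> itself, that is with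
    parameter 0; the others are shifted by the extracted factor \<epsilon>.\<close>
  define R' where "R' k \<tau> = (case k of 0 \<Rightarrow> run (flow (Suc D)) ps \<tau> x i | Suc k \<Rightarrow> R k \<tau>)" for k \<tau>
  have "\<forall>\<^sub>F \<tau> in nhds 0. \<forall>\<epsilon>. \<bar>\<epsilon>\<bar> \<le> 1 \<longrightarrow>
    \<bar>run (flow (Suc D)) ps \<tau> (x(D := \<epsilon>)) i - (\<Sum>k<Suc n. \<epsilon> ^ k * R' k \<tau>)\<bar> \<le> C * \<bar>\<epsilon>\<bar> ^ Suc n"
    using conj[of 0, simplified] conj[of 1, simplified] R
  proof eventually_elim
    case (elim \<tau>)
    show ?case
    proof (intro allI impI)
      fix \<epsilon> :: real assume \<epsilon>: "\<bar>\<epsilon>\<bar> \<le> 1"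
      let ?z = "x(2 * D := \<epsilon>)"
      have z: "?z \<in> cube (Suc (2 * D)) M" using M(2)[of "2 * D" \<epsilon>] \<epsilon> by simp
      have p0: "hadamard_point D ?z 0 = x"
        using Suc.prems(2) by (auto simp: hadamard_point_def space_R_def fun_eq_iff)
      have p1: "hadamard_point D ?z 1 = x(D := \<epsilon>)"
        using Suc.prems(2) by (auto simp: hadamard_point_def space_R_def fun_eq_iff)
      have "run (flow (Suc D)) ps \<tau> x i = \<Phi> \<tau> ?z i"
        using elim(1) z p0 Suc.prems(3) by (auto simp: hadamard_point_def)
      moreover have "run (flow (Suc D)) ps \<tau> (x(D := \<epsilon>)) i = \<Phi> \<tau> ?z i + \<epsilon> * \<Phi> \<tau> ?z (D + i)"
        using elim(2) z p1 Suc.prems(3) by (auto simp: hadamard_point_def)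
      moreover have "(\<Sum>k<Suc n. \<epsilon> ^ k * R' k \<tau>) = run (flow (Suc D)) ps \<tau> x i + \<epsilon> * (\<Sum>k<n. \<epsilon> ^ k * R k \<tau>)"
        unfolding sum.lessThan_Suc_shift R'_def by (simp add: sum_distrib_left mult.assoc)
      ultimately have "run (flow (Suc D)) ps \<tau> (x(D := \<epsilon>)) i - (\<Sum>k<Suc n. \<epsilon> ^ k * R' k \<tau>) =
          \<epsilon> * (\<Phi> \<tau> ?z (D + i) - (\<Sum>k<n. \<epsilon> ^ k * R k \<tau>))" by (simp add: right_diff_distrib)
      moreover have "\<bar>\<Phi> \<tau> ?z (D + i) - (\<Sum>k<n. \<epsilon> ^ k * R k \<tau>)\<bar> \<le> C * \<bar>\<epsilon>\<bar> ^ n" using elim(3) \<epsilon> by blast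
      then have "\<bar>\<epsilon>\<bar> * \<bar>\<Phi> \<tau> ?z (D + i) - (\<Sum>k<n. \<epsilon> ^ k * R k \<tau>)\<bar> \<le> \<bar>\<epsilon>\<bar> * (C * \<bar>\<epsilon>\<bar> ^ n)"
        by (intro mult_left_mono) auto
      ultimately show "\<bar>run (flow (Suc D)) ps \<tau> (x(D := \<epsilon>)) i - (\<Sum>k<Suc n. \<epsilon> ^ k * R' k \<tau>)\<bar> \<le> C * \<bar>\<epsilon>\<bar> ^ Suc n"
        by (simp add: abs_mult mult_ac)
    qed
  qed
  then show ?case by blast
qed

section \<open>Comparison of the two expansions\<close>

text \<open>Equivalence of two norms on polynomials of degree at most \<open>m\<close>. Splitting
  off the value at the last node x = m + 1 leaves p = c + (X - x) q; the nodes up to m have distance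
  at least 1 from x, so q is bounded there by 2B.\<close>

lemma poly_coeff_bound:
  "\<exists>V. \<forall>p B. degree p \<le> m \<longrightarrow> (\<forall>j\<le>m. \<bar>poly p (real j)\<bar> \<le> B) \<longrightarrow> (\<forall>k. \<bar>coeff p k\<bar> \<le> V * B)"
proof (induction m)
  case 0
  have "\<bar>coeff p k\<bar> \<le> 1 * B" if deg: "degree p \<le> 0" and B: "\<forall>j\<le>0. \<bar>poly p (real j)\<bar> \<le> B" for p k and B :: real
  proof -
    obtain c where "p = [:c:]" using deg by (auto elim: degree_eq_zeroE)
    then show ?thesis using B by (cases k) auto
  qed
  then show ?case by blast
next
  case (Suc m)
  then obtain V where V: "\<And>p B k. degree p \<le> m \<Longrightarrow> (\<And>j. j \<le> m \<Longrightarrow> \<bar>poly p (real j)\<bar> \<le> B) \<Longrightarrow> \<bar>coeff p k\<bar> \<le> V * B"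
    by blast
  define x where "x = real (Suc m)"
  have "\<bar>coeff p k\<bar> \<le> (1 + 2 * x * \<bar>V\<bar> + 2 * \<bar>V\<bar>) * B"
    if deg: "degree p \<le> Suc m" and B: "\<forall>j\<le>Suc m. \<bar>poly p (real j)\<bar> \<le> B" for p k B
  proof -
    define c where "c = poly p x"
    have "poly (p - [:c:]) x = 0" by (simp add: c_def)
    then obtain q where q: "p - [:c:] = [:- x, 1:] * q" unfolding poly_eq_0_iff_dvd by blast
    have p: "p = [:c:] + [:- x, 1:] * q" using q by (simp add: algebra_simps)
    have cB: "\<bar>c\<bar> \<le> B" using B unfolding c_def x_def by blast
    then have B0: "B \<ge> 0" by linarith
    have "degree q \<le> m"
    proof (cases "q = 0")
      case False
      then have "degree ([:- x, 1:] * q) = Suc (degree q)" by (subst degree_mult_eq) auto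
      moreover have "degree (p - [:c:]) \<le> Suc m" using deg by (intro degree_diff_le) auto
      ultimately show ?thesis using q by simp
    qed simp
    moreover have "\<bar>poly q (real j)\<bar> \<le> 2 * B" if "j \<le> m" for j
    proof -
      have "poly p (real j) - c = (real j - x) * poly q (real j)"
        by (subst p) (simp add: algebra_simps)
      then have "\<bar>real j - x\<bar> * \<bar>poly q (real j)\<bar> \<le> 2 * B"
        using B that cB by (simp add: abs_mult[symmetric]) (smt (verit) le_SucI)
      moreover have "1 * \<bar>poly q (real j)\<bar> \<le> \<bar>real j - x\<bar> * \<bar>poly q (real j)\<bar>"
        by (rule mult_right_mono) (use that in \<open>auto simp: x_def\<close>)
      ultimately show ?thesis by linarith
    qed
    ultimately have Vq: "\<bar>coeff q k\<bar> \<le> V * (2 * B)" for k by (rule V)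
    then have Vq: "\<bar>coeff q k\<bar> \<le> \<bar>V\<bar> * (2 * B)" for k
      using B0 by (meson abs_ge_self mult_right_mono order_trans mult_nonneg_nonneg zero_le_numeral)
    have "coeff p k = (if k = 0 then c else 0) - x * coeff q k + (case k of 0 \<Rightarrow> 0 | Suc k' \<Rightarrow> coeff q k')"
      by (subst p) (simp add: coeff_pCons split: nat.split)
    moreover have "\<bar>x * coeff q k\<bar> \<le> x * (\<bar>V\<bar> * (2 * B))"
      unfolding abs_mult by (intro mult_mono Vq) (auto simp: x_def)
    moreover have "\<bar>case k of 0 \<Rightarrow> 0 | Suc k' \<Rightarrow> coeff q k'\<bar> \<le> \<bar>V\<bar> * (2 * B)"
      using Vq B0 by (auto split: nat.split)
    moreover have "\<bar>if k = 0 then c else 0\<bar> \<le> B" using cB B0 by auto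
    ultimately have "\<bar>coeff p k\<bar> \<le> B + x * (\<bar>V\<bar> * (2 * B)) + \<bar>V\<bar> * (2 * B)" by linarith
    then show ?thesis by (simp add: algebra_simps)
  qed
  then show ?case by blast
qed

lemma power_sum_coeff_bound:
  obtains V where "V \<ge> 0" "\<And>a B k. (\<And>j. j \<le> m \<Longrightarrow> \<bar>\<Sum>k\<le>m. a k * real j ^ k\<bar> \<le> B) \<Longrightarrow> k \<le> m \<Longrightarrow> \<bar>a k\<bar> \<le> V * B"
proof -
  obtain V where V: "\<And>p B k. degree p \<le> m \<Longrightarrow> (\<And>j. j \<le> m \<Longrightarrow> \<bar>poly p (real j)\<bar> \<le> B) \<Longrightarrow> \<bar>coeff p k\<bar> \<le> V * B"
    using poly_coeff_bound[of m] by blast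
  have "\<bar>a k\<bar> \<le> \<bar>V\<bar> * B" if a: "\<And>j. j \<le> m \<Longrightarrow> \<bar>\<Sum>k\<le>m. a k * real j ^ k\<bar> \<le> B" and k: "k \<le> m" for a B k
  proof -
    define p where "p = (\<Sum>k\<le>m. monom (a k) k)"
    have "degree p \<le> m" unfolding p_def by (rule degree_sum_le) (auto intro: order_trans[OF degree_monom_le])
    moreover have "\<bar>poly p (real j)\<bar> \<le> B" if "j \<le> m" for j
      using a[OF that] by (simp add: p_def poly_sum poly_monom)
    ultimately have "\<bar>coeff p k\<bar> \<le> V * B" by (rule V)
    moreover have "coeff p k = a k" using k by (simp add: p_def coeff_sum)
    moreover have "B \<ge> 0" using a[of 0] by linarith
    then have "V * B \<le> \<bar>V\<bar> * B" by (intro mult_right_mono) auto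
    ultimately show ?thesis by linarith
  qed
  then show ?thesis using that[of "\<bar>V\<bar>"] by simp
qed

lemma tail_bound:
  assumes "\<bar>t\<bar> \<le> (1 :: real)" "\<And>k. k \<in> K \<Longrightarrow> q \<le> k" "finite K"
  shows "\<bar>\<Sum>k\<in>K. t ^ k * c k\<bar> \<le> (\<Sum>k\<in>K. \<bar>c k\<bar>) * \<bar>t\<bar> ^ q"
proof -
  have "\<bar>t ^ k * c k\<bar> \<le> \<bar>c k\<bar> * \<bar>t\<bar> ^ q" if "k \<in> K" for k
  proof -
    have "\<bar>t\<bar> ^ k \<le> \<bar>t\<bar> ^ q" using assms(1,2) that by (intro power_decreasing) auto
    then have "\<bar>c k\<bar> * \<bar>t\<bar> ^ k \<le> \<bar>c k\<bar> * \<bar>t\<bar> ^ q" by (intro mult_left_mono) auto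
    then show ?thesis by (simp add: abs_mult power_abs mult.commute)
  qed
  then show ?thesis unfolding sum_distrib_right by (intro order_trans[OF sum_abs] sum_mono)
qed

text \<open>Both expansions are compared at \<open>\<epsilon> = j |\<tau>|^q / (m + 1)\<close> for \<open>j = 0, \<dots>, m\<close>: then
  the two remainders are of the same order, and the coefficients can be recovered.\<close>

lemma eps_coefficient_expansion:
  fixes err :: "real \<Rightarrow> real \<Rightarrow> real" and p :: "nat \<Rightarrow> nat \<Rightarrow> real"
  assumes eps: "\<forall>\<^sub>F \<tau> in nhds 0. \<forall>\<epsilon>. \<bar>\<epsilon>\<bar> \<le> 1 \<longrightarrow> \<bar>err \<epsilon> \<tau> - (\<Sum>k<Suc m. \<epsilon> ^ k * R k \<tau>)\<bar> \<le> C1 * \<bar>\<epsilon>\<bar> ^ Suc m"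
    and tau: "\<And>N. \<exists>C. \<forall>\<^sub>F \<tau> in nhds 0. \<forall>\<epsilon>. \<bar>\<epsilon>\<bar> \<le> 1 \<longrightarrow>
      \<bar>err \<epsilon> \<tau> - (\<Sum>n<N. \<tau> ^ n * (\<Sum>k\<le>n. \<epsilon> ^ k * p n k))\<bar> \<le> C * \<bar>\<tau>\<bar> ^ N"
    and p: "\<And>n k. n < k \<Longrightarrow> p n k = 0" and k: "k \<le> m" and zero: "\<And>n. n < q \<Longrightarrow> p n k = 0"
  shows "\<exists>C. \<forall>\<^sub>F \<tau> in at 0. \<bar>R k \<tau>\<bar> \<le> C * \<bar>\<tau>\<bar> ^ q"
proof -
  \<comment> \<open>With \<eta> = |\<tau>|^q this gives |\<tau>|^N = \<eta>^(m+1), the size of the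
    other remainder for |\<epsilon>| \<le> \<eta>.\<close>
  define N where "N = q * Suc m"
  obtain C2 where C2: "\<forall>\<^sub>F \<tau> in nhds 0. \<forall>\<epsilon>. \<bar>\<epsilon>\<bar> \<le> 1 \<longrightarrow>
      \<bar>err \<epsilon> \<tau> - (\<Sum>n<N. \<tau> ^ n * (\<Sum>k\<le>n. \<epsilon> ^ k * p n k))\<bar> \<le> C2 * \<bar>\<tau>\<bar> ^ N"
    using tau by blast
  obtain V where V: "V \<ge> 0" "\<And>a B k. (\<And>j. j \<le> m \<Longrightarrow> \<bar>\<Sum>k\<le>m. a k * real j ^ k\<bar> \<le> B) \<Longrightarrow> k \<le> m \<Longrightarrow> \<bar>a k\<bar> \<le> V * B"
    by (rule power_sum_coeff_bound[of m]) blast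
  define C3 where "C3 = (\<Sum>n<N. \<Sum>k\<in>{Suc m..n}. \<bar>p n k\<bar>)"
  define C4 where "C4 = (\<Sum>n\<in>{q..<N}. \<bar>p n k\<bar>)"
  define C5 where "C5 = \<bar>C1\<bar> + \<bar>C2\<bar> + C3"
  have C3: "C3 \<ge> 0" unfolding C3_def by (intro sum_nonneg) auto
  have C5: "C5 \<ge> 0" using C3 by (simp add: C5_def)
  have "\<forall>\<^sub>F \<tau> in at 0. \<bar>\<tau>\<bar> \<le> (1 :: real)"
    using eventually_abs_le[of 1] by (simp add: eventually_at_filter eventually_mono)
  moreover have "\<forall>\<^sub>F \<tau> in at 0. (\<tau> :: real) \<noteq> 0" by (simp add: eventually_at_filter)
  moreover have "\<forall>\<^sub>F \<tau> in at 0. \<forall>\<epsilon>. \<bar>\<epsilon>\<bar> \<le> 1 \<longrightarrow> \<bar>err \<epsilon> \<tau> - (\<Sum>k<Suc m. \<epsilon> ^ k * R k \<tau>)\<bar> \<le> C1 * \<bar>\<epsilon>\<bar> ^ Suc m"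
    using eps unfolding eventually_at_filter by (rule eventually_mono) blast
  moreover have "\<forall>\<^sub>F \<tau> in at 0. \<forall>\<epsilon>. \<bar>\<epsilon>\<bar> \<le> 1 \<longrightarrow>
      \<bar>err \<epsilon> \<tau> - (\<Sum>n<N. \<tau> ^ n * (\<Sum>k\<le>n. \<epsilon> ^ k * p n k))\<bar> \<le> C2 * \<bar>\<tau>\<bar> ^ N"
    using C2 unfolding eventually_at_filter by (rule eventually_mono) blast
  ultimately have "\<forall>\<^sub>F \<tau> in at 0. \<bar>R k \<tau>\<bar> \<le> (V * C5 * real (Suc m) ^ k + C4) * \<bar>\<tau>\<bar> ^ q"
  proof eventually_elim
    case (elim \<tau>)
    define \<eta> where "\<eta> = \<bar>\<tau>\<bar> ^ q"
    define h where "h = \<eta> / real (Suc m)"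
    have \<eta>: "0 < \<eta>" "\<eta> \<le> 1" using elim(1,2) by (auto simp: \<eta>_def power_le_one)
    have h: "h > 0" using \<eta> by (simp add: h_def)
    define A where "A k = R k \<tau> - (\<Sum>n<N. \<tau> ^ n * p n k)" for k
    have Qbound: "\<bar>\<Sum>k\<le>m. A k * \<epsilon> ^ k\<bar> \<le> C5 * \<eta> ^ Suc m" if \<epsilon>: "\<bar>\<epsilon>\<bar> \<le> \<eta>" for \<epsilon>
    proof -
      have \<epsilon>1: "\<bar>\<epsilon>\<bar> \<le> 1" using \<epsilon> \<eta> by linarith
      have \<epsilon>m: "\<bar>\<epsilon>\<bar> ^ Suc m \<le> \<eta> ^ Suc m" using \<epsilon> by (intro power_mono) auto
      define E1 where "E1 = err \<epsilon> \<tau> - (\<Sum>k<Suc m. \<epsilon> ^ k * R k \<tau>)"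
      define E2 where "E2 = err \<epsilon> \<tau> - (\<Sum>n<N. \<tau> ^ n * (\<Sum>k\<le>n. \<epsilon> ^ k * p n k))"
      define E3 where "E3 = (\<Sum>n<N. \<tau> ^ n * (\<Sum>k\<in>{Suc m..n}. \<epsilon> ^ k * p n k))"
      have "(\<Sum>k\<le>n. \<epsilon> ^ k * p n k) = (\<Sum>k\<le>m. \<epsilon> ^ k * p n k) + (\<Sum>k\<in>{Suc m..n}. \<epsilon> ^ k * p n k)" for n
      proof -
        have "(\<Sum>k\<le>m. \<epsilon> ^ k * p n k) + (\<Sum>k\<in>{Suc m..n}. \<epsilon> ^ k * p n k) = (\<Sum>k\<in>{..m} \<union> {Suc m..n}. \<epsilon> ^ k * p n k)"
          by (subst sum.union_disjoint) auto
        also have "\<dots> = (\<Sum>k\<le>n. \<epsilon> ^ k * p n k)"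
          by (rule sum.mono_neutral_right) (use p in \<open>auto simp: not_le\<close>)
        finally show ?thesis ..
      qed
      then have "(\<Sum>n<N. \<tau> ^ n * (\<Sum>k\<le>n. \<epsilon> ^ k * p n k)) = (\<Sum>n<N. \<Sum>k\<le>m. \<tau> ^ n * (\<epsilon> ^ k * p n k)) + E3"
        unfolding E3_def by (simp add: distrib_left sum.distrib sum_distrib_left)
      also have "(\<Sum>n<N. \<Sum>k\<le>m. \<tau> ^ n * (\<epsilon> ^ k * p n k)) = (\<Sum>k\<le>m. \<Sum>n<N. \<tau> ^ n * (\<epsilon> ^ k * p n k))"
        by (rule sum.swap)
      also have "\<dots> = (\<Sum>k\<le>m. (\<Sum>n<N. \<tau> ^ n * p n k) * \<epsilon> ^ k)"
        unfolding sum_distrib_right by (simp add: mult_ac)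
      finally have "(\<Sum>k\<le>m. A k * \<epsilon> ^ k) = E2 - E1 + E3"
        unfolding E1_def E2_def A_def lessThan_Suc_atMost
        by (simp add: left_diff_distrib right_diff_distrib sum_subtractf mult.commute[of _ "\<epsilon> ^ _"])
      moreover have "\<bar>E1\<bar> \<le> \<bar>C1\<bar> * \<eta> ^ Suc m"
      proof -
        have "\<bar>E1\<bar> \<le> C1 * \<bar>\<epsilon>\<bar> ^ Suc m" using elim(3) \<epsilon>1 unfolding E1_def by blast
        also have "\<dots> \<le> \<bar>C1\<bar> * \<eta> ^ Suc m" using \<epsilon>m by (intro mult_mono) auto
        finally show ?thesis .
      qed
      moreover have "\<bar>E2\<bar> \<le> \<bar>C2\<bar> * \<eta> ^ Suc m"
      proof -
        have "\<bar>E2\<bar> \<le> C2 * \<bar>\<tau>\<bar> ^ N" using elim(4) \<epsilon>1 unfolding E2_def by blast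
        also have "\<bar>\<tau>\<bar> ^ N = \<eta> ^ Suc m" unfolding N_def \<eta>_def by (rule power_mult)
        also have "C2 * \<eta> ^ Suc m \<le> \<bar>C2\<bar> * \<eta> ^ Suc m" using \<eta> by (intro mult_right_mono) auto
        finally show ?thesis .
      qed
      moreover have "\<bar>E3\<bar> \<le> C3 * \<eta> ^ Suc m"
      proof -
        have "\<bar>\<tau> ^ n * (\<Sum>k\<in>{Suc m..n}. \<epsilon> ^ k * p n k)\<bar> \<le> (\<Sum>k\<in>{Suc m..n}. \<bar>p n k\<bar>) * \<eta> ^ Suc m" for n
        proof -
          have "\<bar>\<Sum>k\<in>{Suc m..n}. \<epsilon> ^ k * p n k\<bar> \<le> (\<Sum>k\<in>{Suc m..n}. \<bar>p n k\<bar>) * \<bar>\<epsilon>\<bar> ^ Suc m"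
            by (rule tail_bound[OF \<epsilon>1]) auto
          also have "\<dots> \<le> (\<Sum>k\<in>{Suc m..n}. \<bar>p n k\<bar>) * \<eta> ^ Suc m"
            using \<epsilon>m by (intro mult_left_mono sum_nonneg) auto
          finally have "\<bar>\<tau> ^ n\<bar> * \<bar>\<Sum>k\<in>{Suc m..n}. \<epsilon> ^ k * p n k\<bar> \<le> 1 * ((\<Sum>k\<in>{Suc m..n}. \<bar>p n k\<bar>) * \<eta> ^ Suc m)"
            using elim(1) by (intro mult_mono) (auto simp: power_abs power_le_one)
          then show ?thesis by (simp add: abs_mult)
        qed
        then show ?thesis unfolding E3_def C3_def sum_distrib_right
          by (intro order_trans[OF sum_abs] sum_mono) (simp add: sum_distrib_right)
      qed
      ultimately show ?thesis unfolding C5_def distrib_right by linarith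
    qed
    have "\<bar>A k * h ^ k\<bar> \<le> V * (C5 * \<eta> ^ Suc m)"
    proof (rule V(2)[OF _ k])
      fix j assume j: "j \<le> m"
      have "real j / real (Suc m) \<le> 1" using j by simp
      then have "real j / real (Suc m) * \<eta> \<le> 1 * \<eta>" using \<eta> by (intro mult_right_mono) auto
      then have "\<bar>h * real j\<bar> \<le> \<eta>" using \<eta> by (simp add: h_def mult_ac)
      from Qbound[OF this] show "\<bar>\<Sum>k\<le>m. A k * h ^ k * real j ^ k\<bar> \<le> C5 * \<eta> ^ Suc m"
        by (simp add: power_mult_distrib mult_ac)
    qed
    then have "\<bar>A k\<bar> * h ^ k \<le> V * (C5 * \<eta> ^ Suc m)" using h by (simp add: abs_mult)
    moreover have "\<eta> ^ k = h ^ k * real (Suc m) ^ k"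
      by (simp add: h_def power_divide)
    ultimately have "\<bar>A k\<bar> * \<eta> ^ k \<le> V * (C5 * \<eta> ^ Suc m) * real (Suc m) ^ k"
      by (simp only: mult.assoc[symmetric]) (rule mult_right_mono, auto)
    also have "\<dots> = V * C5 * real (Suc m) ^ k * \<eta> ^ (Suc m - k) * \<eta> ^ k"
      using k by (simp add: power_add[symmetric] mult_ac del: power_Suc)
    finally have "\<bar>A k\<bar> \<le> V * C5 * real (Suc m) ^ k * \<eta> ^ (Suc m - k)"
      using \<eta> by (simp add: mult_le_cancel_right)
    \<comment> \<open>Since k \<le> m, at least one factor \<eta> = |\<tau>|^q survives the division
      by \<eta>^k.\<close>
    also have "\<dots> \<le> V * C5 * real (Suc m) ^ k * \<eta>"
    proof -
      have "\<eta> ^ (Suc m - k) \<le> \<eta> ^ 1" using \<eta> k by (intro power_decreasing) auto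
      then show ?thesis using V(1) C5 by (intro mult_left_mono) auto
    qed
    finally have A: "\<bar>A k\<bar> \<le> V * C5 * real (Suc m) ^ k * \<bar>\<tau>\<bar> ^ q" by (simp add: \<eta>_def)
    have "(\<Sum>n<N. \<tau> ^ n * p n k) = (\<Sum>n\<in>{q..<N}. \<tau> ^ n * p n k)"
      by (rule sum.mono_neutral_right) (use zero in \<open>auto simp: not_le\<close>)
    moreover have "\<bar>\<Sum>n\<in>{q..<N}. \<tau> ^ n * p n k\<bar> \<le> C4 * \<bar>\<tau>\<bar> ^ q"
      unfolding C4_def by (rule tail_bound[OF elim(1)]) auto
    ultimately show ?case using A unfolding A_def distrib_right by linarith
  qed
  then show ?thesis by blast
qed

section \<open>Sufficiency of the conditions\<close>

locale perturbed_system =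
  fixes D :: nat and fA fB :: "(nat \<Rightarrow> real) \<Rightarrow> nat \<Rightarrow> real"
  assumes fA: "smooth_field D fA" and fB: "smooth_field D fB"
begin

text \<open>The update \<open>y(D := 0)\<close> projects back to \<open>space_R D\<close>, where the
  given fields are smooth; nothing is known about their values elsewhere.\<close>

definition aug :: "bool \<Rightarrow> (nat \<Rightarrow> real) \<Rightarrow> nat \<Rightarrow> real" where
  "aug l y = (\<lambda>i. if i < D then (if l then y D * fB (y(D := 0)) i else fA (y(D := 0)) i) else 0)"

definition part :: "real \<Rightarrow> bool \<Rightarrow> (nat \<Rightarrow> real) \<Rightarrow> nat \<Rightarrow> real" where
  "part \<epsilon> l = (if l then (\<lambda>y i. \<epsilon> * fB y i) else fA)"

definition whole :: "real \<Rightarrow> (nat \<Rightarrow> real) \<Rightarrow> nat \<Rightarrow> real" where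
  "whole \<epsilon> = (\<lambda>y i. fA y i + \<epsilon> * fB y i)"

lemma smooth_field_drop: "smooth_field D f \<Longrightarrow> i < D \<Longrightarrow> smooth (Suc D) (\<lambda>y. f (y(D := 0)) i)"
proof -
  assume f: "smooth_field D f" and i: "i < D"
  have "smooth (Suc D) (\<lambda>y. f (tuple D (\<lambda>l y. y l) y) i)"
    by (rule smooth_compose) (use f i in \<open>auto simp: smooth_field_iff smooth_coord\<close>)
  moreover have "tuple D (\<lambda>l y. y l) y = y(D := 0)" if "y \<in> space_R (Suc D)" for y
    using that by (auto simp: space_R_def fun_eq_iff not_less)
  ultimately show ?thesis by (subst smooth_cong[of "Suc D" _ "\<lambda>y. f (tuple D (\<lambda>l y. y l) y) i"]) auto
qed

lemma aug_param_field: "param_field D (aug l)"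
proof -
  have "smooth (Suc D) (\<lambda>y. aug l y i)" for i
  proof (cases "i < D")
    case True
    then show ?thesis using smooth_field_drop[OF fA True] smooth_field_drop[OF fB True]
      by (cases l) (auto simp: aug_def intro!: smooth_mult smooth_coord)
  qed (simp add: aug_def smooth_const)
  then show ?thesis by (auto simp: param_field_def smooth_field_iff aug_def space_R_def)
qed

sublocale two_fields "Suc D" aug
  by unfold_locales (use aug_param_field in \<open>simp add: param_field_def\<close>)

abbreviation aug_sum :: "(nat \<Rightarrow> real) \<Rightarrow> nat \<Rightarrow> real" where
  "aug_sum \<equiv> (\<lambda>y i. aug False y i + aug True y i)"

lemma aug_sum_param_field: "param_field D aug_sum"
  using sum_field by (simp add: param_field_def aug_def)

lemma smooth_field_scale: "smooth_field D f \<Longrightarrow> smooth_field D (\<lambda>y i. \<epsilon> * f y i)"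
  unfolding smooth_field_iff by (auto simp: space_R_def Pi_def intro!: smooth_mult smooth_const)

lemma smooth_field_add: "smooth_field D f \<Longrightarrow> smooth_field D g \<Longrightarrow> smooth_field D (\<lambda>y i. f y i + g y i)"
  unfolding smooth_field_iff by (auto simp: space_R_def Pi_def intro!: smooth_add)

lemma part_smooth_field: "smooth_field D (part \<epsilon> l)"
  using fA fB smooth_field_scale by (simp add: part_def)

lemma whole_smooth_field: "smooth_field D (whole \<epsilon>)"
  unfolding whole_def by (rule smooth_field_add[OF fA smooth_field_scale[OF fB]])

lemma param_flow_project:
  assumes F: "param_field D F" and g: "\<And>\<epsilon>. smooth_field D (g \<epsilon>)"
    and eq: "\<And>z i. i < D \<Longrightarrow> F z i = g (z D) (z(D := 0)) i" and M: "M \<ge> 0"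
  shows "\<forall>\<^sub>F t in nhds 0. \<forall>z\<in>cube (Suc D) M.
    flow D (g (z D)) t (z(D := 0)) = (flow (Suc D) F t z)(D := 0) \<and> flow (Suc D) F t z D = z D"
  using param_flow[OF F M]
proof eventually_elim
  case (elim t)
  show ?case
  proof
    fix z assume "z \<in> cube (Suc D) M"
    then obtain Z where Z: "solves_ode (Suc D) F (closed_segment 0 t) Z" "Z 0 = z"
      "Z t = flow (Suc D) F t z" "\<forall>s\<in>closed_segment 0 t. Z s D = z D"
      using elim by blast
    have "flow D (g (z D)) t ((Z 0)(D := 0)) = (Z t)(D := 0)"
    proof (rule flow_conjugate[OF g Z(1), where V = "{y. y D = z D}" and P = "\<lambda>y. y(D := 0)"])
      show "smooth (Suc D) (\<lambda>y. (y(D := 0)) i)" if "i < D" for i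
        using that by (simp add: smooth_coord)
      show "y(D := 0) \<in> space_R D" if "y \<in> space_R (Suc D)" for y :: "nat \<Rightarrow> real"
        using that by (auto simp: space_R_def)
      show "lie (Suc D) F (\<lambda>y. (y(D := 0)) i) y = g (z D) (y(D := 0)) i" if "y \<in> {y. y D = z D}" "i < D" for y i
        using that lie_coord[of i "Suc D" F y] eq[of i y] by simp
    qed (use Z(4) in auto)
    moreover have "Z t D = z D" using Z(4) by simp
    ultimately show "flow D (g (z D)) t (z(D := 0)) = (flow (Suc D) F t z)(D := 0) \<and> flow (Suc D) F t z D = z D"
      unfolding Z(3)[symmetric] Z(2) by blast
  qed
qed

lemma run_project:
  assumes "x \<in> space_R D"
  shows "\<forall>\<^sub>F \<tau> in nhds 0. \<forall>\<epsilon>. \<bar>\<epsilon>\<bar> \<le> 1 \<longrightarrow> (\<forall>i<D.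
    run (\<lambda>l. flow D (part \<epsilon> l)) ps \<tau> x i = run (\<lambda>l. flow (Suc D) (aug l)) ps \<tau> (x(D := \<epsilon>)) i)"
proof -
  obtain M where M: "M \<ge> 1" "\<And>n \<epsilon>. D \<le> n \<Longrightarrow> \<bar>\<epsilon>\<bar> \<le> 1 \<Longrightarrow> x(n := \<epsilon>) \<in> cube (Suc n) M"
    by (rule cube_memI[OF assms]) blast
  have "\<forall>\<^sub>F \<tau> in nhds 0. \<forall>z\<in>cube (Suc D) M. run (\<lambda>l. flow D (part (z D) l)) ps \<tau> (z(D := 0)) =
      (run (\<lambda>l. flow (Suc D) (aug l)) ps \<tau> z)(D := 0) \<and> run (\<lambda>l. flow (Suc D) (aug l)) ps \<tau> z D = z D"
  proof (rule run_semiconjugate)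
    fix l M assume "(M :: real) \<ge> 0"
    then show "\<forall>\<^sub>F t in nhds 0. \<forall>z\<in>cube (Suc D) M.
        flow D (part (z D) l) t (z(D := 0)) = (flow (Suc D) (aug l) t z)(D := 0) \<and> flow (Suc D) (aug l) t z D = z D"
      by (intro param_flow_project[where g = "\<lambda>\<epsilon>. part \<epsilon> l"] aug_param_field part_smooth_field)
        (auto simp: aug_def part_def)
  next
    fix l c show "locally_bounded (Suc D) (\<lambda>\<tau>. flow (Suc D) (aug l) (c * \<tau>))"
      by (rule flow_locally_bounded[OF F])
  qed (use M in simp)
  then show ?thesis
  proof eventually_elim
    case (elim \<tau>)
    show ?case
    proof (intro allI impI)
      fix \<epsilon> :: real and i assume \<epsilon>: "\<bar>\<epsilon>\<bar> \<le> 1" and i: "i < D"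
      have "x(D := \<epsilon>) \<in> cube (Suc D) M" using M(2)[of D] \<epsilon> by simp
      then have "run (\<lambda>l. flow D (part ((x(D := \<epsilon>)) D) l)) ps \<tau> ((x(D := \<epsilon>))(D := 0)) =
          (run (\<lambda>l. flow (Suc D) (aug l)) ps \<tau> (x(D := \<epsilon>)))(D := 0)"
        using elim by blast
      moreover have "(x(D := \<epsilon>))(D := 0) = x" using assms by (auto simp: space_R_def fun_eq_iff)
      ultimately have "run (\<lambda>l. flow D (part \<epsilon> l)) ps \<tau> x =
          (run (\<lambda>l. flow (Suc D) (aug l)) ps \<tau> (x(D := \<epsilon>)))(D := 0)" by simp
      then show "run (\<lambda>l. flow D (part \<epsilon> l)) ps \<tau> x i = run (\<lambda>l. flow (Suc D) (aug l)) ps \<tau> (x(D := \<epsilon>)) i"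
        using i by simp
    qed
  qed
qed

lemma whole_project:
  assumes "x \<in> space_R D"
  shows "\<forall>\<^sub>F \<tau> in nhds 0. \<forall>\<epsilon>. \<bar>\<epsilon>\<bar> \<le> 1 \<longrightarrow> (\<forall>i<D.
    flow D (whole \<epsilon>) \<tau> x i = flow (Suc D) aug_sum \<tau> (x(D := \<epsilon>)) i)"
proof -
  obtain M where M: "M \<ge> 1" "\<And>n \<epsilon>. D \<le> n \<Longrightarrow> \<bar>\<epsilon>\<bar> \<le> 1 \<Longrightarrow> x(n := \<epsilon>) \<in> cube (Suc n) M"
    by (rule cube_memI[OF assms]) blast
  have "\<forall>\<^sub>F \<tau> in nhds 0. \<forall>z\<in>cube (Suc D) M. flow D (whole (z D)) \<tau> (z(D := 0)) =
      (flow (Suc D) aug_sum \<tau> z)(D := 0) \<and> flow (Suc D) aug_sum \<tau> z D = z D"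
  proof (rule param_flow_project[where g = whole, OF aug_sum_param_field whole_smooth_field])
    show "aug_sum z i = whole (z D) (z(D := 0)) i" if "i < D" for z i
      using that by (simp add: aug_def whole_def)
  qed (use M in simp)
  then show ?thesis
  proof eventually_elim
    case (elim \<tau>)
    show ?case
    proof (intro allI impI)
      fix \<epsilon> :: real and i assume \<epsilon>: "\<bar>\<epsilon>\<bar> \<le> 1" and i: "i < D"
      have "x(D := \<epsilon>) \<in> cube (Suc D) M" using M(2)[of D] \<epsilon> by simp
      then have "flow D (whole ((x(D := \<epsilon>)) D)) \<tau> ((x(D := \<epsilon>))(D := 0)) =
          (flow (Suc D) aug_sum \<tau> (x(D := \<epsilon>)))(D := 0)"
        using elim by blast
      moreover have "(x(D := \<epsilon>))(D := 0) = x" using assms by (auto simp: space_R_def fun_eq_iff)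
      ultimately have "flow D (whole \<epsilon>) \<tau> x = (flow (Suc D) aug_sum \<tau> (x(D := \<epsilon>)))(D := 0)" by simp
      then show "flow D (whole \<epsilon>) \<tau> x i = flow (Suc D) aug_sum \<tau> (x(D := \<epsilon>)) i"
        using i by simp
    qed
  qed
qed

definition err :: "(bool \<times> real) list \<Rightarrow> (nat \<Rightarrow> real) \<Rightarrow> real \<Rightarrow> real \<Rightarrow> nat \<Rightarrow> real" where
  "err ps x \<epsilon> \<tau> i = run (\<lambda>l. flow D (part \<epsilon> l)) ps \<tau> x i - flow D (whole \<epsilon>) \<tau> x i"

lemma err_eps_expansion:
  assumes x: "x \<in> space_R D" and i: "i < D"
  shows "\<exists>R C. \<forall>\<^sub>F \<tau> in nhds 0. \<forall>\<epsilon>. \<bar>\<epsilon>\<bar> \<le> 1 \<longrightarrow> \<bar>err ps x \<epsilon> \<tau> i - (\<Sum>k<n. \<epsilon> ^ k * R k \<tau>)\<bar> \<le> C * \<bar>\<epsilon>\<bar> ^ n"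
proof -
  have "\<exists>R C. \<forall>\<^sub>F \<tau> in nhds 0. \<forall>\<epsilon>. \<bar>\<epsilon>\<bar> \<le> 1 \<longrightarrow>
      \<bar>run (flow (Suc D)) (map (\<lambda>p. (aug (fst p), snd p)) ps) \<tau> (x(D := \<epsilon>)) i - (\<Sum>k<n. \<epsilon> ^ k * R k \<tau>)\<bar> \<le> C * \<bar>\<epsilon>\<bar> ^ n"
    by (rule run_eps_expansion) (use x i aug_param_field in auto)
  then obtain R1 C1 where R1: "\<forall>\<^sub>F \<tau> in nhds 0. \<forall>\<epsilon>. \<bar>\<epsilon>\<bar> \<le> 1 \<longrightarrow>
      \<bar>run (\<lambda>l. flow (Suc D) (aug l)) ps \<tau> (x(D := \<epsilon>)) i - (\<Sum>k<n. \<epsilon> ^ k * R1 k \<tau>)\<bar> \<le> C1 * \<bar>\<epsilon>\<bar> ^ n"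
    unfolding run_map by blast
  have "\<exists>R C. \<forall>\<^sub>F \<tau> in nhds 0. \<forall>\<epsilon>. \<bar>\<epsilon>\<bar> \<le> 1 \<longrightarrow>
      \<bar>run (flow (Suc D)) [(aug_sum, 1)] \<tau> (x(D := \<epsilon>)) i - (\<Sum>k<n. \<epsilon> ^ k * R k \<tau>)\<bar> \<le> C * \<bar>\<epsilon>\<bar> ^ n"
    by (rule run_eps_expansion) (use x i aug_sum_param_field in auto)
  then obtain R2 C2 where R2: "\<forall>\<^sub>F \<tau> in nhds 0. \<forall>\<epsilon>. \<bar>\<epsilon>\<bar> \<le> 1 \<longrightarrow>
      \<bar>flow (Suc D) aug_sum \<tau> (x(D := \<epsilon>)) i - (\<Sum>k<n. \<epsilon> ^ k * R2 k \<tau>)\<bar> \<le> C2 * \<bar>\<epsilon>\<bar> ^ n"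
    by auto
  have "\<forall>\<^sub>F \<tau> in nhds 0. \<forall>\<epsilon>. \<bar>\<epsilon>\<bar> \<le> 1 \<longrightarrow>
      \<bar>err ps x \<epsilon> \<tau> i - (\<Sum>k<n. \<epsilon> ^ k * (R1 k \<tau> - R2 k \<tau>))\<bar> \<le> (C1 + C2) * \<bar>\<epsilon>\<bar> ^ n"
    using R1 R2 run_project[OF x, of ps] whole_project[OF x]
  proof eventually_elim
    case (elim \<tau>)
    show ?case
    proof (intro allI impI)
      fix \<epsilon> :: real assume \<epsilon>: "\<bar>\<epsilon>\<bar> \<le> 1"
      have "\<bar>run (\<lambda>l. flow (Suc D) (aug l)) ps \<tau> (x(D := \<epsilon>)) i - (\<Sum>k<n. \<epsilon> ^ k * R1 k \<tau>)\<bar> \<le> C1 * \<bar>\<epsilon>\<bar> ^ n"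
        "\<bar>flow (Suc D) aug_sum \<tau> (x(D := \<epsilon>)) i - (\<Sum>k<n. \<epsilon> ^ k * R2 k \<tau>)\<bar> \<le> C2 * \<bar>\<epsilon>\<bar> ^ n"
        "run (\<lambda>l. flow D (part \<epsilon> l)) ps \<tau> x i = run (\<lambda>l. flow (Suc D) (aug l)) ps \<tau> (x(D := \<epsilon>)) i"
        "flow D (whole \<epsilon>) \<tau> x i = flow (Suc D) aug_sum \<tau> (x(D := \<epsilon>)) i"
        using elim \<epsilon> i by blast+
      then show "\<bar>err ps x \<epsilon> \<tau> i - (\<Sum>k<n. \<epsilon> ^ k * (R1 k \<tau> - R2 k \<tau>))\<bar> \<le> (C1 + C2) * \<bar>\<epsilon>\<bar> ^ n"
        unfolding err_def right_diff_distrib sum_subtractf distrib_right by linarith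
    qed
  qed
  then show ?thesis by (intro exI)
qed

text \<open>The second field is linear in the coordinate that holds \<epsilon>, and neither field
  has a component in that direction, so no derivative ever hits \<epsilon>. Each second letter thus
  contributes exactly one factor \<epsilon>.\<close>

lemma lie_word_homogeneous:
  assumes "x \<in> space_R D" "i < D"
  shows "lie_word (Suc D) aug w (\<lambda>y. y i) (x(D := \<epsilon>)) = \<epsilon> ^ nB w * lie_word (Suc D) aug w (\<lambda>y. y i) (x(D := 1))"
  using assms(1)
proof (induction w arbitrary: x)
  case Nil
  then show ?case using assms(2) by simp
next
  case (Cons l w)
  define h where "h = lie_word (Suc D) aug w (\<lambda>y. y i)"
  have h: "smooth (Suc D) h" unfolding h_def by (rule lie_word_smooth[OF smooth_coord])
  have sp: "x(D := \<epsilon>) \<in> space_R (Suc D)" for \<epsilon> using Cons.prems by (auto simp: space_R_def)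
  have "partial_deriv j h (x(D := \<epsilon>)) = \<epsilon> ^ nB w * partial_deriv j h (x(D := 1))" if j: "j < D" for j
  proof -
    have tw: "(x(D := \<epsilon>))(j := t) = (x(j := t))(D := \<epsilon>)" for \<epsilon> t
      using j by (intro fun_upd_twist) auto
    have "((\<lambda>t. h ((x(D := 1))(j := t))) has_real_derivative partial_deriv j h (x(D := 1))) (at (x j))"
      using smooth_partial_at[OF h _ sp, of j 1] j by simp
    from DERIV_cmult[OF this, of "\<epsilon> ^ nB w"]
    have "((\<lambda>t. h ((x(D := \<epsilon>))(j := t))) has_real_derivative \<epsilon> ^ nB w * partial_deriv j h (x(D := 1))) (at (x j))"
      unfolding tw h_def using Cons.IH[OF space_R_upd[OF Cons.prems j], symmetric] by (simp only:)
    then show ?thesis unfolding partial_deriv_def[of j h "x(D := \<epsilon>)"] using j DERIV_imp_deriv by simp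
  qed
  then have 1: "lie_word (Suc D) aug (l # w) (\<lambda>y. y i) (x(D := \<epsilon>)) =
      (\<Sum>j<D. \<epsilon> ^ nB w * partial_deriv j h (x(D := 1)) * aug l (x(D := \<epsilon>)) j)"
    by (simp add: lie_def h_def[symmetric] aug_def[of l "x(D := \<epsilon>)"])
  have 2: "aug l (x(D := \<epsilon>)) j = (if l then \<epsilon> else 1) * aug l (x(D := 1)) j" for j
    by (simp add: aug_def)
  have 3: "lie_word (Suc D) aug (l # w) (\<lambda>y. y i) (x(D := 1)) =
      (\<Sum>j<D. partial_deriv j h (x(D := 1)) * aug l (x(D := 1)) j)"
    by (simp add: lie_def h_def[symmetric] aug_def[of l "x(D := 1)"])
  show ?case unfolding 1 2 3 sum_distrib_left
    by (intro sum.cong refl, cases l) (simp_all add: mult_ac)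
qed

text \<open>Words are grouped by length and by number of second letters; homogeneity turns the
  latter into the power of \<epsilon>. A single constant serves all |\<epsilon>| \<le> 1, because
  these initial points lie in one cube.\<close>

lemma err_tau_expansion:
  fixes ps :: "(bool \<times> real) list"
  assumes x: "x \<in> space_R D" and i: "i < D"
  defines "p \<equiv> (\<lambda>n k. \<Sum>w\<in>{w \<in> words n. nB w = k}. (series_prod ps w - 1 / fact (length w)) *
    lie_word (Suc D) aug w (\<lambda>y. y i) (x(D := 1)))"
  shows "\<exists>C. \<forall>\<^sub>F \<tau> in nhds 0. \<forall>\<epsilon>. \<bar>\<epsilon>\<bar> \<le> 1 \<longrightarrow>
    \<bar>err ps x \<epsilon> \<tau> i - (\<Sum>n<N. \<tau> ^ n * (\<Sum>k\<le>n. \<epsilon> ^ k * p n k))\<bar> \<le> C * \<bar>\<tau>\<bar> ^ N"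
proof -
  obtain M where M: "M \<ge> 1" "\<And>n \<epsilon>. D \<le> n \<Longrightarrow> \<bar>\<epsilon>\<bar> \<le> 1 \<Longrightarrow> x(n := \<epsilon>) \<in> cube (Suc n) M"
    by (rule cube_memI[OF x]) blast
  let ?h = "\<lambda>y :: nat \<Rightarrow> real. y i"
  let ?c1 = "\<lambda>n y. lie_coeff (Suc D) aug (series_prod ps) ?h n y"
  let ?c2 = "\<lambda>n y. lie_coeff (Suc D) aug (\<lambda>w. 1 / fact (length w)) ?h n y"
  have "uniform_O (Suc D) M N (\<lambda>\<tau> y. ?h (run (\<lambda>l. flow (Suc D) (aug l)) ps \<tau> y) - (\<Sum>n<N. \<tau> ^ n * ?c1 n y))"
    using represents_run[of ps, unfolded represents_def, THEN conjunct2, rule_format,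
      OF smooth_coord[of "Suc D" i], of M N] M(1) by simp
  then obtain C1 where C1: "\<forall>\<^sub>F \<tau> in nhds 0. \<forall>y\<in>cube (Suc D) M.
      \<bar>run (\<lambda>l. flow (Suc D) (aug l)) ps \<tau> y i - (\<Sum>n<N. \<tau> ^ n * ?c1 n y)\<bar> \<le> C1 * \<bar>\<tau>\<bar> ^ N"
    unfolding uniform_O_def by blast
  have "uniform_O (Suc D) M N (\<lambda>\<tau> y. ?h (flow (Suc D) aug_sum \<tau> y) - (\<Sum>n<N. \<tau> ^ n * ?c2 n y))"
    using represents_exact[unfolded represents_def, THEN conjunct2, rule_format,
      OF smooth_coord[of "Suc D" i], of M N] M(1) by simp
  then obtain C2 where C2: "\<forall>\<^sub>F \<tau> in nhds 0. \<forall>y\<in>cube (Suc D) M.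
      \<bar>flow (Suc D) aug_sum \<tau> y i - (\<Sum>n<N. \<tau> ^ n * ?c2 n y)\<bar> \<le> C2 * \<bar>\<tau>\<bar> ^ N"
    unfolding uniform_O_def by blast
  have coeff: "?c1 n (x(D := \<epsilon>)) - ?c2 n (x(D := \<epsilon>)) = (\<Sum>k\<le>n. \<epsilon> ^ k * p n k)" for n \<epsilon>
  proof -
    define g where "g w = (series_prod ps w - 1 / fact (length w)) * lie_word (Suc D) aug w ?h (x(D := 1))" for w
    have "?c1 n (x(D := \<epsilon>)) - ?c2 n (x(D := \<epsilon>)) = (\<Sum>w\<in>words n. \<epsilon> ^ nB w * g w)"
      unfolding lie_coeff_def sum_subtractf[symmetric] g_def
      by (intro sum.cong refl) (simp add: lie_word_homogeneous[OF x i, of _ \<epsilon>] algebra_simps)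
    also have "\<dots> = (\<Sum>k\<le>n. \<Sum>w\<in>{w \<in> words n. nB w = k}. \<epsilon> ^ nB w * g w)"
      by (rule sum.group[symmetric, OF finite_words finite_atMost]) (auto simp: words_def)
    also have "\<dots> = (\<Sum>k\<le>n. \<epsilon> ^ k * p n k)"
      unfolding p_def g_def sum_distrib_left by (intro sum.cong) auto
    finally show ?thesis .
  qed
  have "\<forall>\<^sub>F \<tau> in nhds 0. \<forall>\<epsilon>. \<bar>\<epsilon>\<bar> \<le> 1 \<longrightarrow>
    \<bar>err ps x \<epsilon> \<tau> i - (\<Sum>n<N. \<tau> ^ n * (\<Sum>k\<le>n. \<epsilon> ^ k * p n k))\<bar> \<le> (C1 + C2) * \<bar>\<tau>\<bar> ^ N"
    using C1 C2 run_project[OF x, of ps] whole_project[OF x]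
  proof eventually_elim
    case (elim \<tau>)
    show ?case
    proof (intro allI impI)
      fix \<epsilon> :: real assume \<epsilon>: "\<bar>\<epsilon>\<bar> \<le> 1"
      have y: "x(D := \<epsilon>) \<in> cube (Suc D) M" using M(2)[of D] \<epsilon> by simp
      have "\<bar>run (\<lambda>l. flow (Suc D) (aug l)) ps \<tau> (x(D := \<epsilon>)) i - (\<Sum>n<N. \<tau> ^ n * ?c1 n (x(D := \<epsilon>)))\<bar> \<le> C1 * \<bar>\<tau>\<bar> ^ N"
        "\<bar>flow (Suc D) aug_sum \<tau> (x(D := \<epsilon>)) i - (\<Sum>n<N. \<tau> ^ n * ?c2 n (x(D := \<epsilon>)))\<bar> \<le> C2 * \<bar>\<tau>\<bar> ^ N"
        using elim(1,2) y by blast+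
      moreover have "run (\<lambda>l. flow D (part \<epsilon> l)) ps \<tau> x i = run (\<lambda>l. flow (Suc D) (aug l)) ps \<tau> (x(D := \<epsilon>)) i"
        "flow D (whole \<epsilon>) \<tau> x i = flow (Suc D) aug_sum \<tau> (x(D := \<epsilon>)) i"
        using elim(3,4) \<epsilon> i by blast+
      ultimately show "\<bar>err ps x \<epsilon> \<tau> i - (\<Sum>n<N. \<tau> ^ n * (\<Sum>k\<le>n. \<epsilon> ^ k * p n k))\<bar> \<le> (C1 + C2) * \<bar>\<tau>\<bar> ^ N"
        unfolding err_def coeff[symmetric] right_diff_distrib sum_subtractf distrib_right by linarith
    qed
  qed
  then show ?thesis by blast
qed

text \<open>For \<epsilon> = 0 the second flow is the identity, and the steps of the first add up by
  the group property.\<close>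

lemma splitting_unperturbed:
  assumes x: "x \<in> space_R D"
  shows "\<forall>\<^sub>F \<tau> in nhds 0. splitting (flow D fA) (flow D (\<lambda>y i. 0 * fB y i)) a b s \<tau> x = flow D fA (c_coeff a (s + 1) * \<tau>) x"
proof -
  obtain M where M: "M \<ge> 1" "x \<in> cube D M" by (rule cube_memI[OF x]) blast
  obtain T where T: "T > 0" "\<And>x. x \<in> cube D M \<Longrightarrow> solves_ode D fA {- T..T} (\<lambda>t. flow D fA t x)"
    by (rule flow_exists[OF fA, of M]) (use M in auto)
  note sol = T(2)[OF M(2)]
  have id: "flow D (\<lambda>y i. 0 * fB y i) t y = y" if "y \<in> space_R D" for t y
  proof -
    have "solves_ode D (\<lambda>y i. 0 * fB y i) (closed_segment 0 t) (\<lambda>_. y)"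
      using that by (auto simp: solves_ode_def)
    from flow_eq[OF smooth_field_scale[OF fB] this] show ?thesis .
  qed
  have main: "splitting (flow D fA) (flow D (\<lambda>y i. 0 * fB y i)) a b s \<tau> x = flow D fA (c_coeff a (s + 1) * \<tau>) x"
    \<comment> \<open>Bounding the sum of the absolute values keeps all intermediate times in the
      interval of existence, also when some of the steps go backwards.\<close>
    if "(\<Sum>j=1..s + 1. \<bar>a j\<bar>) * \<bar>\<tau>\<bar> \<le> T" for \<tau>
    using that
  proof (induction s)
    case 0
    show ?case by (simp add: c_coeff_def)
  next
    case (Suc s)
    have le: "(\<Sum>j=1..s + 1. \<bar>a j\<bar>) * \<bar>\<tau>\<bar> + \<bar>a (s + 2) * \<tau>\<bar> \<le> T"
      using Suc.prems by (simp add: distrib_right abs_mult add.assoc)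
    have "\<bar>c_coeff a (s + 1) * \<tau>\<bar> \<le> (\<Sum>j=1..s + 1. \<bar>a j\<bar>) * \<bar>\<tau>\<bar>"
      unfolding c_coeff_def abs_mult by (intro mult_right_mono sum_abs) auto
    then have st: "\<bar>c_coeff a (s + 1) * \<tau>\<bar> + \<bar>a (s + 2) * \<tau>\<bar> \<le> T" using le by linarith
    have IH: "splitting (flow D fA) (flow D (\<lambda>y i. 0 * fB y i)) a b s \<tau> x = flow D fA (c_coeff a (s + 1) * \<tau>) x"
      by (rule Suc.IH) (use le in linarith)
    have "c_coeff a (s + 1) * \<tau> \<in> {- T..T}" using st by (auto simp: abs_le_iff)
    then have "flow D fA (c_coeff a (s + 1) * \<tau>) x \<in> space_R D" using sol unfolding solves_ode_def by blast
    then have "flow D (\<lambda>y i. 0 * fB y i) (b (s + 1) * \<tau>) (flow D fA (c_coeff a (s + 1) * \<tau>) x) =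
        flow D fA (c_coeff a (s + 1) * \<tau>) x" by (rule id)
    then have "splitting (flow D fA) (flow D (\<lambda>y i. 0 * fB y i)) a b (Suc s) \<tau> x =
        flow D fA (a (s + 2) * \<tau>) (flow D fA (c_coeff a (s + 1) * \<tau>) x)"
      by (simp only: splitting.simps o_apply IH)
    also have "\<dots> = flow D fA (c_coeff a (s + 1) * \<tau> + a (s + 2) * \<tau>) x"
      by (rule flow_group[OF fA sol st])
    also have "c_coeff a (s + 1) * \<tau> + a (s + 2) * \<tau> = c_coeff a (Suc s + 1) * \<tau>"
      by (simp add: c_coeff_def algebra_simps)
    finally show ?case .
  qed
  have "\<forall>\<^sub>F \<tau> in nhds 0. \<bar>(\<Sum>j=1..s + 1. \<bar>a j\<bar>) * \<tau>\<bar> \<le> T"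
    by (rule eventually_nhds_0_scale[OF eventually_abs_le[OF T(1)]])
  then show ?thesis
  proof eventually_elim
    case (elim \<tau>)
    show ?case by (rule main) (use elim in \<open>simp add: abs_mult sum_nonneg abs_of_nonneg\<close>)
  qed
qed

theorem generalized_order_sufficient:
  assumes c: "c_coeff a (s + 1) = 1"
    and \<gamma>: "\<And>w. 1 \<le> nB w \<Longrightarrow> nB w \<le> m \<Longrightarrow> length w \<le> r (nB w) \<Longrightarrow>
      series_prod (splitting_steps a b s) w = 1 / fact (length w)"
  shows "has_generalized_order D fA fB
    (\<lambda>\<epsilon>. splitting (flow D fA) (flow D (\<lambda>y i. \<epsilon> * fB y i)) a b s) m r"
  unfolding has_generalized_order_def
proof
  fix x assume x: "x \<in> space_R D"
  define E where "E \<epsilon> \<tau> i = splitting (flow D fA) (flow D (\<lambda>y i. \<epsilon> * fB y i)) a b s \<tau> x i -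
      flow D (\<lambda>y i. fA y i + \<epsilon> * fB y i) \<tau> x i" for \<epsilon> \<tau> i
  let ?ps = "splitting_steps a b s"
  have E: "E \<epsilon> \<tau> i = err ?ps x \<epsilon> \<tau> i" for \<epsilon> \<tau> i
    unfolding E_def err_def whole_def splitting_eq_run[of "\<lambda>l. flow D (part \<epsilon> l)", symmetric]
    by (simp add: part_def)
  have E0: "\<forall>\<^sub>F \<tau> in nhds 0. \<forall>i. E 0 \<tau> i = 0"
    using splitting_unperturbed[OF x, of a b s]
    by (rule eventually_mono) (use c in \<open>simp add: E_def\<close>)
  have "\<forall>i. \<exists>R C. i < D \<longrightarrow> (\<forall>\<^sub>F \<tau> in nhds 0. \<forall>\<epsilon>. \<bar>\<epsilon>\<bar> \<le> 1 \<longrightarrow>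
      \<bar>E \<epsilon> \<tau> i - (\<Sum>k<Suc m. \<epsilon> ^ k * R k \<tau>)\<bar> \<le> C * \<bar>\<epsilon>\<bar> ^ Suc m)"
    unfolding E using err_eps_expansion[OF x] by blast
  from choice[OF this] obtain R where "\<forall>i. \<exists>C. i < D \<longrightarrow> (\<forall>\<^sub>F \<tau> in nhds 0. \<forall>\<epsilon>. \<bar>\<epsilon>\<bar> \<le> 1 \<longrightarrow>
      \<bar>E \<epsilon> \<tau> i - (\<Sum>k<Suc m. \<epsilon> ^ k * R i k \<tau>)\<bar> \<le> C * \<bar>\<epsilon>\<bar> ^ Suc m)" by blast
  from choice[OF this] obtain C where R: "\<And>i. i < D \<Longrightarrow> \<forall>\<^sub>F \<tau> in nhds 0. \<forall>\<epsilon>. \<bar>\<epsilon>\<bar> \<le> 1 \<longrightarrow>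
      \<bar>E \<epsilon> \<tau> i - (\<Sum>k<Suc m. \<epsilon> ^ k * R i k \<tau>)\<bar> \<le> C i * \<bar>\<epsilon>\<bar> ^ Suc m"
    by blast
  have Rk: "\<exists>C. \<forall>\<^sub>F \<tau> in at 0. \<bar>R i k \<tau>\<bar> \<le> C * \<bar>\<tau>\<bar> ^ (r k + 1)" if i: "i < D" and k: "1 \<le> k" "k \<le> m" for i k
  proof -
    define p where "p n k = (\<Sum>w\<in>{w \<in> words n. nB w = k}. (series_prod ?ps w - 1 / fact (length w)) *
      lie_word (Suc D) aug w (\<lambda>y. y i) (x(D := 1)))" for n k
    show ?thesis
    proof (rule eps_coefficient_expansion[OF R[OF i], where p = p])
      show "\<exists>C. \<forall>\<^sub>F \<tau> in nhds 0. \<forall>\<epsilon>. \<bar>\<epsilon>\<bar> \<le> 1 \<longrightarrow>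
          \<bar>E \<epsilon> \<tau> i - (\<Sum>n<N. \<tau> ^ n * (\<Sum>k\<le>n. \<epsilon> ^ k * p n k))\<bar> \<le> C * \<bar>\<tau>\<bar> ^ N" for N
        unfolding E p_def by (rule err_tau_expansion[OF x i])
      show "p n k = 0" if "n < k" for n k
      proof -
        have empty: "{w \<in> words n. nB w = k} = {}"
          using that by (auto simp: words_def dest: order_le_less_trans[OF length_filter_le])
        show ?thesis unfolding p_def empty by simp
      qed
      show "p n k = 0" if "n < r k + 1" for n
        unfolding p_def by (rule sum.neutral) (use \<gamma> k that in \<open>auto simp: words_def\<close>)
    qed (use k in simp)
  qed
  have "error_expansion D m r E"
    unfolding error_expansion_def
  proof (intro exI conjI ballI)
    fix k assume "k \<in> {1..m}"
    then have k: "1 \<le> k" "k \<le> m" by auto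
    have "\<forall>i. \<exists>C. i < D \<longrightarrow> (\<forall>\<^sub>F \<tau> in at 0. \<bar>R i k \<tau>\<bar> \<le> C * \<bar>\<tau>\<bar> ^ (r k + 1))"
      using Rk k by blast
    from choice[OF this] obtain C' where C': "\<And>i. i < D \<Longrightarrow> \<forall>\<^sub>F \<tau> in at 0. \<bar>R i k \<tau>\<bar> \<le> C' i * \<bar>\<tau>\<bar> ^ (r k + 1)"
      by blast
    then have "\<forall>\<^sub>F \<tau> in at 0. \<forall>i\<in>{..<D}. \<bar>R i k \<tau>\<bar> \<le> C' i * \<bar>\<tau>\<bar> ^ (r k + 1)"
      by (intro eventually_ball_finite) auto
    then have "\<forall>\<^sub>F \<tau> in at 0. norm (norm_R D (\<lambda>i. R i k \<tau>)) \<le> (\<Sum>i<D. C' i) * norm (\<tau> ^ (r k + 1))"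
    proof eventually_elim
      case (elim \<tau>)
      have "norm_R D (\<lambda>i. R i k \<tau>) \<le> (\<Sum>i<D. \<bar>R i k \<tau>\<bar>)"
        unfolding norm_R_def by (rule L2_set_le_sum_abs)
      also have "\<dots> \<le> (\<Sum>i<D. C' i * \<bar>\<tau>\<bar> ^ (r k + 1))" by (rule sum_mono) (use elim in auto)
      finally show ?case by (simp add: norm_R_def sum_distrib_right power_abs abs_mult)
    qed
    then show "(\<lambda>\<tau>. norm_R D (\<lambda>i. R i k \<tau>)) \<in> O[at 0](\<lambda>\<tau>. \<tau> ^ (r k + 1))" by (rule bigoI)
  next
    have "\<forall>\<^sub>F \<tau> in nhds 0. \<forall>i\<in>{..<D}. \<forall>\<epsilon>. \<bar>\<epsilon>\<bar> \<le> 1 \<longrightarrow>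
      \<bar>E \<epsilon> \<tau> i - (\<Sum>k<Suc m. \<epsilon> ^ k * R i k \<tau>)\<bar> \<le> C i * \<bar>\<epsilon>\<bar> ^ Suc m"
      using R by (intro eventually_ball_finite) auto
    then have "\<forall>\<^sub>F \<tau> in nhds 0. \<forall>\<epsilon>. \<bar>\<epsilon>\<bar> \<le> 1 \<longrightarrow>
        norm_R D (\<lambda>i. E \<epsilon> \<tau> i - (\<Sum>k=1..m. \<epsilon> ^ k * R i k \<tau>)) \<le> (\<Sum>i<D. C i) * \<bar>\<epsilon>\<bar> ^ (m + 1)"
      using E0
    proof eventually_elim
      case (elim \<tau>)
      show ?case
      proof (intro allI impI)
        fix \<epsilon> :: real assume \<epsilon>: "\<bar>\<epsilon>\<bar> \<le> 1"
        have bound: "\<bar>E \<epsilon> \<tau> i - (\<Sum>k=1..m. \<epsilon> ^ k * R i k \<tau>)\<bar> \<le> C i * \<bar>\<epsilon>\<bar> ^ (m + 1)" if i: "i < D" for i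
        proof -
          \<comment> \<open>At \<epsilon> = 0 the remainder bound is 0, which identifies the
            coefficient of \<epsilon>^0 with the unperturbed error. That error is 0 by consistency,
            so the expansion starts at k = 1 as required.\<close>
          have "\<bar>E 0 \<tau> i - (\<Sum>k<Suc m. 0 ^ k * R i k \<tau>)\<bar> \<le> C i * \<bar>0\<bar> ^ Suc m"
            using elim(1) i by (metis abs_zero lessThan_iff zero_le_one)
          then have "R i 0 \<tau> = 0"
            using elim(2) unfolding sum.lessThan_Suc_shift by simp
          then have "(\<Sum>k<Suc m. \<epsilon> ^ k * R i k \<tau>) = (\<Sum>k=1..m. \<epsilon> ^ k * R i k \<tau>)"
            unfolding lessThan_Suc_atMost atMost_atLeast0 by (simp add: sum.atLeast_Suc_atMost)
          then show ?thesis using elim(1) i \<epsilon> by (metis Suc_eq_plus1 lessThan_iff)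
        qed
        have "norm_R D (\<lambda>i. E \<epsilon> \<tau> i - (\<Sum>k=1..m. \<epsilon> ^ k * R i k \<tau>)) \<le>
            (\<Sum>i<D. \<bar>E \<epsilon> \<tau> i - (\<Sum>k=1..m. \<epsilon> ^ k * R i k \<tau>)\<bar>)"
          unfolding norm_R_def by (rule L2_set_le_sum_abs)
        also have "\<dots> \<le> (\<Sum>i<D. C i * \<bar>\<epsilon>\<bar> ^ (m + 1))" by (rule sum_mono) (use bound in auto)
        finally show "norm_R D (\<lambda>i. E \<epsilon> \<tau> i - (\<Sum>k=1..m. \<epsilon> ^ k * R i k \<tau>)) \<le> (\<Sum>i<D. C i) * \<bar>\<epsilon>\<bar> ^ (m + 1)"
          by (simp add: sum_distrib_right)
      qed
    qed
    from eventually_prodI[OF this eventually_abs_le[OF zero_less_one]]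
    have "\<forall>\<^sub>F p in nhds (0, 0). norm_R D (\<lambda>i. E (snd p) (fst p) i - (\<Sum>k=1..m. snd p ^ k * R i k (fst p))) \<le>
        (\<Sum>i<D. C i) * \<bar>snd p\<bar> ^ (m + 1)"
      unfolding nhds_prod[symmetric] by (rule eventually_mono) auto
    then have "\<forall>\<^sub>F p in at (0, 0). norm (norm_R D (\<lambda>i. E (snd p) (fst p) i - (\<Sum>k=1..m. snd p ^ k * R i k (fst p)))) \<le>
        (\<Sum>i<D. C i) * norm (snd p ^ (m + 1))"
      unfolding eventually_at_filter
      by (rule eventually_mono) (simp add: norm_R_def power_abs abs_mult)
    then show "(\<lambda>(\<tau>, \<epsilon>). norm_R D (\<lambda>i. E \<epsilon> \<tau> i - (\<Sum>k=1..m. \<epsilon> ^ k * R i k \<tau>))) \<in> O[at (0, 0)](\<lambda>(\<tau>, \<epsilon>). \<epsilon> ^ (m + 1))"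
      unfolding split_beta by (rule bigoI)
  qed
  then show "error_expansion D m r (\<lambda>\<epsilon> \<tau> i. splitting (flow D fA) (flow D (\<lambda>y i. \<epsilon> * fB y i)) a b s \<tau> x i -
      flow D (\<lambda>y i. fA y i + \<epsilon> * fB y i) \<tau> x i)"
    by (simp only: E_def[abs_def])
qed

end

section \<open>Necessity of the conditions\<close>

lemma abs_le_norm_R: "i < D \<Longrightarrow> \<bar>x i\<bar> \<le> norm_R D x"
proof -
  assume i: "i < D"
  have "\<bar>x i\<bar> = sqrt ((x i)\<^sup>2)" by simp
  also have "\<dots> \<le> norm_R D x"
    unfolding norm_R_def L2_set_def
    by (intro real_sqrt_le_mono member_le_sum[of i "{..<D}" "\<lambda>i. (x i)\<^sup>2"]) (use i in auto)
  finally show ?thesis .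
qed

lemma error_expansion_components:
  assumes "error_expansion D m r err"
  obtains R C d where "d > 0" "\<And>\<tau> \<epsilon> i. 0 < \<bar>\<tau>\<bar> \<Longrightarrow> \<bar>\<tau>\<bar> < d \<Longrightarrow> \<bar>\<epsilon>\<bar> < d \<Longrightarrow> i < D \<Longrightarrow>
      \<bar>err \<epsilon> \<tau> i - (\<Sum>k=1..m. \<epsilon> ^ k * R k \<tau> i)\<bar> \<le> C * \<bar>\<epsilon>\<bar> ^ (m + 1)"
    "\<And>k \<tau> i. k \<in> {1..m} \<Longrightarrow> 0 < \<bar>\<tau>\<bar> \<Longrightarrow> \<bar>\<tau>\<bar> < d \<Longrightarrow> i < D \<Longrightarrow> \<bar>R k \<tau> i\<bar> \<le> C * \<bar>\<tau>\<bar> ^ (r k + 1)"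
proof -
  obtain R where R: "\<forall>k\<in>{1..m}. (\<lambda>\<tau>. norm_R D (R k \<tau>)) \<in> O[at 0](\<lambda>\<tau>. \<tau> ^ (r k + 1))"
    and err: "(\<lambda>(\<tau>, \<epsilon>). norm_R D (\<lambda>i. err \<epsilon> \<tau> i - (\<Sum>k=1..m. \<epsilon> ^ k * R k \<tau> i))) \<in> O[at (0, 0)](\<lambda>(\<tau>, \<epsilon>). \<epsilon> ^ (m + 1))"
    using assms unfolding error_expansion_def by blast
  have "(\<lambda>p. norm_R D (\<lambda>i. err (snd p) (fst p) i - (\<Sum>k=1..m. snd p ^ k * R k (fst p) i)))
      \<in> O[at (0, 0)](\<lambda>p. snd p ^ (m + 1))"
    using err unfolding case_prod_unfold .
  then obtain C0 where "\<forall>\<^sub>F p in at (0, 0). norm (norm_R D (\<lambda>i. err (snd p) (fst p) i - (\<Sum>k=1..m. snd p ^ k * R k (fst p) i))) \<le>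
      C0 * norm (snd p ^ (m + 1))"
    by (elim landau_o.bigE) blast
  then obtain d0 where d0: "d0 > 0" "\<And>p. p \<noteq> (0, 0) \<Longrightarrow> dist p (0, 0) < d0 \<Longrightarrow>
      norm (norm_R D (\<lambda>i. err (snd p) (fst p) i - (\<Sum>k=1..m. snd p ^ k * R k (fst p) i))) \<le> C0 * norm (snd p ^ (m + 1))"
    unfolding eventually_at by blast
  have "\<forall>k. \<exists>C. k \<in> {1..m} \<longrightarrow> (\<forall>\<^sub>F \<tau> in at 0. norm (norm_R D (R k \<tau>)) \<le> C * norm (\<tau> ^ (r k + 1)))"
    using R landau_o.bigE by metis
  from choice[OF this] obtain Ck where
    "\<And>k. k \<in> {1..m} \<Longrightarrow> \<forall>\<^sub>F \<tau> in at 0. norm (norm_R D (R k \<tau>)) \<le> Ck k * norm (\<tau> ^ (r k + 1))" by blast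
  then have "\<forall>\<^sub>F \<tau> in at 0. \<forall>k\<in>{1..m}. norm (norm_R D (R k \<tau>)) \<le> Ck k * norm (\<tau> ^ (r k + 1))"
    by (intro eventually_ball_finite) auto
  then obtain d1 where d1: "d1 > 0" "\<And>\<tau> k. \<tau> \<noteq> 0 \<Longrightarrow> dist \<tau> 0 < d1 \<Longrightarrow> k \<in> {1..m} \<Longrightarrow>
      norm (norm_R D (R k \<tau>)) \<le> Ck k * norm (\<tau> ^ (r k + 1))"
    unfolding eventually_at by blast
  define C where "C = \<bar>C0\<bar> + (\<Sum>k=1..m. \<bar>Ck k\<bar>)"
  show ?thesis
  proof (rule that)
    \<comment> \<open>The distance of a pair from the origin is at most |\<tau>| + |\<epsilon>|,
      hence the half.\<close>
    show "min (d0 / 2) d1 > 0" using d0 d1 by simp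
    fix \<tau> \<epsilon> :: real and i
    assume *: "0 < \<bar>\<tau>\<bar>" "\<bar>\<tau>\<bar> < min (d0 / 2) d1" "\<bar>\<epsilon>\<bar> < min (d0 / 2) d1" "i < D"
    have "dist (\<tau>, \<epsilon>) (0, 0) \<le> \<bar>\<tau>\<bar> + \<bar>\<epsilon>\<bar>"
      using norm_Pair_le[of \<tau> \<epsilon>] by (simp add: dist_norm)
    then have "dist (\<tau>, \<epsilon>) (0, 0) < d0" using * by simp
    moreover have "(\<tau>, \<epsilon>) \<noteq> (0, 0)" using * by auto
    ultimately have "norm (norm_R D (\<lambda>i. err \<epsilon> \<tau> i - (\<Sum>k=1..m. \<epsilon> ^ k * R k \<tau> i))) \<le> C0 * norm (\<epsilon> ^ (m + 1))"
      using d0(2)[of "(\<tau>, \<epsilon>)"] by simp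
    then have "norm_R D (\<lambda>i. err \<epsilon> \<tau> i - (\<Sum>k=1..m. \<epsilon> ^ k * R k \<tau> i)) \<le> C0 * \<bar>\<epsilon>\<bar> ^ (m + 1)"
      by (simp add: power_abs norm_R_def abs_mult)
    also have "\<dots> \<le> C * \<bar>\<epsilon>\<bar> ^ (m + 1)"
      unfolding C_def by (intro mult_right_mono) (auto intro: order_trans[OF abs_ge_self] sum_nonneg)
    finally show "\<bar>err \<epsilon> \<tau> i - (\<Sum>k=1..m. \<epsilon> ^ k * R k \<tau> i)\<bar> \<le> C * \<bar>\<epsilon>\<bar> ^ (m + 1)"
      using abs_le_norm_R[OF *(4), of "\<lambda>i. err \<epsilon> \<tau> i - (\<Sum>k=1..m. \<epsilon> ^ k * R k \<tau> i)"] by linarith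
  next
    fix k \<tau> i assume *: "k \<in> {1..m}" "0 < \<bar>\<tau>\<bar>" "\<bar>\<tau>\<bar> < min (d0 / 2) d1" "i < D"
    then have "norm (norm_R D (R k \<tau>)) \<le> Ck k * norm (\<tau> ^ (r k + 1))"
      by (intro d1(2)) (auto simp: dist_real_def)
    then have "norm_R D (R k \<tau>) \<le> Ck k * \<bar>\<tau>\<bar> ^ (r k + 1)" by (simp add: power_abs norm_R_def abs_mult)
    also have "\<dots> \<le> C * \<bar>\<tau>\<bar> ^ (r k + 1)"
    proof (rule mult_right_mono)
      have "\<bar>Ck k\<bar> \<le> (\<Sum>k=1..m. \<bar>Ck k\<bar>)" by (rule member_le_sum[OF *(1)]) auto
      then show "Ck k \<le> C" unfolding C_def by linarith
    qed simp
    finally show "\<bar>R k \<tau> i\<bar> \<le> C * \<bar>\<tau>\<bar> ^ (r k + 1)" using abs_le_norm_R[OF *(4), of "R k \<tau>"] by linarith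
  qed
qed

text \<open>A polynomial of degree at most m that is O(\<epsilon>^(m+1)) vanishes. It is sampled at
  the points j h, and the coefficient bound gives |A_k| \<le> K h for every small h.\<close>

lemma small_polynomial_zero:
  assumes d: "d > 0" and le: "\<And>\<epsilon>. \<bar>\<epsilon>\<bar> < d \<Longrightarrow> \<bar>\<Sum>l\<le>m. A l * \<epsilon> ^ l\<bar> \<le> C * \<bar>\<epsilon>\<bar> ^ (m + 1)" and k: "k \<le> m"
  shows "A k = (0 :: real)"
proof (rule ccontr)
  assume "A k \<noteq> 0"
  obtain V where V: "V \<ge> 0" "\<And>a B k. (\<And>j. j \<le> m \<Longrightarrow> \<bar>\<Sum>k\<le>m. a k * real j ^ k\<bar> \<le> B) \<Longrightarrow> k \<le> m \<Longrightarrow> \<bar>a k\<bar> \<le> V * B"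
    by (rule power_sum_coeff_bound[of m]) blast
  define K where "K = V * (\<bar>C\<bar> * real (m + 1) ^ (m + 1))"
  have K: "K \<ge> 0" unfolding K_def using V(1) by simp
  \<comment> \<open>The second term keeps j h below \<open>d\<close> for all j \<le> m, and the
    third makes K h at most |A_k| / 2.\<close>
  define h where "h = min 1 (min (d / (2 * real (m + 1))) (\<bar>A k\<bar> / (2 * (K + 1))))"
  have "d / (2 * real (m + 1)) > 0" "\<bar>A k\<bar> / (2 * (K + 1)) > 0" using d K \<open>A k \<noteq> 0\<close> by simp_all
  then have h: "h > 0" "h \<le> 1" "h \<le> d / (2 * real (m + 1))" "h \<le> \<bar>A k\<bar> / (2 * (K + 1))"
    unfolding h_def by simp_all
  have "\<bar>A k * h ^ k\<bar> \<le> V * (\<bar>C\<bar> * (real (m + 1) * h) ^ (m + 1))"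
  proof (rule V(2)[OF _ k])
    fix j assume j: "j \<le> m"
    have jh: "real j * h \<le> real (m + 1) * h" using j h by (intro mult_right_mono) auto
    have "x * (d / (2 * x)) = d / 2" if "x \<noteq> 0" for x :: real using that by simp
    from this[of "real (m + 1)"] have "real (m + 1) * (d / (2 * real (m + 1))) = d / 2" by simp
    then have "real (m + 1) * h \<le> d / 2"
      using mult_left_mono[OF h(3), of "real (m + 1)"] by linarith
    moreover have "\<bar>real j * h\<bar> = real j * h" using h by simp
    ultimately have "\<bar>real j * h\<bar> < d" using jh d by linarith
    from le[OF this] have "\<bar>\<Sum>l\<le>m. A l * (real j * h) ^ l\<bar> \<le> C * \<bar>real j * h\<bar> ^ (m + 1)" .
    also have "\<dots> \<le> \<bar>C\<bar> * (real (m + 1) * h) ^ (m + 1)"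
      using jh h by (intro mult_mono power_mono) auto
    finally show "\<bar>\<Sum>l\<le>m. A l * h ^ l * real j ^ l\<bar> \<le> \<bar>C\<bar> * (real (m + 1) * h) ^ (m + 1)"
      by (simp add: power_mult_distrib mult_ac)
  qed
  also have "V * (\<bar>C\<bar> * (real (m + 1) * h) ^ (m + 1)) = K * h ^ (m + 1)"
    unfolding K_def power_mult_distrib by (simp only: mult_ac)
  also have "h ^ (m + 1) = h ^ (m + 1 - k) * h ^ k"
    unfolding power_add[symmetric] using k by simp
  finally have "\<bar>A k\<bar> * h ^ k \<le> (K * h ^ (m + 1 - k)) * h ^ k"
    using h by (simp add: abs_mult mult.assoc)
  then have "\<bar>A k\<bar> \<le> K * h ^ (m + 1 - k)" using h by (simp add: mult_le_cancel_right)
  also have "\<dots> \<le> K * h"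
  proof -
    have "h ^ (m + 1 - k) \<le> h ^ 1" using h k by (intro power_decreasing) auto
    then show ?thesis using K by (intro mult_left_mono) auto
  qed
  also have "\<dots> \<le> (K + 1) * (\<bar>A k\<bar> / (2 * (K + 1)))" using h K by (intro mult_mono) auto
  also have "\<dots> = \<bar>A k\<bar> / 2" using K by (simp add: field_simps)
  finally show False using \<open>A k \<noteq> 0\<close> by simp
qed

text \<open>For fixed \<tau> the coefficients in \<epsilon> up to order m are unique, so R_k equals
  \<tau>^n \<delta>. This is O(\<tau>^(r_k + 1)) with n \<le> r_k only for \<delta> = 0.\<close>

lemma error_expansion_monomial:
  assumes exp: "error_expansion D m r err" and i: "i < D" and k: "1 \<le> k" "k \<le> m" and n: "n \<le> r k"
    and err: "\<And>\<epsilon> \<tau>. \<tau> \<noteq> 0 \<Longrightarrow> err \<epsilon> \<tau> i = \<epsilon> ^ k * \<tau> ^ n * \<delta>"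
  shows "\<delta> = 0"
proof (rule ccontr)
  assume \<delta>: "\<delta> \<noteq> 0"
  obtain R C d where d: "d > 0" and E: "\<And>\<tau> \<epsilon> i. 0 < \<bar>\<tau>\<bar> \<Longrightarrow> \<bar>\<tau>\<bar> < d \<Longrightarrow> \<bar>\<epsilon>\<bar> < d \<Longrightarrow> i < D \<Longrightarrow>
      \<bar>err \<epsilon> \<tau> i - (\<Sum>k=1..m. \<epsilon> ^ k * R k \<tau> i)\<bar> \<le> C * \<bar>\<epsilon>\<bar> ^ (m + 1)"
    and R: "\<And>k \<tau> i. k \<in> {1..m} \<Longrightarrow> 0 < \<bar>\<tau>\<bar> \<Longrightarrow> \<bar>\<tau>\<bar> < d \<Longrightarrow> i < D \<Longrightarrow> \<bar>R k \<tau> i\<bar> \<le> C * \<bar>\<tau>\<bar> ^ (r k + 1)"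
    by (rule error_expansion_components[OF exp]) blast
  have Rk: "R k \<tau> i = \<tau> ^ n * \<delta>" if \<tau>: "0 < \<bar>\<tau>\<bar>" "\<bar>\<tau>\<bar> < d" for \<tau>
  proof -
    define A where "A l = (if l = 0 then 0 else (if l = k then \<tau> ^ n * \<delta> else 0) - R l \<tau> i)" for l
    have "A k = 0"
    proof (rule small_polynomial_zero[OF d _ k(2)])
      fix \<epsilon> :: real assume "\<bar>\<epsilon>\<bar> < d"
      have "(\<Sum>l\<le>m. A l * \<epsilon> ^ l) = (\<Sum>l=1..m. \<epsilon> ^ l * ((if l = k then \<tau> ^ n * \<delta> else 0) - R l \<tau> i))"
        unfolding atMost_atLeast0 by (simp add: sum.atLeast_Suc_atMost A_def mult.commute)
      also have "\<dots> = (\<Sum>l=1..m. if l = k then \<epsilon> ^ l * (\<tau> ^ n * \<delta>) else 0) - (\<Sum>l=1..m. \<epsilon> ^ l * R l \<tau> i)"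
        unfolding sum_subtractf[symmetric] by (intro sum.cong) (auto simp: right_diff_distrib)
      also have "(\<Sum>l=1..m. if l = k then \<epsilon> ^ l * (\<tau> ^ n * \<delta>) else 0) = err \<epsilon> \<tau> i"
        using err[of \<tau> \<epsilon>] \<tau> k by simp
      finally show "\<bar>\<Sum>l\<le>m. A l * \<epsilon> ^ l\<bar> \<le> C * \<bar>\<epsilon>\<bar> ^ (m + 1)"
        using E[OF \<tau> \<open>\<bar>\<epsilon>\<bar> < d\<close> i] by simp
    qed
    then show ?thesis using k by (simp add: A_def)
  qed
  define \<tau> where "\<tau> = min 1 (min (d / 2) (\<bar>\<delta>\<bar> / (2 * (\<bar>C\<bar> + 1))))"
  have "\<bar>\<delta>\<bar> / (2 * (\<bar>C\<bar> + 1)) > 0" using \<delta> by simp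
  then have \<tau>: "\<tau> > 0" "\<tau> \<le> 1" "\<tau> < d" "\<tau> \<le> \<bar>\<delta>\<bar> / (2 * (\<bar>C\<bar> + 1))"
    using d unfolding \<tau>_def by (simp_all only: min_less_iff_disj min_less_iff_conj min.cobounded1
      min.coboundedI2[OF min.cobounded2]) auto
  have "\<bar>R k \<tau> i\<bar> \<le> C * \<bar>\<tau>\<bar> ^ (r k + 1)" by (rule R) (use \<tau> k i in auto)
  then have "\<bar>\<delta>\<bar> * \<tau> ^ n \<le> C * \<tau> ^ (r k + 1)" using Rk[of \<tau>] \<tau> by (simp add: abs_mult mult.commute)
  also have "\<tau> ^ (r k + 1) = \<tau> ^ (r k + 1 - n) * \<tau> ^ n" unfolding power_add[symmetric] using n by simp
  finally have "\<bar>\<delta>\<bar> \<le> C * \<tau> ^ (r k + 1 - n)" using \<tau> by (simp add: mult.assoc[symmetric] mult_le_cancel_right)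
  also have "\<dots> \<le> \<bar>C\<bar> * \<tau>"
  proof -
    have "\<tau> ^ (r k + 1 - n) \<le> \<tau> ^ 1" using \<tau> n by (intro power_decreasing) auto
    then show ?thesis using \<tau> by (intro mult_mono) auto
  qed
  also have "\<dots> \<le> (\<bar>C\<bar> + 1) * (\<bar>\<delta>\<bar> / (2 * (\<bar>C\<bar> + 1)))" using \<tau> by (intro mult_mono) auto
  also have "\<dots> = \<bar>\<delta>\<bar> / 2" by (simp add: field_simps)
  finally show False using \<delta> by simp
qed

text \<open>The test system for \<open>(j\<^sub>1, \<dots>, j\<^sub>k)\<close>: coordinate \<open>0\<close> is the time, advanced by the first
  part, and \<open>z\<^sub>l' = t^(j\<^sub>l - 1) z\<^sub>l\<^sub>-\<^sub>1\<close> with \<open>z\<^sub>0 = 1\<close> is the second part. From the initial value \<open>0\<close>,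
  the last coordinate collects the two sides of the order condition.\<close>

locale test_system =
  fixes js :: "nat list"
  assumes pos: "\<forall>j\<in>set js. 1 \<le> j"
begin

definition tA :: "(nat \<Rightarrow> real) \<Rightarrow> nat \<Rightarrow> real" where
  "tA y = (\<lambda>i. if i = 0 then 1 else 0)"

definition tB :: "(nat \<Rightarrow> real) \<Rightarrow> nat \<Rightarrow> real" where
  "tB y = (\<lambda>i. if 1 \<le> i \<and> i \<le> length js then y 0 ^ (js ! (i - 1) - 1) * (if i = 1 then 1 else y (i - 1)) else 0)"

text \<open>The ansatz that all solutions of the test system follow. Here \<tau> is the fixed step
  size as a scale, \<open>t\<close> the current value of the time coordinate, and \<open>f\<close>
  holds the value reached for each prefix of \<open>js\<close>: a stage of \<open>alpha\<close> for
  the method, \<open>beta\<close> for the exact flow.\<close>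

definition state :: "real \<Rightarrow> real \<Rightarrow> real \<Rightarrow> (nat list \<Rightarrow> real) \<Rightarrow> nat \<Rightarrow> real" where
  "state \<epsilon> \<tau> t f = (\<lambda>i. if i = 0 then t else if i \<le> length js then
     \<epsilon> ^ i * \<tau> ^ sum_list (take i js) * f (take i js) else 0)"

abbreviation test_dim :: nat where "test_dim \<equiv> Suc (length js)"

lemma tA_smooth_field: "smooth_field test_dim tA"
  unfolding smooth_field_iff tA_def by (auto simp: space_R_def intro!: smooth_const)

lemma tB_smooth: "smooth test_dim (\<lambda>y. tB y i)"
proof (cases "1 \<le> i \<and> i \<le> length js")
  case True
  then show ?thesis unfolding tB_def
    by (cases "i = 1") (auto intro!: smooth_mult smooth_power smooth_coord smooth_const)
next
  case False
  then have "(\<lambda>y. tB y i) = (\<lambda>y. 0)" by (auto simp: tB_def)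
  then show ?thesis by (simp add: smooth_const)
qed

lemma tB_smooth_field: "smooth_field test_dim tB"
  unfolding smooth_field_iff
proof (intro conjI allI impI)
  show "tB \<in> space_R test_dim \<rightarrow> space_R test_dim" by (auto simp: space_R_def tB_def)
qed (rule tB_smooth)

sublocale perturbed_system test_dim tA tB
  by unfold_locales (rule tA_smooth_field, rule tB_smooth_field)

lemma state_space [simp]: "state \<epsilon> \<tau> t f \<in> space_R test_dim"
  by (simp add: state_def space_R_def)

lemma take_snoc:
  assumes "1 \<le> i" "i \<le> length js"
  shows "take i js = take (i - 1) js @ [js ! (i - 1)]" "1 \<le> js ! (i - 1)"
proof -
  show "take i js = take (i - 1) js @ [js ! (i - 1)]"
    using assms take_Suc_conv_app_nth[of "i - 1" js] by simp
  show "1 \<le> js ! (i - 1)" using assms pos by simp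
qed

lemma tB_state:
  assumes "1 \<le> i" "i \<le> length js" "f [] = 1"
  shows "tB (state \<epsilon> \<tau> t f) i = t ^ (js ! (i - 1) - 1) *
    (\<epsilon> ^ (i - 1) * \<tau> ^ sum_list (take (i - 1) js) * f (take (i - 1) js))"
  using assms by (cases "i = 1") (auto simp: tB_def state_def)

lemma flow_tA: "flow test_dim tA u (state \<epsilon> \<tau> t f) = state \<epsilon> \<tau> (t + u) f"
proof -
  have "solves_ode test_dim tA (closed_segment 0 u) (\<lambda>u. state \<epsilon> \<tau> (t + u) f)"
    unfolding solves_ode_def
  proof (intro ballI conjI allI impI)
    fix v i
    show "((\<lambda>v. state \<epsilon> \<tau> (t + v) f i) has_real_derivative tA (state \<epsilon> \<tau> (t + v) f) i) (at v within closed_segment 0 u)"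
      by (cases "i = 0") (auto simp: state_def tA_def intro!: derivative_eq_intros)
  qed simp
  from flow_eq[OF tA_smooth_field this] show ?thesis by simp
qed

text \<open>At time u the weight of the pulse is u/\<tau>. Its derivative brings a factor 1/\<tau>,
  and the remaining powers of \<tau> are those of (c \<tau>)^(a - 1) and of the preceding
  coordinate, as the test field demands.\<close>

lemma flow_tB:
  assumes \<tau>: "\<tau> \<noteq> 0" and f: "f [] = 1"
  shows "flow test_dim (\<lambda>y i. \<epsilon> * tB y i) (b * \<tau>) (state \<epsilon> \<tau> (c * \<tau>) f) = state \<epsilon> \<tau> (c * \<tau>) (pulse f c b)"
proof -
  have "solves_ode test_dim (\<lambda>y i. \<epsilon> * tB y i) (closed_segment 0 (b * \<tau>)) (\<lambda>u. state \<epsilon> \<tau> (c * \<tau>) (pulse f c (u / \<tau>)))"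
    unfolding solves_ode_def
  proof (intro ballI conjI allI impI)
    fix u i
    consider "i = 0" | "1 \<le> i" "i \<le> length js" | "length js < i" by linarith
    then have "((\<lambda>u. state \<epsilon> \<tau> (c * \<tau>) (pulse f c (u / \<tau>)) i) has_real_derivative
        \<epsilon> * tB (state \<epsilon> \<tau> (c * \<tau>) (pulse f c (u / \<tau>))) i) (at u)"
    proof cases
      case 2
      define v a where "v = take (i - 1) js" and "a = js ! (i - 1)"
      have va: "take i js = v @ [a]" "1 \<le> a" using take_snoc[OF 2] by (simp_all add: v_def a_def)
      have "((\<lambda>u. pulse f c (u / \<tau>) (v @ [a])) has_real_derivative c ^ (a - 1) * pulse f c (u / \<tau>) v * (1 / \<tau>)) (at u)"
        by (rule DERIV_chain2[OF pulse_deriv_snoc]) (auto intro!: derivative_eq_intros simp: \<tau>)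
      then have "((\<lambda>u. \<epsilon> ^ i * \<tau> ^ sum_list (v @ [a]) * pulse f c (u / \<tau>) (v @ [a])) has_real_derivative
          \<epsilon> ^ i * \<tau> ^ sum_list (v @ [a]) * (c ^ (a - 1) * pulse f c (u / \<tau>) v * (1 / \<tau>))) (at u)"
        by (rule DERIV_cmult)
      also have "\<epsilon> ^ i * \<tau> ^ sum_list (v @ [a]) * (c ^ (a - 1) * pulse f c (u / \<tau>) v * (1 / \<tau>)) =
          \<epsilon> * ((c * \<tau>) ^ (a - 1) * (\<epsilon> ^ (i - 1) * \<tau> ^ sum_list v * pulse f c (u / \<tau>) v))"
      proof -
        obtain a' i' where "a = Suc a'" "i = Suc i'" using va(2) 2(1) by (metis Suc_le_D One_nat_def)
        then show ?thesis using \<tau> by (simp add: power_add power_mult_distrib)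
      qed
      also have "\<dots> = \<epsilon> * tB (state \<epsilon> \<tau> (c * \<tau>) (pulse f c (u / \<tau>))) i"
        using tB_state[OF 2, of "pulse f c (u / \<tau>)" \<epsilon> \<tau> "c * \<tau>"] f by (simp add: v_def a_def)
      finally show ?thesis using 2 unfolding state_def va(1)[symmetric] by simp
    qed (auto simp: state_def tB_def)
    then show "((\<lambda>u. state \<epsilon> \<tau> (c * \<tau>) (pulse f c (u / \<tau>)) i) has_real_derivative
        \<epsilon> * tB (state \<epsilon> \<tau> (c * \<tau>) (pulse f c (u / \<tau>))) i) (at u within closed_segment 0 (b * \<tau>))"
      by (rule has_field_derivative_at_within)
  qed simp
  from flow_eq[OF smooth_field_scale[OF tB_smooth_field] this]
  have "flow test_dim (\<lambda>y i. \<epsilon> * tB y i) (b * \<tau>) (state \<epsilon> \<tau> (c * \<tau>) (pulse f c 0)) = state \<epsilon> \<tau> (c * \<tau>) (pulse f c b)"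
    using \<tau> by simp
  moreover have "pulse f c 0 = f" by (rule ext) simp
  ultimately show ?thesis by simp
qed

lemma flow_whole: "flow test_dim (\<lambda>y i. tA y i + \<epsilon> * tB y i) \<tau> (\<lambda>i. 0) = state \<epsilon> \<tau> \<tau> beta"
proof -
  have "solves_ode test_dim (\<lambda>y i. tA y i + \<epsilon> * tB y i) (closed_segment 0 \<tau>) (\<lambda>u. state \<epsilon> u u beta)"
    unfolding solves_ode_def
  proof (intro ballI conjI allI impI)
    fix u i
    consider "i = 0" | "1 \<le> i" "i \<le> length js" | "length js < i" by linarith
    then have "((\<lambda>u. state \<epsilon> u u beta i) has_real_derivative
        tA (state \<epsilon> u u beta) i + \<epsilon> * tB (state \<epsilon> u u beta) i) (at u)"
    proof cases
      case 2
      define v a where "v = take (i - 1) js" and "a = js ! (i - 1)"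
      have va: "take i js = v @ [a]" "1 \<le> a" using take_snoc[OF 2] by (simp_all add: v_def a_def)
      define n where "n = sum_list v + (a - 1)"
      have n: "sum_list (v @ [a]) = Suc n" using va(2) by (simp add: n_def)
      have "((\<lambda>u. \<epsilon> ^ i * u ^ Suc n * beta (v @ [a])) has_real_derivative
          \<epsilon> ^ i * (real (Suc n) * u ^ n) * beta (v @ [a])) (at u)"
        using DERIV_cmult_right[OF DERIV_cmult[OF DERIV_pow[of "Suc n" u]]] by simp
      also have "\<epsilon> ^ i * (real (Suc n) * u ^ n) * beta (v @ [a]) = \<epsilon> ^ i * u ^ n * beta v"
        unfolding beta_snoc n by simp
      also have "\<dots> = tA (state \<epsilon> u u beta) i + \<epsilon> * tB (state \<epsilon> u u beta) i"
      proof -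
        have "\<epsilon> ^ i = \<epsilon> * \<epsilon> ^ (i - 1)" using 2 by (cases i) auto
        then show ?thesis using 2 tB_state[OF 2, of beta \<epsilon> u u]
          by (simp add: v_def a_def tA_def n_def power_add)
      qed
      finally show ?thesis using 2 unfolding state_def n[symmetric] va(1)[symmetric] by simp
    qed (auto simp: state_def tB_def tA_def)
    then show "((\<lambda>u. state \<epsilon> u u beta i) has_real_derivative
        tA (state \<epsilon> u u beta) i + \<epsilon> * tB (state \<epsilon> u u beta) i) (at u within closed_segment 0 \<tau>)"
      by (rule has_field_derivative_at_within)
  qed simp
  from flow_eq[OF whole_smooth_field[unfolded whole_def] this]
  have "flow test_dim (\<lambda>y i. tA y i + \<epsilon> * tB y i) \<tau> (state \<epsilon> 0 0 beta) = state \<epsilon> \<tau> \<tau> beta" .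
  \<comment> \<open>Positive indices give every nonempty prefix positive weight, so the power of the
    scale 0 vanishes.\<close>
  moreover have "state \<epsilon> 0 0 beta = (\<lambda>i. 0)"
  proof
    fix i
    show "state \<epsilon> 0 0 beta i = 0"
    proof (cases "1 \<le> i \<and> i \<le> length js")
      case True
      then have "sum_list (take i js) > 0" using take_snoc[of i] by (simp only: sum_list_append) simp
      then show ?thesis using True by (simp add: state_def)
    qed (auto simp: state_def)
  qed
  ultimately show ?thesis by simp
qed

lemma splitting_state:
  assumes "\<tau> \<noteq> 0"
  shows "splitting (flow test_dim tA) (flow test_dim (\<lambda>y i. \<epsilon> * tB y i)) a b s \<tau> (\<lambda>i. 0) =
    state \<epsilon> \<tau> (c_coeff a (s + 1) * \<tau>) (alpha b (c_coeff a) s)"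
proof (induction s)
  case 0
  have "state \<epsilon> \<tau> 0 (alpha b (c_coeff a) 0) = (\<lambda>i. 0)"
    by (auto simp: state_def fun_eq_iff)
  moreover have "c_coeff a (0 + 1) = a 1" by (simp add: c_coeff_def)
  ultimately show ?case using flow_tA[of "a 1 * \<tau>" \<epsilon> \<tau> 0 "alpha b (c_coeff a) 0"]
    by (simp only: splitting.simps add_0)
next
  case (Suc s)
  have "alpha b (c_coeff a) (Suc s) = pulse (alpha b (c_coeff a) s) (c_coeff a (s + 1)) (b (s + 1))"
    by (rule ext) simp
  moreover have "c_coeff a (s + 1) * \<tau> + a (s + 2) * \<tau> = c_coeff a (Suc s + 1) * \<tau>"
    by (simp add: c_coeff_def algebra_simps)
  ultimately show ?case
    by (simp only: splitting.simps o_apply Suc flow_tB[where f = "alpha b (c_coeff a) s", OF assms alpha_Nil] flow_tA)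
qed

lemma test_error:
  assumes "splitting_generalized_order a b s m r"
  shows "error_expansion test_dim m r (\<lambda>\<epsilon> \<tau> i.
    splitting (flow test_dim tA) (flow test_dim (\<lambda>y i. \<epsilon> * tB y i)) a b s \<tau> (\<lambda>i. 0) i -
    flow test_dim (\<lambda>y i. tA y i + \<epsilon> * tB y i) \<tau> (\<lambda>i. 0) i)"
  using assms tA_smooth_field tB_smooth_field
  unfolding splitting_generalized_order_def has_generalized_order_def by (simp add: space_R_def)

text \<open>Coordinate 0 is advanced to c_(s+1) \<tau> by the method and to \<tau> by the exact
  flow. At \<epsilon> = 0 the terms with k \<ge> 1 and the remainder bound all vanish, so the two
  values agree at a single \<tau> that is not 0.\<close>

lemma order_implies_consistent:
  assumes "splitting_generalized_order a b s m r"
  shows "c_coeff a (s + 1) = 1"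
proof -
  obtain R C d where d: "d > 0" and E: "\<And>\<tau> \<epsilon> i. 0 < \<bar>\<tau>\<bar> \<Longrightarrow> \<bar>\<tau>\<bar> < d \<Longrightarrow> \<bar>\<epsilon>\<bar> < d \<Longrightarrow> i < test_dim \<Longrightarrow>
      \<bar>(splitting (flow test_dim tA) (flow test_dim (\<lambda>y i. \<epsilon> * tB y i)) a b s \<tau> (\<lambda>i. 0) i -
        flow test_dim (\<lambda>y i. tA y i + \<epsilon> * tB y i) \<tau> (\<lambda>i. 0) i) - (\<Sum>k=1..m. \<epsilon> ^ k * R k \<tau> i)\<bar> \<le> C * \<bar>\<epsilon>\<bar> ^ (m + 1)"
    by (rule error_expansion_components[OF test_error[OF assms]]) blast
  define \<tau> where "\<tau> = d / 2"
  have \<tau>: "\<tau> \<noteq> 0" "0 < \<bar>\<tau>\<bar>" "\<bar>\<tau>\<bar> < d" using d by (auto simp: \<tau>_def)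
  have "(\<Sum>k=1..m. 0 ^ k * R k \<tau> 0) = 0" by (rule sum.neutral) auto
  then have "\<bar>state 0 \<tau> (c_coeff a (s + 1) * \<tau>) (alpha b (c_coeff a) s) 0 - state 0 \<tau> \<tau> beta 0\<bar> \<le> 0"
    using E[OF \<tau>(2,3), of 0 0] d unfolding splitting_state[OF \<tau>(1)] flow_whole by simp
  then show ?thesis using \<tau>(1) by (simp add: state_def)
qed

lemma order_implies_condition:
  assumes order: "splitting_generalized_order a b s m r"
    and js: "js \<noteq> []" "length js \<le> m" "sum_list js \<le> r (length js)"
  shows "alpha b (c_coeff a) s js = beta js"
proof -
  have "alpha b (c_coeff a) s js - beta js = 0"
  proof (rule error_expansion_monomial[OF test_error[OF order], where i = "length js" and k = "length js"
        and n = "sum_list js"])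
    fix \<epsilon> \<tau> :: real assume "\<tau> \<noteq> 0"
    then show "splitting (flow test_dim tA) (flow test_dim (\<lambda>y i. \<epsilon> * tB y i)) a b s \<tau> (\<lambda>i. 0) (length js) -
        flow test_dim (\<lambda>y i. tA y i + \<epsilon> * tB y i) \<tau> (\<lambda>i. 0) (length js) =
        \<epsilon> ^ length js * \<tau> ^ sum_list js * (alpha b (c_coeff a) s js - beta js)"
      unfolding splitting_state[OF \<open>\<tau> \<noteq> 0\<close>] flow_whole
      using js(1) by (simp add: state_def right_diff_distrib)
  qed (use js in \<open>auto simp: Suc_le_eq\<close>)
  then show ?thesis by simp
qed

end

section \<open>The order conditions\<close>

text \<open>The bound is a parameter of the definition, so that it can be truncated to
  \<open>min (r k) n\<close> in the induction for symmetric methods.\<close>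

definition multi_index_conditions :: "(nat \<Rightarrow> real) \<Rightarrow> (nat \<Rightarrow> real) \<Rightarrow> nat \<Rightarrow> nat \<Rightarrow> (nat \<Rightarrow> nat) \<Rightarrow> bool" where
  "multi_index_conditions a b s m r \<longleftrightarrow> (\<forall>js. js \<noteq> [] \<and> (\<forall>j\<in>set js. 1 \<le> j) \<and> length js \<le> m \<and>
     sum_list js \<le> r (length js) \<longrightarrow> alpha b (c_coeff a) s js = beta js)"

lemma conditions_imp_words:
  assumes c: "c_coeff a (s + 1) = 1" and cond: "multi_index_conditions a b s m r"
    and w: "nB w \<le> m" "nB w \<noteq> 0 \<Longrightarrow> length w \<le> r (nB w)"
  shows "series_prod (splitting_steps a b s) w = 1 / fact (length w)"
proof (rule series_prod_splitting_steps_exact[OF c])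
  fix js assume js: "length js = nB w" "\<forall>j\<in>set js. 1 \<le> j" "sum_list js \<le> length w"
  show "alpha b (c_coeff a) s js = beta js"
  \<comment> \<open>A word with no second letter leads only to the empty multi-index, where both
    sides are 1; its coefficient is correct by consistency alone, whatever its length.\<close>
  proof (cases "js = []")
    case False
    then have "nB w \<noteq> 0" using js(1) by auto
    then have "sum_list js \<le> r (length js)" using w(2) js by simp
    moreover have "length js \<le> m" using w(1) js(1) by simp
    ultimately show ?thesis using cond js(2) False unfolding multi_index_conditions_def by blast
  qed simp
qed

lemma words_imp_order:
  assumes "c_coeff a (s + 1) = 1"
    and "\<And>w. 1 \<le> nB w \<Longrightarrow> nB w \<le> m \<Longrightarrow> length w \<le> r (nB w) \<Longrightarrow>
      series_prod (splitting_steps a b s) w = 1 / fact (length w)"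
  shows "splitting_generalized_order a b s m r"
  unfolding splitting_generalized_order_def
proof (intro allI impI)
  fix D fA fB assume "smooth_field D fA \<and> smooth_field D fB"
  then interpret perturbed_system D fA fB by unfold_locales auto
  show "has_generalized_order D fA fB (\<lambda>\<epsilon>. splitting (flow D fA) (flow D (\<lambda>y i. \<epsilon> * fB y i)) a b s) m r"
    by (rule generalized_order_sufficient) (use assms in auto)
qed

lemma order_iff_conditions:
  "splitting_generalized_order a b s m r \<longleftrightarrow> c_coeff a (s + 1) = 1 \<and> multi_index_conditions a b s m r"
proof
  assume order: "splitting_generalized_order a b s m r"
  have "c_coeff a (s + 1) = 1"
    by (rule test_system.order_implies_consistent[OF _ order, of "[]"]) (simp add: test_system_def)
  moreover have "multi_index_conditions a b s m r"
    unfolding multi_index_conditions_def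
    by (auto intro: test_system.order_implies_condition[OF _ order] simp: test_system_def)
  ultimately show "c_coeff a (s + 1) = 1 \<and> multi_index_conditions a b s m r" ..
next
  assume "c_coeff a (s + 1) = 1 \<and> multi_index_conditions a b s m r"
  then show "splitting_generalized_order a b s m r"
    by (intro words_imp_order conditions_imp_words[where m = m and r = r]) auto
qed

lemma lyndon_imp_conditions:
  assumes "\<forall>k l. 1 \<le> k \<and> k \<le> l \<and> l \<le> m \<longrightarrow> r l \<le> r k"
    and "\<And>js. lyndon js \<Longrightarrow> length js \<le> m \<Longrightarrow> sum_list js \<le> r (length js) \<Longrightarrow> alpha b (c_coeff a) s js = beta js"
  shows "multi_index_conditions a b s m r"
  unfolding multi_index_conditions_def
  using alpha_eq_beta_of_lyndon[of m r b "c_coeff a" s] assms by blast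

text \<open>For a symmetric method, the conditions with \<open>j\<^sub>1 + \<dots> + j\<^sub>k \<le> n\<close> are established by induction
  on \<open>n\<close>; for even \<open>n\<close> those with \<open>j\<^sub>1 + \<dots> + j\<^sub>k = n\<close> come from the symmetry.\<close>

lemma symmetric_conditions:
  assumes r: "\<forall>k l. 1 \<le> k \<and> k \<le> l \<and> l \<le> m \<longrightarrow> r l \<le> r k" and sym: "symmetric_coeffs a b s"
    and c: "c_coeff a (s + 1) = 1"
    and lyndon: "\<And>js. lyndon js \<Longrightarrow> length js \<le> m \<Longrightarrow> sum_list js \<le> r (length js) \<Longrightarrow> odd (sum_list js) \<Longrightarrow>
      alpha b (c_coeff a) s js = beta js"
  shows "multi_index_conditions a b s m (\<lambda>k. min (r k) n)"
proof (induction n)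
  case 0
  show ?case unfolding multi_index_conditions_def
  proof (intro allI impI)
    fix js :: "nat list"
    assume *: "js \<noteq> [] \<and> (\<forall>j\<in>set js. 1 \<le> j) \<and> length js \<le> m \<and> sum_list js \<le> min (r (length js)) 0"
    then obtain j where "j \<in> set js" by (cases js) auto
    with * show "alpha b (c_coeff a) s js = beta js" by auto
  qed
next
  case (Suc n)
  let ?r = "\<lambda>k. min (r k) (Suc n)"
  have anti: "\<forall>k l. 1 \<le> k \<and> k \<le> l \<and> l \<le> m \<longrightarrow> ?r l \<le> ?r k" using r by (intro allI impI min.mono) auto
  show ?case
  proof (cases "odd (Suc n)")
    case True
    show ?thesis
    proof (rule lyndon_imp_conditions[OF anti])
      fix js assume js: "lyndon js" "length js \<le> m" "sum_list js \<le> ?r (length js)"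
      show "alpha b (c_coeff a) s js = beta js"
      proof (cases "sum_list js \<le> n")
        case True
        then show ?thesis using Suc.IH js unfolding multi_index_conditions_def lyndon_def by auto
      next
        case False
        then have "sum_list js = Suc n" using js(3) by simp
        then show ?thesis using lyndon js \<open>odd (Suc n)\<close> by simp
      qed
    qed
  next
    case False
    \<comment> \<open>Palindromy speaks about words. The way back to multi-indices goes through the
      order itself: the words give the generalized order with the truncated bound, and its test
      systems return the conditions.\<close>
    have "splitting_generalized_order a b s m ?r"
    proof (rule words_imp_order[OF c])
      fix w assume w: "1 \<le> nB w" "nB w \<le> m" "length w \<le> ?r (nB w)"
      show "series_prod (splitting_steps a b s) w = 1 / fact (length w)"
      proof (cases "length w \<le> n")
        case True
        then show ?thesis using conditions_imp_words[OF c Suc.IH w(2)] w(3) by simp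
      next
        case False
        then have len: "length w = Suc n" using w(3) by simp
        \<comment> \<open>Both pieces of a cut of \<open>w\<close> have length at most
          \<open>n\<close> and no more second letters than \<open>w\<close>; since \<open>r\<close>
          is nonincreasing, the induction hypothesis covers them.\<close>
        have part: "series_prod (splitting_steps a b s) u = 1 / fact (length u)"
          if "length u \<le> n" "nB u \<le> nB w" for u
        proof (rule conditions_imp_words[OF c Suc.IH])
          show "nB u \<le> m" using that w by simp
          assume "nB u \<noteq> 0"
          then have "1 \<le> nB u" by linarith
          then have "r (nB w) \<le> r (nB u)" using r that(2) w(2) by blast
          then show "length u \<le> min (r (nB u)) n" using that w(3) len by simp
        qed
        have nB: "nB w = nB (take k w) + nB (drop k w)" for k
          by (metis append_take_drop_id filter_append length_append)
        show ?thesis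
        proof (rule series_prod_palindrome_even[OF rev_splitting_steps[OF sym]])
          show "even (length w)" using \<open>\<not> odd (Suc n)\<close> len by simp
          fix k assume k: "0 < k" "k < length w"
          show "series_prod (splitting_steps a b s) (take k w) = 1 / fact k"
            using part[of "take k w"] nB[of k] k len by simp
          show "series_prod (splitting_steps a b s) (drop k w) = 1 / fact (length w - k)"
            using part[of "drop k w"] nB[of k] k len by simp
        qed
      qed
    qed
    then show ?thesis using order_iff_conditions by blast
  qed
qed

theorem theorem1:
  fixes a b :: "nat \<Rightarrow> real" and s m :: nat and r :: "nat \<Rightarrow> nat"
  assumes "\<forall>k l. 1 \<le> k \<and> k \<le> l \<and> l \<le> m \<longrightarrow> r l \<le> r k"
  shows "(splitting_generalized_order a b s m r \<longleftrightarrow>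
            c_coeff a (s + 1) = 1 \<and>
            (\<forall>k\<in>{1..m}. \<forall>js. lyndon js \<and> length js = k \<and> sum_list js \<le> r k
               \<longrightarrow> order_condition a b s js)) \<and>
         (symmetric_coeffs a b s \<longrightarrow>
           (splitting_generalized_order a b s m r \<longleftrightarrow>
              c_coeff a (s + 1) = 1 \<and>
              (\<forall>k\<in>{1..m}. \<forall>js. lyndon js \<and> length js = k \<and> sum_list js \<le> r k \<and> odd (sum_list js)
                 \<longrightarrow> order_condition a b s js)))"
proof -
  have len: "length js \<in> {1..m} \<longleftrightarrow> length js \<le> m" if "lyndon js" for js
    using that by (cases js) (auto simp: lyndon_def)
  have nec: "order_condition a b s js"
    if "splitting_generalized_order a b s m r" "lyndon js" "length js \<le> m" "sum_list js \<le> r (length js)" for js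
    using that unfolding order_iff_conditions multi_index_conditions_def order_condition_iff lyndon_def by blast
  have "splitting_generalized_order a b s m r"
    if "c_coeff a (s + 1) = 1" and cond: "\<forall>k\<in>{1..m}. \<forall>js. lyndon js \<and> length js = k \<and> sum_list js \<le> r k
      \<longrightarrow> order_condition a b s js"
  proof -
    have "alpha b (c_coeff a) s js = beta js"
      if "lyndon js" "length js \<le> m" "sum_list js \<le> r (length js)" for js
      using cond len that unfolding order_condition_iff by blast
    then show ?thesis using that(1) lyndon_imp_conditions[OF assms] order_iff_conditions by blast
  qed
  moreover have "splitting_generalized_order a b s m r"
    if sym: "symmetric_coeffs a b s" and c: "c_coeff a (s + 1) = 1"
      and cond: "\<forall>k\<in>{1..m}. \<forall>js. lyndon js \<and> length js = k \<and> sum_list js \<le> r k \<and> odd (sum_list js)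
        \<longrightarrow> order_condition a b s js"
  proof -
    have odd: "alpha b (c_coeff a) s js = beta js"
      if "lyndon js" "length js \<le> m" "sum_list js \<le> r (length js)" "odd (sum_list js)" for js
      using cond len that unfolding order_condition_iff by blast
    have "multi_index_conditions a b s m r"
      unfolding multi_index_conditions_def
    proof (intro allI impI, elim conjE)
      fix js assume js: "js \<noteq> []" "\<forall>j\<in>set js. 1 \<le> j" "length js \<le> m" "sum_list js \<le> r (length js)"
      \<comment> \<open>Truncating at the weight of \<open>js\<close> itself is just enough for the
        bound to admit \<open>js\<close>.\<close>
      have "multi_index_conditions a b s m (\<lambda>k. min (r k) (sum_list js))"
        by (rule symmetric_conditions[OF assms sym c odd])
      then show "alpha b (c_coeff a) s js = beta js"
        using js unfolding multi_index_conditions_def by simp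
    qed
    then show ?thesis using c order_iff_conditions by blast
  qed
  moreover have "c_coeff a (s + 1) = 1" if "splitting_generalized_order a b s m r"
    using that order_iff_conditions by blast
  moreover have "\<forall>k\<in>{1..m}. \<forall>js. lyndon js \<and> length js = k \<and> sum_list js \<le> r k \<longrightarrow> order_condition a b s js"
    if "splitting_generalized_order a b s m r"
    by (intro ballI allI impI, elim conjE, rule nec[OF that]) auto
  ultimately show ?thesis by blast
qed

end
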